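(* Let $G$ and $H$ be ample groupoids with $\sigma$-compact unit spaces. The following are equivalent: (1) $G$ and $H$ are Kakutani equivalent; (2) there exist a $G$-full open set $X\subseteq G^{(0)}$ and an $H$-full open set $Y\subseteq H^{(0)}$ such that $G|_X\cong H|_Y$; (3) $G$ and $H$ are groupoid equivalent; (4) $G\times\mathcal{R}\cong H\times\mathcal{R}$.
   Context: An ample groupoid is a groupoid $G$ with a topology having a basis of compact open sets, such that inversion and composition are continuous, the unit space $G^{(0)}$ is Hausdorff, and the range and source maps $r,s:G\to G^{(0)}$ are local homeomorphisms. $G$ is not assumed Hausdorff or second countable. Isomorphism ($\cong$) means a groupoid isomorphism that is a homeomorphism. A space is $\sigma$-compact if it has a countable cover by compact sets. For $K\subseteq G^{(0)}$, $GK:=s^{-1}(K)$, $KG:=r^{-1}(K)$ and $G|_K:=KG\cap GK$. $K$ is $G$-full if $r(GK)=G^{(0)}$. Ample groupoids $G$ and $H$ are Kakutani equivalent if there are a $G$-full clopen $X\subseteq G^{(0)}$ and an $H$-full clopen $Y\subseteq H^{(0)}$ such that $G|_X\cong H|_Y$. $\mathcal{R}=\mathbb{N}\times\mathbb{N}$ is the full equivalence relation on $\mathbb{N}$, regarded as a discrete principal groupoid with unit space $\mathbb{N}$: $r(i,j)=i$, $s(i,j)=j$, $(i,j)(j,k)=(i,k)$, $(i,j)^{-1}=(j,i)$. $G\times\mathcal{R}$ is the ample groupoid with product topology and coordinatewise operations. A $G$--$H$ equivalence is a topological space $Z$ with commuting free and proper continuous actions of $G$ on the left and $H$ on the right (with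 continuous anchor maps $r:Z\to G^{(0)}$ and $s:Z\to H^{(0)}$) such that $r$ induces a homeomorphism $Z/H\cong G^{(0)}$ and $s$ induces a homeomorphism $G\backslash Z\cong H^{(0)}$. An action of $G$ on $Z$ is free if $g\cdot z=z$ implies $g$ is a unit, and proper if the map $(g,z)\mapsto(g\cdot z,z)$ from $\{(g,z)\in G\times Z:s(g)=r(z)\}$ to $Z\times Z$ is proper (closed with compact fibres); similarly for right actions. $G$ and $H$ are groupoid equivalent if a $G$--$H$ equivalence exists. *)

theory Defs
  imports "HOL-Analysis.Analysis"
begin

section \<open>Topological preliminaries\<close>

definition local_homeomorphism :: "'a topology \<Rightarrow> 'b topology \<Rightarrow> ('a \<Rightarrow> 'b) \<Rightarrow> bool" where
  "local_homeomorphism X Y f \<longleftrightarrow>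
     (\<forall>x\<in>topspace X. \<exists>U. openin X U \<and> x \<in> U \<and> openin Y (f ` U) \<and>
        homeomorphic_map (subtopology X U) (subtopology Y (f ` U)) f)"

definition has_compact_open_basis :: "'a topology \<Rightarrow> bool" where
  "has_compact_open_basis X \<longleftrightarrow>
     (\<exists>B. (\<forall>K\<in>B. compactin X K \<and> openin X K) \<and>
          openin X = arbitrary union_of (\<lambda>K. K \<in> B))"

definition sigma_compact_space :: "'a topology \<Rightarrow> bool" where
  "sigma_compact_space X \<longleftrightarrow>
     (\<exists>\<C>. countable \<C> \<and> (\<forall>K\<in>\<C>. compactin X K) \<and> \<Union>\<C> = topspace X)"

definition quotient_topology :: "'a topology \<Rightarrow> ('a \<Rightarrow> 'b) \<Rightarrow> 'b topology" where
  "quotient_topology X q =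
     topology (\<lambda>U. U \<subseteq> q ` topspace X \<and> openin X {x \<in> topspace X. q x \<in> U})"

lemma istopology_quotient:
  "istopology (\<lambda>U. U \<subseteq> q ` topspace X \<and> openin X {x \<in> topspace X. q x \<in> U})"
proof -
  have "openin X {x \<in> topspace X. q x \<in> S \<inter> T}"
    if "openin X {x \<in> topspace X. q x \<in> S}" "openin X {x \<in> topspace X. q x \<in> T}" for S T
  proof -
    have "{x \<in> topspace X. q x \<in> S \<inter> T} =
          {x \<in> topspace X. q x \<in> S} \<inter> {x \<in> topspace X. q x \<in> T}"
      by auto
    then show ?thesis using that by (simp add: openin_Int)
  qed
  moreover have "openin X {x \<in> topspace X. q x \<in> \<Union>\<K>}"
    if "\<And>K. K \<in> \<K> \<Longrightarrow> openin X {x \<in> topspace X. q x \<in> K}" for \<K>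
  proof -
    have "{x \<in> topspace X. q x \<in> \<Union>\<K>} = (\<Union>K\<in>\<K>. {x \<in> topspace X. q x \<in> K})"
      by auto
    then show ?thesis using that by auto
  qed
  ultimately show ?thesis
    unfolding istopology_def by blast
qed

lemma openin_quotient_topology:
  "openin (quotient_topology X q) U \<longleftrightarrow>
     U \<subseteq> q ` topspace X \<and> openin X {x \<in> topspace X. q x \<in> U}"
  unfolding quotient_topology_def topology_inverse'[OF istopology_quotient] ..

lemma topspace_quotient_topology [simp]:
  "topspace (quotient_topology X q) = q ` topspace X"
proof -
  have "{x \<in> topspace X. q x \<in> q ` topspace X} = topspace X" by auto
  then have "openin (quotient_topology X q) (q ` topspace X)"
    by (simp add: openin_quotient_topology)
  then show ?thesis
    by (meson openin_quotient_topology openin_subset openin_topspace subset_antisym)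
qed

lemma quotient_map_quotient_topology:
  "quotient_map X (quotient_topology X q) q"
  by (auto simp: quotient_map_def openin_quotient_topology)

section \<open>Groupoids\<close>

text \<open>The arrows of a groupoid are the points of its topology, and a unit is identified with its
  identity arrow, so that the range and source maps are functions from arrows to arrows. The
  multiplication \<open>gmult G x y\<close> is meaningful only when \<open>src G x = rng G y\<close>.\<close>

record 'a tgroupoid =
  gtop :: "'a topology"
  rng :: "'a \<Rightarrow> 'a"
  src :: "'a \<Rightarrow> 'a"
  gmult :: "'a \<Rightarrow> 'a \<Rightarrow> 'a"
  ginv :: "'a \<Rightarrow> 'a"

definition arrows :: "'a tgroupoid \<Rightarrow> 'a set" where
  "arrows G = topspace (gtop G)"

definition units :: "'a tgroupoid \<Rightarrow> 'a set" where
  "units G = src G ` arrows G"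

definition unit_space :: "'a tgroupoid \<Rightarrow> 'a topology" where
  "unit_space G = subtopology (gtop G) (units G)"

locale groupoid =
  fixes G :: "'a tgroupoid"
  assumes rng_closed: "x \<in> arrows G \<Longrightarrow> rng G x \<in> arrows G"
    and src_closed: "x \<in> arrows G \<Longrightarrow> src G x \<in> arrows G"
    and rng_rng: "x \<in> arrows G \<Longrightarrow> rng G (rng G x) = rng G x"
    and src_rng: "x \<in> arrows G \<Longrightarrow> src G (rng G x) = rng G x"
    and rng_src: "x \<in> arrows G \<Longrightarrow> rng G (src G x) = src G x"
    and src_src: "x \<in> arrows G \<Longrightarrow> src G (src G x) = src G x"
    and mult_closed: "\<lbrakk>x \<in> arrows G; y \<in> arrows G; src G x = rng G y\<rbrakk> \<Longrightarrow> gmult G x y \<in> arrows G"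
    and rng_mult: "\<lbrakk>x \<in> arrows G; y \<in> arrows G; src G x = rng G y\<rbrakk> \<Longrightarrow> rng G (gmult G x y) = rng G x"
    and src_mult: "\<lbrakk>x \<in> arrows G; y \<in> arrows G; src G x = rng G y\<rbrakk> \<Longrightarrow> src G (gmult G x y) = src G y"
    and mult_assoc: "\<lbrakk>x \<in> arrows G; y \<in> arrows G; z \<in> arrows G; src G x = rng G y; src G y = rng G z\<rbrakk>
      \<Longrightarrow> gmult G (gmult G x y) z = gmult G x (gmult G y z)"
    and rng_mult_left: "x \<in> arrows G \<Longrightarrow> gmult G (rng G x) x = x"
    and src_mult_right: "x \<in> arrows G \<Longrightarrow> gmult G x (src G x) = x"
    and inv_closed: "x \<in> arrows G \<Longrightarrow> ginv G x \<in> arrows G"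
    and rng_inv: "x \<in> arrows G \<Longrightarrow> rng G (ginv G x) = src G x"
    and src_inv: "x \<in> arrows G \<Longrightarrow> src G (ginv G x) = rng G x"
    and mult_inv_right: "x \<in> arrows G \<Longrightarrow> gmult G x (ginv G x) = rng G x"
    and mult_inv_left: "x \<in> arrows G \<Longrightarrow> gmult G (ginv G x) x = src G x"

locale ample_groupoid = groupoid +
  assumes compact_open_basis: "has_compact_open_basis (gtop G)"
    and continuous_inv: "continuous_map (gtop G) (gtop G) (ginv G)"
    and continuous_mult: "continuous_map
      (subtopology (prod_topology (gtop G) (gtop G)) {(x, y). src G x = rng G y})
      (gtop G) (\<lambda>(x, y). gmult G x y)"
    and Hausdorff_units: "Hausdorff_space (unit_space G)"
    and local_homeo_rng: "local_homeomorphism (gtop G) (unit_space G) (rng G)"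
    and local_homeo_src: "local_homeomorphism (gtop G) (unit_space G) (src G)"

definition groupoid_hom :: "'a tgroupoid \<Rightarrow> 'b tgroupoid \<Rightarrow> ('a \<Rightarrow> 'b) \<Rightarrow> bool" where
  "groupoid_hom G H \<phi> \<longleftrightarrow>
     (\<forall>x\<in>arrows G. \<phi> x \<in> arrows H) \<and>
     (\<forall>x\<in>arrows G. \<forall>y\<in>arrows G. src G x = rng G y \<longrightarrow>
        src H (\<phi> x) = rng H (\<phi> y) \<and> \<phi> (gmult G x y) = gmult H (\<phi> x) (\<phi> y))"

definition groupoid_isomorphic :: "'a tgroupoid \<Rightarrow> 'b tgroupoid \<Rightarrow> bool" where
  "groupoid_isomorphic G H \<longleftrightarrow>
     (\<exists>\<phi> \<psi>. homeomorphic_maps (gtop G) (gtop H) \<phi> \<psi> \<and>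
            groupoid_hom G H \<phi> \<and> groupoid_hom H G \<psi>)"

definition restrict_groupoid :: "'a tgroupoid \<Rightarrow> 'a set \<Rightarrow> 'a tgroupoid" where
  "restrict_groupoid G K =
     G\<lparr>gtop := subtopology (gtop G) {x. rng G x \<in> K \<and> src G x \<in> K}\<rparr>"

definition full_in :: "'a tgroupoid \<Rightarrow> 'a set \<Rightarrow> bool" where
  "full_in G K \<longleftrightarrow> rng G ` {x \<in> arrows G. src G x \<in> K} = units G"

definition Kakutani_equivalent :: "'a tgroupoid \<Rightarrow> 'b tgroupoid \<Rightarrow> bool" where
  "Kakutani_equivalent G H \<longleftrightarrow>
     (\<exists>X Y. openin (unit_space G) X \<and> closedin (unit_space G) X \<and> full_in G X \<and>
            openin (unit_space H) Y \<and> closedin (unit_space H) Y \<and> full_in H Y \<and>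
            groupoid_isomorphic (restrict_groupoid G X) (restrict_groupoid H Y))"

text \<open>As elsewhere, units are arrows: the unit \<open>i\<close> of the full equivalence relation on the natural
  numbers is the diagonal pair \<open>(i, i)\<close>.\<close>

definition full_relation :: "(nat \<times> nat) tgroupoid" where
  "full_relation =
     \<lparr>gtop = discrete_topology UNIV,
      rng = (\<lambda>(i, j). (i, i)),
      src = (\<lambda>(i, j). (j, j)),
      gmult = (\<lambda>(i, j) (k, l). (i, l)),
      ginv = (\<lambda>(i, j). (j, i))\<rparr>"

definition prod_groupoid :: "'a tgroupoid \<Rightarrow> 'b tgroupoid \<Rightarrow> ('a \<times> 'b) tgroupoid" where
  "prod_groupoid G H =
     \<lparr>gtop = prod_topology (gtop G) (gtop H),
      rng = (\<lambda>(x, y). (rng G x, rng H y)),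
      src = (\<lambda>(x, y). (src G x, src H y)),
      gmult = (\<lambda>(x, y) (x', y'). (gmult G x x', gmult H y y')),
      ginv = (\<lambda>(x, y). (ginv G x, ginv H y))\<rparr>"

section \<open>Actions and equivalences\<close>

locale left_action =
  fixes G :: "'a tgroupoid" and Z :: "'z topology" and anchor :: "'z \<Rightarrow> 'a"
    and act :: "'a \<Rightarrow> 'z \<Rightarrow> 'z"
  assumes anchor_continuous: "continuous_map Z (unit_space G) anchor"
    and act_continuous: "continuous_map
      (subtopology (prod_topology (gtop G) Z) {(g, z). src G g = anchor z}) Z
      (\<lambda>(g, z). act g z)"
    and anchor_act: "\<lbrakk>g \<in> arrows G; z \<in> topspace Z; src G g = anchor z\<rbrakk> \<Longrightarrow> anchor (act g z) = rng G g"
    and act_act: "\<lbrakk>g \<in> arrows G; h \<in> arrows G; z \<in> topspace Z; src G g = rng G h; src G h = anchor z\<rbrakk>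
      \<Longrightarrow> act (gmult G g h) z = act g (act h z)"
    and act_unit: "z \<in> topspace Z \<Longrightarrow> act (anchor z) z = z"

locale right_action =
  fixes H :: "'b tgroupoid" and Z :: "'z topology" and anchor :: "'z \<Rightarrow> 'b"
    and act :: "'z \<Rightarrow> 'b \<Rightarrow> 'z"
  assumes anchor_continuous: "continuous_map Z (unit_space H) anchor"
    and act_continuous: "continuous_map
      (subtopology (prod_topology Z (gtop H)) {(z, h). anchor z = rng H h}) Z
      (\<lambda>(z, h). act z h)"
    and anchor_act: "\<lbrakk>z \<in> topspace Z; h \<in> arrows H; anchor z = rng H h\<rbrakk> \<Longrightarrow> anchor (act z h) = src H h"
    and act_act: "\<lbrakk>z \<in> topspace Z; g \<in> arrows H; h \<in> arrows H; anchor z = rng H g; src H g = rng H h\<rbrakk>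
      \<Longrightarrow> act z (gmult H g h) = act (act z g) h"
    and act_unit: "z \<in> topspace Z \<Longrightarrow> act z (anchor z) = z"

definition free_left_action where
  "free_left_action G Z anchor act \<longleftrightarrow>
     (\<forall>g\<in>arrows G. \<forall>z\<in>topspace Z. src G g = anchor z \<longrightarrow> act g z = z \<longrightarrow> g \<in> units G)"

definition free_right_action where
  "free_right_action H Z anchor act \<longleftrightarrow>
     (\<forall>z\<in>topspace Z. \<forall>h\<in>arrows H. anchor z = rng H h \<longrightarrow> act z h = z \<longrightarrow> h \<in> units H)"

definition proper_left_action where
  "proper_left_action G Z anchor act \<longleftrightarrow>
     proper_map (subtopology (prod_topology (gtop G) Z) {(g, z). src G g = anchor z})
       (prod_topology Z Z) (\<lambda>(g, z). (act g z, z))"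

definition proper_right_action where
  "proper_right_action H Z anchor act \<longleftrightarrow>
     proper_map (subtopology (prod_topology Z (gtop H)) {(z, h). anchor z = rng H h})
       (prod_topology Z Z) (\<lambda>(z, h). (act z h, z))"

definition left_orbit where
  "left_orbit G anchor act z = {act g z | g. g \<in> arrows G \<and> src G g = anchor z}"

definition right_orbit where
  "right_orbit H anchor act z = {act z h | h. h \<in> arrows H \<and> anchor z = rng H h}"

definition induces_homeomorphism :: "'z topology \<Rightarrow> ('z \<Rightarrow> 'o) \<Rightarrow> 'c topology \<Rightarrow> ('z \<Rightarrow> 'c) \<Rightarrow> bool" where
  "induces_homeomorphism Z orb Y p \<longleftrightarrow>
     (\<exists>f. homeomorphic_map (quotient_topology Z orb) Y f \<and> (\<forall>z\<in>topspace Z. f (orb z) = p z))"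

definition is_groupoid_equivalence ::
  "'a tgroupoid \<Rightarrow> 'b tgroupoid \<Rightarrow> 'z topology \<Rightarrow> ('z \<Rightarrow> 'a) \<Rightarrow> ('z \<Rightarrow> 'b) \<Rightarrow>
   ('a \<Rightarrow> 'z \<Rightarrow> 'z) \<Rightarrow> ('z \<Rightarrow> 'b \<Rightarrow> 'z) \<Rightarrow> bool" where
  "is_groupoid_equivalence G H Z r s lact ract \<longleftrightarrow>
     left_action G Z r lact \<and> free_left_action G Z r lact \<and> proper_left_action G Z r lact \<and>
     right_action H Z s ract \<and> free_right_action H Z s ract \<and> proper_right_action H Z s ract \<and>
     (\<forall>g\<in>arrows G. \<forall>z\<in>topspace Z. src G g = r z \<longrightarrow> s (lact g z) = s z) \<and>
     (\<forall>z\<in>topspace Z. \<forall>h\<in>arrows H. s z = rng H h \<longrightarrow> r (ract z h) = r z) \<and>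
     (\<forall>g\<in>arrows G. \<forall>z\<in>topspace Z. \<forall>h\<in>arrows H. src G g = r z \<longrightarrow> s z = rng H h \<longrightarrow>
        ract (lact g z) h = lact g (ract z h)) \<and>
     induces_homeomorphism Z (right_orbit H s ract) (unit_space G) r \<and>
     induces_homeomorphism Z (left_orbit G r lact) (unit_space H) s"

text \<open>The equivalence space cannot range over all types inside a formula. Fixing the type
  \<open>'a \<times> 'b\<close> loses nothing: choosing one point in each fibre of the anchor map to the units of
  \<open>G\<close> embeds any equivalence space into \<open>units G \<times> arrows H\<close>. See lemma
  \<open>groupoid_equivalentI\<close> below.\<close>

definition groupoid_equivalent :: "'a tgroupoid \<Rightarrow> 'b tgroupoid \<Rightarrow> bool" where
  "groupoid_equivalent G H \<longleftrightarrow>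
     (\<exists>(Z :: ('a \<times> 'b) topology) r s lact ract. is_groupoid_equivalence G H Z r s lact ract)"

lemma induces_homeomorphism_iff:
  "induces_homeomorphism Z orb Y p \<longleftrightarrow>
     quotient_map Z Y p \<and> (\<forall>z\<in>topspace Z. \<forall>w\<in>topspace Z. p z = p w \<longleftrightarrow> orb z = orb w)"
  (is "?L \<longleftrightarrow> ?R")
proof
  assume ?L
  then obtain f where f: "homeomorphic_map (quotient_topology Z orb) Y f"
    and fp: "\<And>z. z \<in> topspace Z \<Longrightarrow> f (orb z) = p z"
    unfolding induces_homeomorphism_def by blast
  have "quotient_map Z Y (f \<circ> orb)"
    using f quotient_map_quotient_topology quotient_map_compose
    unfolding homeomorphic_map_def by blast
  then have "quotient_map Z Y p"
    by (rule quotient_map_eq) (simp add: fp)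
  moreover have "inj_on f (orb ` topspace Z)"
    using f by (simp add: homeomorphic_map_def)
  ultimately show ?R
    by (metis fp imageI inj_on_eq_iff)
next
  assume R: ?R
  define f where "f A = p (SOME z. z \<in> topspace Z \<and> orb z = A)" for A
  have fp: "f (orb z) = p z" if "z \<in> topspace Z" for z
  proof -
    have "(SOME w. w \<in> topspace Z \<and> orb w = orb z) \<in> topspace Z \<and>
          orb (SOME w. w \<in> topspace Z \<and> orb w = orb z) = orb z"
      by (rule someI[of _ z]) (use that in auto)
    then show ?thesis using R that unfolding f_def by blast
  qed
  have "quotient_map Z Y (f \<circ> orb)"
  proof (rule quotient_map_eq)
    show "quotient_map Z Y p" using R by blast
  qed (simp add: fp)
  then have "quotient_map (quotient_topology Z orb) Y f"
    using quotient_map_compose_eq[OF quotient_map_quotient_topology] by blast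
  moreover have "inj_on f (orb ` topspace Z)"
  proof (rule inj_onI)
    fix A B assume "A \<in> orb ` topspace Z" "B \<in> orb ` topspace Z" and eq: "f A = f B"
    then obtain z w where "z \<in> topspace Z" "A = orb z" "w \<in> topspace Z" "B = orb w" by auto
    then show "A = B" using R eq fp by metis
  qed
  ultimately show ?L
    unfolding induces_homeomorphism_def homeomorphic_map_def using fp by auto
qed

lemma left_act_closed:
  assumes "left_action G Z r act" "g \<in> arrows G" "z \<in> topspace Z" "src G g = r z"
  shows "act g z \<in> topspace Z"
proof -
  interpret left_action G Z r act by fact
  have "(g, z) \<in> topspace (subtopology (prod_topology (gtop G) Z) {(g, z). src G g = r z})"
    using assms by (simp add: arrows_def)
  then have "(\<lambda>(g, z). act g z) (g, z) \<in> topspace Z"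
    using continuous_map_funspace[OF act_continuous] by blast
  then show ?thesis by simp
qed

lemma right_act_closed:
  assumes "right_action H Z s act" "z \<in> topspace Z" "h \<in> arrows H" "s z = rng H h"
  shows "act z h \<in> topspace Z"
proof -
  interpret right_action H Z s act by fact
  have "(z, h) \<in> topspace (subtopology (prod_topology Z (gtop H)) {(z, h). s z = rng H h})"
    using assms by (simp add: arrows_def)
  then have "(\<lambda>(z, h). act z h) (z, h) \<in> topspace Z"
    using continuous_map_funspace[OF act_continuous] by blast
  then show ?thesis by simp
qed

lemma proper_map_transport:
  assumes "proper_map A B m" "homeomorphic_maps A' A p q" "homeomorphic_maps B B' u v"
    "\<And>x. x \<in> topspace A' \<Longrightarrow> u (m (p x)) = m' x"
  shows "proper_map A' B' m'"
proof -
  have "proper_map A' B' (u \<circ> (m \<circ> p))"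
    using assms homeomorphic_imp_proper_map homeomorphic_maps_imp_map proper_map_compose by metis
  moreover have "{x \<in> topspace A'. (u \<circ> (m \<circ> p)) x = y} = {x \<in> topspace A'. m' x = y}" for y
    using assms(4) by auto
  ultimately show ?thesis
    unfolding proper_map_def using assms(4) by (auto elim: closed_map_eq)
qed

lemma continuous_map_transport:
  assumes "continuous_map A B m" "homeomorphic_maps A' A p q" "homeomorphic_maps B B' u v"
    "\<And>x. x \<in> topspace A' \<Longrightarrow> u (m (p x)) = m' x"
  shows "continuous_map A' B' m'"
proof -
  have "continuous_map A' B' (u \<circ> (m \<circ> p))"
    using assms unfolding homeomorphic_maps_def by (meson continuous_map_compose)
  then show ?thesis
    by (rule continuous_map_eq) (simp add: assms)
qed

lemma is_groupoid_equivalence_transport: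
  assumes eq: "is_groupoid_equivalence G H Z r s lact ract"
    and hom: "homeomorphic_maps Z W f k"
  shows "is_groupoid_equivalence G H W (\<lambda>w. r (k w)) (\<lambda>w. s (k w))
           (\<lambda>g w. f (lact g (k w))) (\<lambda>w h. f (ract (k w) h))"
proof -
  have fk: "\<And>z. z \<in> topspace Z \<Longrightarrow> f z \<in> topspace W" "\<And>w. w \<in> topspace W \<Longrightarrow> k w \<in> topspace Z"
    "\<And>z. z \<in> topspace Z \<Longrightarrow> k (f z) = z" "\<And>w. w \<in> topspace W \<Longrightarrow> f (k w) = w"
    using hom by (auto simp: homeomorphic_maps_def dest: continuous_map_funspace)
  have kcont: "continuous_map W Z k" and khom: "homeomorphic_map W Z k"
    using hom by (auto simp: homeomorphic_maps_def homeomorphic_maps_sym intro: homeomorphic_maps_imp_map)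
  have la: "left_action G Z r lact" and ra: "right_action H Z s ract"
    using eq by (auto simp: is_groupoid_equivalence_def)
  interpret L: left_action G Z r lact by fact
  interpret R: right_action H Z s ract by fact
  note lc = left_act_closed[OF la] and rc = right_act_closed[OF ra]
  have comm: "\<And>g z. \<lbrakk>g \<in> arrows G; z \<in> topspace Z; src G g = r z\<rbrakk> \<Longrightarrow> s (lact g z) = s z"
    "\<And>z h. \<lbrakk>z \<in> topspace Z; h \<in> arrows H; s z = rng H h\<rbrakk> \<Longrightarrow> r (ract z h) = r z"
    "\<And>g z h. \<lbrakk>g \<in> arrows G; z \<in> topspace Z; h \<in> arrows H; src G g = r z; s z = rng H h\<rbrakk>
       \<Longrightarrow> ract (lact g z) h = lact g (ract z h)"
    using eq unfolding is_groupoid_equivalence_def by blast+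
  have homk: "homeomorphic_maps W Z k f"
    using hom homeomorphic_maps_sym by blast
  have idh: "homeomorphic_maps (gtop G) (gtop G) (\<lambda>x. x) (\<lambda>x. x)"
    "homeomorphic_maps (gtop H) (gtop H) (\<lambda>x. x) (\<lambda>x. x)"
    by (simp_all add: homeomorphic_maps_def)
  have pf: "homeomorphic_maps (prod_topology Z Z) (prod_topology W W)
      (\<lambda>(x, y). (f x, f y)) (\<lambda>(x, y). (k x, k y))"
    using hom by (simp add: homeomorphic_maps_prod)
  have domL: "homeomorphic_maps
      (subtopology (prod_topology (gtop G) W) {(g, w). src G g = r (k w)})
      (subtopology (prod_topology (gtop G) Z) {(g, z). src G g = r z})
      (\<lambda>(g, w). (g, k w)) (\<lambda>(g, z). (g, f z))"
  proof (rule homeomorphic_maps_subtopologies_alt)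
    show "homeomorphic_maps (prod_topology (gtop G) W) (prod_topology (gtop G) Z)
        (\<lambda>(g, w). (g, k w)) (\<lambda>(g, z). (g, f z))"
      using homk idh unfolding homeomorphic_maps_prod by simp
  qed (auto simp: fk)
  have domR: "homeomorphic_maps
      (subtopology (prod_topology W (gtop H)) {(w, h). s (k w) = rng H h})
      (subtopology (prod_topology Z (gtop H)) {(z, h). s z = rng H h})
      (\<lambda>(w, h). (k w, h)) (\<lambda>(z, h). (f z, h))"
  proof (rule homeomorphic_maps_subtopologies_alt)
    show "homeomorphic_maps (prod_topology W (gtop H)) (prod_topology Z (gtop H))
        (\<lambda>(w, h). (k w, h)) (\<lambda>(z, h). (f z, h))"
      using homk idh unfolding homeomorphic_maps_prod by simp
  qed (auto simp: fk)
  let ?r = "\<lambda>w. r (k w)" and ?s = "\<lambda>w. s (k w)"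
  let ?l = "\<lambda>g w. f (lact g (k w))" and ?a = "\<lambda>w h. f (ract (k w) h)"
  have LA: "left_action G W ?r ?l"
  proof
    show "continuous_map W (unit_space G) ?r"
      using continuous_map_compose[OF kcont L.anchor_continuous] by (simp add: o_def)
    show "continuous_map (subtopology (prod_topology (gtop G) W) {(g, w). src G g = r (k w)})
        W (\<lambda>(g, w). f (lact g (k w)))"
      by (rule continuous_map_transport[OF L.act_continuous domL hom]) auto
  qed (simp_all add: fk lc L.anchor_act L.act_act L.act_unit)
  have RA: "right_action H W ?s ?a"
  proof
    show "continuous_map W (unit_space H) ?s"
      using continuous_map_compose[OF kcont R.anchor_continuous] by (simp add: o_def)
    show "continuous_map (subtopology (prod_topology W (gtop H)) {(w, h). s (k w) = rng H h})
        W (\<lambda>(w, h). f (ract (k w) h))"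
      by (rule continuous_map_transport[OF R.act_continuous domR hom]) auto
  qed (simp_all add: fk rc R.anchor_act R.act_act R.act_unit)
  have FL: "free_left_action G W ?r ?l"
    using eq unfolding is_groupoid_equivalence_def free_left_action_def by (metis fk lc)
  have FR: "free_right_action H W ?s ?a"
    using eq unfolding is_groupoid_equivalence_def free_right_action_def by (metis fk rc)
  have PL: "proper_left_action G W ?r ?l"
    unfolding proper_left_action_def
    by (rule proper_map_transport[OF _ domL pf])
       (use eq in \<open>auto simp: is_groupoid_equivalence_def proper_left_action_def fk\<close>)
  have PR: "proper_right_action H W ?s ?a"
    unfolding proper_right_action_def
    by (rule proper_map_transport[OF _ domR pf])
       (use eq in \<open>auto simp: is_groupoid_equivalence_def proper_right_action_def fk\<close>)
  have orbL: "left_orbit G ?r ?l w = f ` left_orbit G r lact (k w)" for w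
    by (auto simp: left_orbit_def)
  have orbR: "right_orbit H ?s ?a w = f ` right_orbit H s ract (k w)" for w
    by (auto simp: right_orbit_def)
  have injf: "inj_on f (topspace Z)"
    using fk(3) by (rule inj_on_inverseI)
  have subL: "left_orbit G r lact z \<subseteq> topspace Z" if "z \<in> topspace Z" for z
    using that lc by (auto simp: left_orbit_def)
  have subR: "right_orbit H s ract z \<subseteq> topspace Z" if "z \<in> topspace Z" for z
    using that rc by (auto simp: right_orbit_def)
  have qk: "quotient_map W Z k"
    using khom by (simp add: homeomorphic_map_def)
  have QR: "induces_homeomorphism W (right_orbit H ?s ?a) (unit_space G) ?r"
  proof -
    have *: "quotient_map Z (unit_space G) r"
      "\<forall>z\<in>topspace Z. \<forall>w\<in>topspace Z. r z = r w \<longleftrightarrow> right_orbit H s ract z = right_orbit H s ract w"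
      using eq by (auto simp: is_groupoid_equivalence_def induces_homeomorphism_iff)
    have "quotient_map W (unit_space G) ?r"
      using quotient_map_compose[OF qk *(1)] by (simp add: o_def)
    moreover have "?r z = ?r w \<longleftrightarrow> right_orbit H ?s ?a z = right_orbit H ?s ?a w"
      if "z \<in> topspace W" "w \<in> topspace W" for z w
      unfolding orbR using *(2) that fk(2) inj_on_image_eq_iff[OF injf subR subR] by simp
    ultimately show ?thesis by (simp add: induces_homeomorphism_iff)
  qed
  have QL: "induces_homeomorphism W (left_orbit G ?r ?l) (unit_space H) ?s"
  proof -
    have *: "quotient_map Z (unit_space H) s"
      "\<forall>z\<in>topspace Z. \<forall>w\<in>topspace Z. s z = s w \<longleftrightarrow> left_orbit G r lact z = left_orbit G r lact w"
      using eq by (auto simp: is_groupoid_equivalence_def induces_homeomorphism_iff)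
    have "quotient_map W (unit_space H) ?s"
      using quotient_map_compose[OF qk *(1)] by (simp add: o_def)
    moreover have "?s z = ?s w \<longleftrightarrow> left_orbit G ?r ?l z = left_orbit G ?r ?l w"
      if "z \<in> topspace W" "w \<in> topspace W" for z w
      unfolding orbL using *(2) that fk(2) inj_on_image_eq_iff[OF injf subL subL] by simp
    ultimately show ?thesis by (simp add: induces_homeomorphism_iff)
  qed
  show ?thesis
    unfolding is_groupoid_equivalence_def
    using LA RA FL FR PL PR QL QR by (simp add: fk lc rc comm)
qed

lemma groupoid_equivalentI:
  fixes Z :: "'z topology"
  assumes H: "groupoid H"
    and eq: "is_groupoid_equivalence G H Z r s lact ract"
  shows "groupoid_equivalent G H"
proof -
  interpret H: groupoid H by fact
  have ra: "right_action H Z s ract"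
    and orb: "\<And>z w. \<lbrakk>z \<in> topspace Z; w \<in> topspace Z\<rbrakk> \<Longrightarrow>
      r z = r w \<longleftrightarrow> right_orbit H s ract z = right_orbit H s ract w"
    using eq by (auto simp: is_groupoid_equivalence_def induces_homeomorphism_iff)
  interpret R: right_action H Z s ract by fact
  define rep where "rep u = (SOME z. z \<in> topspace Z \<and> r z = u)" for u
  have rep: "rep (r z) \<in> topspace Z \<and> r (rep (r z)) = r z" if "z \<in> topspace Z" for z
    unfolding rep_def by (rule someI[of _ z]) (use that in auto)
  have ex: "\<exists>h. z = ract (rep (r z)) h" if z: "z \<in> topspace Z" for z
  proof -
    have "s z \<in> units H"
      using continuous_map_funspace[OF R.anchor_continuous] z by (auto simp: unit_space_def)
    then have "s z \<in> arrows H" "rng H (s z) = s z"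
      by (auto simp: units_def H.src_closed H.rng_src)
    then have "z \<in> right_orbit H s ract z"
      using R.act_unit[OF z] by (force simp: right_orbit_def)
    also have "right_orbit H s ract z = right_orbit H s ract (rep (r z))"
      using orb rep z by metis
    finally show ?thesis by (auto simp: right_orbit_def)
  qed
  define f where "f z = (r z, SOME h. z = ract (rep (r z)) h)" for z
  have "z = ract (rep (fst (f z))) (snd (f z))" if "z \<in> topspace Z" for z
    using someI_ex[OF ex[OF that]] by (simp add: f_def)
  then have "inj_on f (topspace Z)"
    by (rule inj_on_inverseI[where g = "\<lambda>p. ract (rep (fst p)) (snd p)", OF sym])
  then have "homeomorphic_map Z (quotient_topology Z f) f"
    by (simp add: homeomorphic_map_def quotient_map_quotient_topology)
  then obtain k where "homeomorphic_maps Z (quotient_topology Z f) f k"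
    by (auto simp: homeomorphic_map_maps)
  from is_groupoid_equivalence_transport[OF eq this] show ?thesis
    unfolding groupoid_equivalent_def by blast
qed

end

theory Submission
  imports Defs
begin

text \<open>An equivalence \<open>Z\<close> is the same thing as a bibundle whose anchor maps are open and surjective
  and whose actions have continuous division maps. Division shows that \<open>Z\<close> has a basis of compact
  open bisections, that is, sets on which both anchor maps are injective, and any open bisection \<open>W\<close>
  conjugates \<open>G|\<^bsub>r(W)\<^esub>\<close> into \<open>H|\<^bsub>s(W)\<^esub>\<close>. By \<open>\<sigma>\<close>-compactness countably many compact open bisections
  cover both unit spaces.

  Choosing greedily among them gives an open bisection with full clopen images, hence (3) implies (1).
  After multiplying with the full equivalence relation there is always room on an unused level, so a
  back-and-forth construction yields a bisection whose images are the whole unit spaces, hence (3)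
  implies (4). If \<open>A\<close> and \<open>B\<close> are full and open in \<open>K\<close>, then \<open>AKB\<close> is an equivalence between \<open>K|\<^bsub>A\<^esub>\<close>
  and \<open>K|\<^bsub>B\<^esub>\<close>; with \<open>K = G \<times> \<R>\<close> this shows that (4) implies (3). For (2) implies (4), the open sets are
  first shrunk to \<open>\<sigma>\<close>-compact ones, and then \<open>G\<close> and \<open>H\<close> are both stably isomorphic to the common
  restriction.\<close>

section \<open>Topological preliminaries\<close>

text \<open>Two obstacles shape the argument. Neither the arrow spaces nor an equivalence space need
  be Hausdorff, so a compact open set there need not be closed. Only the unit spaces are Hausdorff;
  a compact open bisection therefore has clopen images under both anchors, and all cutting down is
  done by removing preimages of such images. Division is what makes this workable: it replaces
  closedness and orbit arguments by explicit continuous formulas. Secondly, no countability is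
  assumed beyond sigma-compact unit spaces, and an open subset of a sigma-compact space need not be
  sigma-compact. This is why the restrictions in (2) cannot be stabilised directly. A suitable
  smaller full open set is a union of s-images of countably many bisections whose r-images cover the
  units of G. The implications are closed in the order (1), (2), (4), (3), (1). Taking both
  groupoids as corners of one \<open>K\<close> in (4) implies (3) produces the equivalence space as
  a set of arrows, which avoids composing equivalences by quotients.\<close>

text \<open>Continuity and openness can be glued from the chosen neighbourhoods; conversely an
  injective continuous open map is a homeomorphism onto its open image. Ampleness can then be
  checked as three separate conditions.\<close>

lemma local_homeomorphism_iff:
  "local_homeomorphism X Y f \<longleftrightarrow>
     continuous_map X Y f \<and> open_map X Y f \<and>
     (\<forall>x\<in>topspace X. \<exists>U. openin X U \<and> x \<in> U \<and> inj_on f U)"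
  (is "?L \<longleftrightarrow> ?R")
proof
  assume L: ?L
  then obtain U where U: "\<And>x. x \<in> topspace X \<Longrightarrow> openin X (U x)" "\<And>x. x \<in> topspace X \<Longrightarrow> x \<in> U x"
    "\<And>x. x \<in> topspace X \<Longrightarrow> openin Y (f ` U x)"
    "\<And>x. x \<in> topspace X \<Longrightarrow> homeomorphic_map (subtopology X (U x)) (subtopology Y (f ` U x)) f"
    unfolding local_homeomorphism_def by metis
  have ts: "topspace (subtopology X (U x)) = U x" if "x \<in> topspace X" for x
    using U(1)[OF that] openin_subset by fastforce
  have cont: "continuous_map (subtopology X (U x)) Y f" if "x \<in> topspace X" for x
    using homeomorphic_imp_continuous_map[OF U(4)[OF that]] by (simp add: continuous_map_in_subtopology)
  have "continuous_map X Y f"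
    unfolding continuous_map_def
  proof (intro conjI allI impI)
    show "f \<in> topspace X \<rightarrow> topspace Y"
      using U(2,3) openin_subset by fastforce
    fix V assume V: "openin Y V"
    show "openin X {x \<in> topspace X. f x \<in> V}"
    proof (subst openin_subopen, intro ballI)
      fix x assume x: "x \<in> {x \<in> topspace X. f x \<in> V}"
      then have "openin (subtopology X (U x)) {y \<in> topspace (subtopology X (U x)). f y \<in> V}"
        using openin_continuous_map_preimage[OF cont V] by blast
      moreover have "topspace (subtopology X (U x)) = U x" using ts x by blast
      ultimately have "openin (subtopology X (U x)) {y \<in> U x. f y \<in> V}"
        by (simp only:)
      then have "openin X {y \<in> U x. f y \<in> V}"
        using U(1) x openin_trans_full by blast
      then show "\<exists>T. openin X T \<and> x \<in> T \<and> T \<subseteq> {x \<in> topspace X. f x \<in> V}"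
        using U(2)[of x] x openin_subset by (intro exI[of _ "{y \<in> U x. f y \<in> V}"]) auto
    qed
  qed
  moreover have "open_map X Y f"
    unfolding open_map_def
  proof (intro allI impI)
    fix V assume V: "openin X V"
    show "openin Y (f ` V)"
    proof (subst openin_subopen, intro ballI)
      fix y assume "y \<in> f ` V"
      then obtain x where x: "x \<in> V" "y = f x" by blast
      then have xX: "x \<in> topspace X" using V openin_subset by blast
      have "openin (subtopology X (U x)) (V \<inter> U x)"
        using V by (simp add: openin_subtopology_Int)
      then have "openin (subtopology Y (f ` U x)) (f ` (V \<inter> U x))"
        using homeomorphic_imp_open_map[OF U(4)[OF xX]] by (simp add: open_map_def)
      then have "openin Y (f ` (V \<inter> U x))"
        using U(3)[OF xX] openin_trans_full by blast
      then show "\<exists>T. openin Y T \<and> y \<in> T \<and> T \<subseteq> f ` V"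
        using x U(2)[OF xX] by blast
    qed
  qed
  moreover have "inj_on f (U x)" if "x \<in> topspace X" for x
    using homeomorphic_imp_injective_map[OF U(4)[OF that]] ts[OF that] by simp
  ultimately show ?R using U(1,2) by blast
next
  assume R: ?R
  show ?L
    unfolding local_homeomorphism_def
  proof
    fix x assume "x \<in> topspace X"
    then obtain U where U: "openin X U" "x \<in> U" "inj_on f U" using R by blast
    have ts: "topspace (subtopology X U) = U" using openin_subset[OF U(1)] by auto
    have fU: "openin Y (f ` U)" using R U(1) by (simp add: open_map_def)
    then have ts': "topspace (subtopology Y (f ` U)) = f ` U" using openin_subset by fastforce
    have "homeomorphic_map (subtopology X U) (subtopology Y (f ` U)) f"
    proof (rule bijective_open_imp_homeomorphic_map)
      show "continuous_map (subtopology X U) (subtopology Y (f ` U)) f"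
        using R by (auto simp: continuous_map_in_subtopology intro: continuous_map_from_subtopology)
      show "open_map (subtopology X U) (subtopology Y (f ` U)) f"
        unfolding open_map_def openin_open_subtopology[OF U(1)] openin_open_subtopology[OF fU]
        using R by (auto simp: open_map_def)
    qed (simp_all only: ts ts' U(3))
    then show "\<exists>U. openin X U \<and> x \<in> U \<and> openin Y (f ` U) \<and>
        homeomorphic_map (subtopology X U) (subtopology Y (f ` U)) f"
      using U fU by blast
  qed
qed

text \<open>If some basis consists of compact open sets, then all compact open sets together form
  one, so no particular basis has to be carried along. The pointwise form passes easily to open
  subspaces and products.\<close>

lemma has_compact_open_basis_iff:
  "has_compact_open_basis X \<longleftrightarrow>
     (\<forall>U x. openin X U \<longrightarrow> x \<in> U \<longrightarrow> (\<exists>K. compactin X K \<and> openin X K \<and> x \<in> K \<and> K \<subseteq> U))"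
  (is "?L \<longleftrightarrow> ?R")
proof
  assume ?L
  then obtain B where B: "\<forall>K\<in>B. compactin X K \<and> openin X K"
    "openin X = arbitrary union_of (\<lambda>K. K \<in> B)"
    unfolding has_compact_open_basis_def by blast
  show ?R
  proof (intro allI impI)
    fix U x assume "openin X U" "x \<in> U"
    then obtain K where "K \<in> B" "x \<in> K" "K \<subseteq> U"
      unfolding B(2) arbitrary_union_of_alt by blast
    then show "\<exists>K. compactin X K \<and> openin X K \<and> x \<in> K \<and> K \<subseteq> U" using B(1) by blast
  qed
next
  assume R: ?R
  have "openin X U \<longleftrightarrow> (arbitrary union_of (\<lambda>K. K \<in> {K. compactin X K \<and> openin X K})) U" for U
  proof
    assume "openin X U"
    with R show "(arbitrary union_of (\<lambda>K. K \<in> {K. compactin X K \<and> openin X K})) U"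
      unfolding arbitrary_union_of_alt by blast
  next
    assume "(arbitrary union_of (\<lambda>K. K \<in> {K. compactin X K \<and> openin X K})) U"
    then show "openin X U"
      unfolding arbitrary_union_of_alt by (subst openin_subopen) blast
  qed
  then have "openin X = arbitrary union_of (\<lambda>K. K \<in> {K. compactin X K \<and> openin X K})"
    by (rule ext)
  moreover have "\<forall>K\<in>{K. compactin X K \<and> openin X K}. compactin X K \<and> openin X K"
    by simp
  ultimately show ?L
    unfolding has_compact_open_basis_def by (intro exI[of _ "{K. compactin X K \<and> openin X K}"] conjI)
qed

lemma has_compact_open_basis_subtopology:
  assumes "has_compact_open_basis X" "openin X S"
  shows "has_compact_open_basis (subtopology X S)"
  unfolding has_compact_open_basis_iff
proof (intro allI impI)
  fix U x assume "openin (subtopology X S) U" "x \<in> U"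
  then have U: "openin X U" "x \<in> U" "U \<subseteq> S"
    using assms(2) by (auto simp: openin_open_subtopology)
  then obtain K where "compactin X K" "openin X K" "x \<in> K" "K \<subseteq> U"
    using assms(1) unfolding has_compact_open_basis_iff by meson
  then show "\<exists>K. compactin (subtopology X S) K \<and> openin (subtopology X S) K \<and> x \<in> K \<and> K \<subseteq> U"
    using assms(2) U by (intro exI[of _ K]) (auto simp: openin_open_subtopology compactin_subtopology)
qed

lemma has_compact_open_basis_prod:
  assumes "has_compact_open_basis X" "has_compact_open_basis Y"
  shows "has_compact_open_basis (prod_topology X Y)"
  unfolding has_compact_open_basis_iff
proof (intro allI impI)
  fix U p assume U: "openin (prod_topology X Y) U" "p \<in> U"
  obtain x y where p: "p = (x, y)" by force
  then obtain V W where V: "openin X V" "x \<in> V" and W: "openin Y W" "y \<in> W" and VW: "V \<times> W \<subseteq> U"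
    using U unfolding openin_prod_topology_alt by blast
  obtain K where K: "compactin X K" "openin X K" "x \<in> K" "K \<subseteq> V"
    using assms(1) V unfolding has_compact_open_basis_iff by meson
  obtain L where L: "compactin Y L" "openin Y L" "y \<in> L" "L \<subseteq> W"
    using assms(2) W unfolding has_compact_open_basis_iff by meson
  have "K \<times> L \<subseteq> U" using K(4) L(4) VW by blast
  then show "\<exists>K. compactin (prod_topology X Y) K \<and> openin (prod_topology X Y) K \<and> p \<in> K \<and> K \<subseteq> U"
    using p K L by (intro exI[of _ "K \<times> L"]) (simp add: compactin_Times openin_prod_Times_iff)
qed

text \<open>Groupoid operations and actions are continuous only on a subspace of matching pairs. The
  paired map of \<open>u\<close> and \<open>v\<close> lands in that subspace, so it can be composed
  with the operation.\<close>

lemma continuous_map_partial: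
  assumes "continuous_map (subtopology (prod_topology A B) {(x, y). P x y}) C (\<lambda>(x, y). f x y)"
    and "continuous_map T A u" "continuous_map T B v" "\<And>t. t \<in> topspace T \<Longrightarrow> P (u t) (v t)"
  shows "continuous_map T C (\<lambda>t. f (u t) (v t))"
proof -
  have "continuous_map T C ((\<lambda>(x, y). f x y) \<circ> (\<lambda>t. (u t, v t)))"
    by (rule continuous_map_compose[OF _ assms(1)])
       (use assms in \<open>auto simp: continuous_map_in_subtopology continuous_map_paired\<close>)
  then show ?thesis by (simp add: o_def)
qed

text \<open>The partial operations of a product are the products of the partial operations, up to a
  permutation of the coordinates.\<close>

lemma continuous_map_prod_partial:
  assumes f: "continuous_map (subtopology (prod_topology A B) {(x, y). P x y}) C (\<lambda>(x, y). f x y)"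
    and g: "continuous_map (subtopology (prod_topology A' B') {(x, y). P' x y}) C' (\<lambda>(x, y). g x y)"
    and S: "S \<subseteq> {(p, q). P (fst p) (fst q) \<and> P' (snd p) (snd q)}"
    and h: "\<And>p q. (p, q) \<in> S \<Longrightarrow> h p q = (f (fst p) (fst q), g (snd p) (snd q))"
  shows "continuous_map (subtopology (prod_topology (prod_topology A A') (prod_topology B B')) S)
     (prod_topology C C') (\<lambda>(p, q). h p q)"
proof -
  let ?T = "subtopology (prod_topology (prod_topology A A') (prod_topology B B')) S"
  have id: "continuous_map ?T (prod_topology (prod_topology A A') (prod_topology B B')) (\<lambda>x. x)"
    by (simp add: continuous_map_from_subtopology)
  note comps = continuous_map_fst_of[OF id, unfolded o_def] continuous_map_snd_of[OF id, unfolded o_def]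
  have fst2: "continuous_map ?T A (\<lambda>x. fst (fst x))" "continuous_map ?T B (\<lambda>x. fst (snd x))"
    and snd2: "continuous_map ?T A' (\<lambda>x. snd (fst x))" "continuous_map ?T B' (\<lambda>x. snd (snd x))"
    using comps[THEN continuous_map_fst_of] comps[THEN continuous_map_snd_of] by (simp_all add: o_def)
  have "continuous_map ?T C (\<lambda>x. f (fst (fst x)) (fst (snd x)))"
    by (rule continuous_map_partial[OF f fst2]) (use S in auto)
  moreover have "continuous_map ?T C' (\<lambda>x. g (snd (fst x)) (snd (snd x)))"
    by (rule continuous_map_partial[OF g snd2]) (use S in auto)
  ultimately have "continuous_map ?T (prod_topology C C')
      (\<lambda>x. (f (fst (fst x)) (fst (snd x)), g (snd (fst x)) (snd (snd x))))"
    by (simp add: continuous_map_paired)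
  then show ?thesis
    by (rule continuous_map_eq) (auto simp: h)
qed

lemma open_map_prod:
  assumes f: "open_map X X' f" and g: "open_map Y Y' g"
  shows "open_map (prod_topology X Y) (prod_topology X' Y') (\<lambda>(x, y). (f x, g y))"
  unfolding open_map_def
proof (intro allI impI)
  fix W assume W: "openin (prod_topology X Y) W"
  show "openin (prod_topology X' Y') ((\<lambda>(x, y). (f x, g y)) ` W)"
  proof (subst openin_subopen, intro ballI)
    fix p assume "p \<in> (\<lambda>(x, y). (f x, g y)) ` W"
    then obtain x y where xy: "(x, y) \<in> W" "p = (f x, g y)" by auto
    obtain U V where "openin X U" "openin Y V" "x \<in> U" "y \<in> V" "U \<times> V \<subseteq> W"
      using W xy(1) unfolding openin_prod_topology_alt by metis
    then have "openin (prod_topology X' Y') (f ` U \<times> g ` V)" "p \<in> f ` U \<times> g ` V"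
      using f g xy by (simp_all add: openin_prod_Times_iff open_map_def)
    moreover have "f ` U \<times> g ` V \<subseteq> (\<lambda>(x, y). (f x, g y)) ` W"
      using \<open>U \<times> V \<subseteq> W\<close> by force
    ultimately show "\<exists>T. openin (prod_topology X' Y') T \<and> p \<in> T \<and> T \<subseteq> (\<lambda>(x, y). (f x, g y)) ` W"
      by blast
  qed
qed

section \<open>Groupoids\<close>

context groupoid
begin

lemma units_iff: "u \<in> units G \<longleftrightarrow> u \<in> arrows G \<and> src G u = u"
  by (auto simp: units_def src_src src_closed intro: rev_image_eqI)

lemma rng_unit: "u \<in> units G \<Longrightarrow> rng G u = u"
  by (metis rng_src units_iff)

lemma src_in_units: "x \<in> arrows G \<Longrightarrow> src G x \<in> units G"
  by (simp add: units_def)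

lemma rng_in_units: "x \<in> arrows G \<Longrightarrow> rng G x \<in> units G"
  by (simp add: units_iff rng_closed src_rng)

lemma inv_mult_cancel:
  assumes "x \<in> arrows G" "y \<in> arrows G" "src G x = rng G y"
  shows "gmult G (ginv G x) (gmult G x y) = y"
  using assms mult_assoc[of "ginv G x" x y]
  by (simp add: inv_closed src_inv mult_inv_left rng_mult_left)

lemma mult_inv_cancel:
  assumes "x \<in> arrows G" "y \<in> arrows G" "rng G x = rng G y"
  shows "gmult G x (gmult G (ginv G x) y) = y"
  using assms mult_assoc[of x "ginv G x" y]
  by (simp add: inv_closed src_inv rng_inv mult_inv_right rng_mult_left)

lemma mult_inv_cancel_right:
  assumes "x \<in> arrows G" "y \<in> arrows G" "src G x = rng G y"
  shows "gmult G (gmult G x y) (ginv G y) = x"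
  using assms mult_assoc[of x y "ginv G y"] src_mult_right[of x]
  by (simp add: inv_closed rng_inv mult_inv_right)

lemma inv_mult_cancel_right:
  assumes "x \<in> arrows G" "y \<in> arrows G" "src G x = src G y"
  shows "gmult G (gmult G x (ginv G y)) y = x"
  using assms mult_assoc[of x "ginv G y" y] src_mult_right[of x]
  by (simp add: inv_closed rng_inv src_inv mult_inv_left)

lemma inv_inv: "x \<in> arrows G \<Longrightarrow> ginv G (ginv G x) = x"
  using inv_mult_cancel[of "ginv G x" x] src_mult_right[of "ginv G (ginv G x)"]
  by (simp add: inv_closed src_inv rng_inv mult_inv_left)

text \<open>Both candidates, multiplied to \<open>?z\<close> from the right, give
  \<open>rng G x\<close>; cancelling \<open>?z\<close> on the left makes them equal.\<close>

lemma inv_mult: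
  assumes "x \<in> arrows G" "y \<in> arrows G" "src G x = rng G y"
  shows "ginv G (gmult G x y) = gmult G (ginv G y) (ginv G x)"
proof -
  let ?z = "gmult G x y"
  have z: "?z \<in> arrows G" "rng G ?z = rng G x" "src G ?z = src G y"
    using assms by (simp_all add: mult_closed rng_mult src_mult)
  have "gmult G ?z (gmult G (ginv G y) (ginv G x)) = gmult G (gmult G ?z (ginv G y)) (ginv G x)"
    using assms z mult_assoc[of ?z "ginv G y" "ginv G x"] by (simp add: inv_closed src_inv rng_inv)
  also have "\<dots> = rng G x"
    using assms by (simp add: mult_inv_cancel_right mult_inv_right)
  finally have eq: "gmult G ?z (gmult G (ginv G y) (ginv G x)) = gmult G ?z (ginv G ?z)"
    using z by (simp add: mult_inv_right)
  have "ginv G ?z = gmult G (ginv G ?z) (gmult G ?z (ginv G ?z))"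
    by (rule inv_mult_cancel[symmetric]) (simp_all add: z inv_closed rng_inv)
  also have "\<dots> = gmult G (ginv G ?z) (gmult G ?z (gmult G (ginv G y) (ginv G x)))"
    by (simp only: eq)
  also have "\<dots> = gmult G (ginv G y) (ginv G x)"
    by (rule inv_mult_cancel) (use assms z in \<open>simp_all add: inv_closed src_inv rng_inv mult_closed rng_mult\<close>)
  finally show ?thesis .
qed

lemma inv_unit: "u \<in> units G \<Longrightarrow> ginv G u = u"
  by (metis inv_closed mult_inv_left rng_inv rng_mult_left rng_unit src_inv src_mult_right units_iff)

lemma inv_in_units: "x \<in> arrows G \<Longrightarrow> ginv G x \<in> units G \<Longrightarrow> x \<in> units G"
  by (metis inv_inv inv_unit)

lemma topspace_unit_space: "topspace (unit_space G) = units G"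
  unfolding unit_space_def topspace_subtopology arrows_def[symmetric] using units_iff by blast

end

lemma topspace_gtop: "topspace (gtop G) = arrows G"
  by (simp add: arrows_def)

lemma open_map_into_open_subtopology:
  assumes "openin Y S" "f ` topspace X \<subseteq> S"
  shows "open_map X (subtopology Y S) f \<longleftrightarrow> open_map X Y f"
proof -
  have "f ` U \<subseteq> S" if "openin X U" for U
    using assms(2) openin_subset[OF that] by blast
  then show ?thesis
    unfolding open_map_def openin_open_subtopology[OF assms(1)] by auto
qed

context ample_groupoid
begin

lemma src_continuous: "continuous_map (gtop G) (gtop G) (src G)"
  using local_homeo_src by (simp add: local_homeomorphism_iff unit_space_def continuous_map_in_subtopology)

lemma rng_continuous: "continuous_map (gtop G) (gtop G) (rng G)"
  using local_homeo_rng by (simp add: local_homeomorphism_iff unit_space_def continuous_map_in_subtopology)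

text \<open>Around a unit choose an open \<open>U\<close> on which \<open>src\<close> is injective.
  An arrow x of \<open>U\<close> whose source also lies in \<open>U\<close> has the same source as
  the unit \<open>src G x\<close>, so it equals that unit.\<close>

lemma open_units: "openin (gtop G) (units G)"
proof (subst openin_subopen, intro ballI)
  fix u assume u: "u \<in> units G"
  then have "u \<in> topspace (gtop G)" by (simp add: units_iff topspace_gtop)
  then obtain U where U: "openin (gtop G) U" "u \<in> U" "inj_on (src G) U"
    using local_homeo_src unfolding local_homeomorphism_iff by blast
  let ?V = "{x \<in> topspace (gtop G). src G x \<in> U} \<inter> U"
  have "openin (gtop G) ?V"
    using openin_continuous_map_preimage[OF src_continuous U(1)] U(1) by blast
  moreover have "?V \<subseteq> units G"
    using U(3) by (auto simp: units_iff topspace_gtop inj_on_def src_src)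
  ultimately show "\<exists>T. openin (gtop G) T \<and> u \<in> T \<and> T \<subseteq> units G"
    using U(2) u by (intro exI[of _ ?V]) (auto simp: units_iff topspace_gtop)
qed

lemma openin_unit_space: "openin (unit_space G) X \<longleftrightarrow> openin (gtop G) X \<and> X \<subseteq> units G"
  by (simp add: unit_space_def openin_open_subtopology open_units)

lemma open_src: "openin (gtop G) U \<Longrightarrow> openin (gtop G) (src G ` U)"
  using local_homeo_src openin_unit_space by (auto simp: local_homeomorphism_iff open_map_def)

lemma open_rng: "openin (gtop G) U \<Longrightarrow> openin (gtop G) (rng G ` U)"
  using local_homeo_rng openin_unit_space by (auto simp: local_homeomorphism_iff open_map_def)

lemma compact_open_basis_units: "has_compact_open_basis (unit_space G)"
  unfolding unit_space_def by (intro has_compact_open_basis_subtopology compact_open_basis open_units)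

lemma continuous_map_units: "continuous_map T (unit_space G) f \<Longrightarrow> continuous_map T (gtop G) f"
  by (simp add: unit_space_def continuous_map_in_subtopology)

lemmas continuous_map_mult = continuous_map_partial[OF continuous_mult]

lemma continuous_map_ginv: "continuous_map T (gtop G) f \<Longrightarrow> continuous_map T (gtop G) (\<lambda>t. ginv G (f t))"
  using continuous_map_compose[OF _ continuous_inv, of T f] by (simp add: o_def)

lemma continuous_map_src: "continuous_map T (gtop G) f \<Longrightarrow> continuous_map T (gtop G) (\<lambda>t. src G (f t))"
  using continuous_map_compose[OF _ src_continuous, of T f] by (simp add: o_def)

lemma continuous_map_rng: "continuous_map T (gtop G) f \<Longrightarrow> continuous_map T (gtop G) (\<lambda>t. rng G (f t))"
  using continuous_map_compose[OF _ rng_continuous, of T f] by (simp add: o_def)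

end

text \<open>Only the source map has to be tested: the range map is its composite with inversion,
  which is a homeomorphism, and so inherits continuity, openness and local injectivity.\<close>

lemma ample_groupoidI:
  assumes "groupoid G"
    and "has_compact_open_basis (gtop G)"
    and inv: "continuous_map (gtop G) (gtop G) (ginv G)"
    and "continuous_map (subtopology (prod_topology (gtop G) (gtop G)) {(x, y). src G x = rng G y})
      (gtop G) (\<lambda>(x, y). gmult G x y)"
    and "Hausdorff_space (unit_space G)"
    and src: "continuous_map (gtop G) (gtop G) (src G)" "open_map (gtop G) (gtop G) (src G)"
    and inj: "\<And>x. x \<in> arrows G \<Longrightarrow> \<exists>U. openin (gtop G) U \<and> x \<in> U \<and> inj_on (src G) U"
  shows "ample_groupoid G"
proof -
  interpret groupoid G by fact
  have open_units: "openin (gtop G) (units G)"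
    using src(2) by (simp add: units_def open_map_def arrows_def)
  have inv_hom: "homeomorphic_maps (gtop G) (gtop G) (ginv G) (ginv G)"
    using inv by (simp add: homeomorphic_maps_def inv_inv topspace_gtop)
  have rng_eq: "rng G x = (src G \<circ> ginv G) x" if "x \<in> topspace (gtop G)" for x
    using that by (simp add: src_inv topspace_gtop)
  have "local_homeomorphism (gtop G) (unit_space G) (src G)"
    unfolding local_homeomorphism_iff unit_space_def
  proof (intro conjI ballI)
    show "open_map (gtop G) (subtopology (gtop G) (units G)) (src G)"
      using src(2) by (subst open_map_into_open_subtopology[OF open_units]) (auto simp: topspace_gtop src_in_units)
  qed (use src(1) inj in \<open>auto simp: continuous_map_in_subtopology topspace_gtop src_in_units\<close>)
  moreover have "local_homeomorphism (gtop G) (unit_space G) (rng G)"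
    unfolding local_homeomorphism_iff unit_space_def
  proof (intro conjI ballI)
    have "continuous_map (gtop G) (gtop G) (rng G)"
      using continuous_map_eq[OF continuous_map_compose[OF inv src(1)]] rng_eq by metis
    then show "continuous_map (gtop G) (subtopology (gtop G) (units G)) (rng G)"
      by (auto simp: continuous_map_in_subtopology topspace_gtop rng_in_units)
    have "open_map (gtop G) (gtop G) (src G \<circ> ginv G)"
      using src(2) inv_hom open_map_compose homeomorphic_imp_open_map homeomorphic_maps_map by metis
    then have "open_map (gtop G) (gtop G) (rng G)"
      by (rule open_map_eq) (simp add: rng_eq)
    then show "open_map (gtop G) (subtopology (gtop G) (units G)) (rng G)"
      by (subst open_map_into_open_subtopology[OF open_units]) (auto simp: topspace_gtop rng_in_units)
    fix x assume "x \<in> topspace (gtop G)"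
    then have x: "x \<in> arrows G" by (simp add: topspace_gtop)
    then obtain U where U: "openin (gtop G) U" "ginv G x \<in> U" "inj_on (src G) U"
      using inj inv_closed by blast
    let ?V = "{y \<in> topspace (gtop G). ginv G y \<in> U}"
    have "inj_on (rng G) ?V"
    proof (rule inj_onI)
      fix y z assume yz: "y \<in> ?V" "z \<in> ?V" "rng G y = rng G z"
      then have "ginv G y = ginv G z"
        using U(3) by (auto simp: inj_on_def topspace_gtop src_inv)
      then show "y = z" using yz by (metis (no_types, lifting) inv_inv mem_Collect_eq topspace_gtop)
    qed
    then show "\<exists>U. openin (gtop G) U \<and> x \<in> U \<and> inj_on (rng G) U"
      using openin_continuous_map_preimage[OF inv U(1)] x U(2)
      by (intro exI[of _ ?V]) (auto simp: topspace_gtop)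
  qed
  ultimately show ?thesis
    using assms by (simp add: ample_groupoid_def ample_groupoid_axioms_def)
qed

section \<open>Homomorphisms and isomorphisms\<close>

text \<open>\<open>groupoid_hom\<close> speaks of composable pairs only. A unit is sent to an
  idempotent, and cancellation turns an idempotent into a unit. Composability of the images of (x,
  src x) and of (rng x, x) then gives both equations.\<close>

lemma groupoid_hom_src_rng:
  assumes "groupoid P" "groupoid Q" "groupoid_hom P Q \<phi>" "x \<in> arrows P"
  shows "\<phi> (src P x) = src Q (\<phi> x)" "\<phi> (rng P x) = rng Q (\<phi> x)"
proof -
  interpret P: groupoid P by fact
  interpret Q: groupoid Q by fact
  have cl: "\<phi> y \<in> arrows Q" if "y \<in> arrows P" for y
    using assms that by (simp add: groupoid_hom_def)
  have m: "src Q (\<phi> y) = rng Q (\<phi> z)" "\<phi> (gmult P y z) = gmult Q (\<phi> y) (\<phi> z)"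
    if "y \<in> arrows P" "z \<in> arrows P" "src P y = rng P z" for y z
    using assms that by (simp_all add: groupoid_hom_def)
  have idem: "\<phi> u = src Q (\<phi> u)" "\<phi> u = rng Q (\<phi> u)" if u: "u \<in> units P" for u
  proof -
    have u': "u \<in> arrows P" "src P u = u" "rng P u = u" using u P.rng_unit by (auto simp: P.units_iff)
    then have "gmult Q (\<phi> u) (\<phi> u) = \<phi> u" "src Q (\<phi> u) = rng Q (\<phi> u)"
      using m[of u u] P.src_mult_right[of u] by simp_all
    then show "\<phi> u = src Q (\<phi> u)" "\<phi> u = rng Q (\<phi> u)"
      using Q.inv_mult_cancel[of "\<phi> u" "\<phi> u"] cl[OF u'(1)] by (simp_all add: Q.mult_inv_left)
  qed
  show "\<phi> (src P x) = src Q (\<phi> x)"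
    using idem(2)[of "src P x"] m(1)[of x "src P x"] assms(4)
    by (simp add: P.src_in_units P.src_closed P.rng_src)
  show "\<phi> (rng P x) = rng Q (\<phi> x)"
    using idem(1)[of "rng P x"] m(1)[of "rng P x" x] assms(4)
    by (simp add: P.rng_in_units P.rng_closed P.src_rng)
qed

text \<open>Multiplicativity of the inverse map is automatic: composability of preimages and the
  product formula are both checked after applying the injective map \<open>\<phi>\<close>. Later
  isomorphisms thus need only one direction.\<close>

lemma groupoid_isomorphicI:
  assumes P: "groupoid P" and Q: "groupoid Q"
    and hom: "homeomorphic_maps (gtop P) (gtop Q) \<phi> \<psi>" and "groupoid_hom P Q \<phi>"
  shows "groupoid_hom Q P \<psi>" "groupoid_isomorphic P Q"
proof -
  interpret P: groupoid P by fact
  have \<psi>: "\<psi> y \<in> arrows P" "\<phi> (\<psi> y) = y" if "y \<in> arrows Q" for y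
    using that hom by (auto simp: homeomorphic_maps_def arrows_def continuous_map_def)
  have \<phi>: "\<psi> (\<phi> x) = x" if "x \<in> arrows P" for x
    using that hom by (auto simp: homeomorphic_maps_def arrows_def continuous_map_def)
  note sr = groupoid_hom_src_rng[OF P Q assms(4)]
  show "groupoid_hom Q P \<psi>"
    unfolding groupoid_hom_def
  proof (intro conjI ballI impI)
    fix x y assume xy: "x \<in> arrows Q" "y \<in> arrows Q" "src Q x = rng Q y"
    then have "\<phi> (src P (\<psi> x)) = \<phi> (rng P (\<psi> y))" by (simp add: sr \<psi>)
    then show eq: "src P (\<psi> x) = rng P (\<psi> y)"
      using \<phi> xy by (metis P.rng_closed P.src_closed \<psi>(1))
    then have "\<phi> (gmult P (\<psi> x) (\<psi> y)) = gmult Q x y"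
      using assms(4) xy \<psi> by (simp add: groupoid_hom_def)
    then show "\<psi> (gmult Q x y) = gmult P (\<psi> x) (\<psi> y)"
      using \<phi> eq xy by (metis P.mult_closed \<psi>(1))
  qed (simp add: \<psi>)
  then show "groupoid_isomorphic P Q"
    unfolding groupoid_isomorphic_def using assms by blast
qed

lemma groupoid_isomorphic_sym: "groupoid_isomorphic P Q \<Longrightarrow> groupoid_isomorphic Q P"
  unfolding groupoid_isomorphic_def using homeomorphic_maps_sym by blast

lemma groupoid_hom_compose:
  "groupoid_hom P Q \<phi> \<Longrightarrow> groupoid_hom Q R \<psi> \<Longrightarrow> groupoid_hom P R (\<psi> \<circ> \<phi>)"
  by (simp add: groupoid_hom_def)

lemma groupoid_isomorphic_trans:
  assumes "groupoid_isomorphic P Q" "groupoid_isomorphic Q R"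
  shows "groupoid_isomorphic P R"
proof -
  obtain \<phi> \<psi> \<phi>' \<psi>' where "homeomorphic_maps (gtop P) (gtop Q) \<phi> \<psi>" "groupoid_hom P Q \<phi>" "groupoid_hom Q P \<psi>"
    "homeomorphic_maps (gtop Q) (gtop R) \<phi>' \<psi>'" "groupoid_hom Q R \<phi>'" "groupoid_hom R Q \<psi>'"
    using assms unfolding groupoid_isomorphic_def by blast
  then show ?thesis
    unfolding groupoid_isomorphic_def using homeomorphic_maps_compose groupoid_hom_compose by meson
qed

section \<open>Restrictions\<close>

lemma restrict_groupoid_simps [simp]:
  "gtop (restrict_groupoid G K) = subtopology (gtop G) {x. rng G x \<in> K \<and> src G x \<in> K}"
  "rng (restrict_groupoid G K) = rng G" "src (restrict_groupoid G K) = src G"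
  "gmult (restrict_groupoid G K) = gmult G" "ginv (restrict_groupoid G K) = ginv G"
  by (simp_all add: restrict_groupoid_def)

lemma arrows_restrict: "arrows (restrict_groupoid G K) = {x \<in> arrows G. rng G x \<in> K \<and> src G x \<in> K}"
  by (auto simp: arrows_def)

lemma restrict_restrict:
  assumes "A \<subseteq> K"
  shows "restrict_groupoid (restrict_groupoid G K) A = restrict_groupoid G A"
proof -
  have "{x. rng G x \<in> K \<and> src G x \<in> K} \<inter> {x. rng G x \<in> A \<and> src G x \<in> A} = {x. rng G x \<in> A \<and> src G x \<in> A}"
    using assms by blast
  then show ?thesis by (simp add: restrict_groupoid_def subtopology_subtopology)
qed

context groupoid
begin

lemma groupoid_restrict: "groupoid (restrict_groupoid G K)"
  by unfold_locales
     (auto simp: arrows_restrict rng_closed src_closed rng_rng src_rng rng_src src_src mult_closed rng_mult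
       src_mult mult_assoc rng_mult_left src_mult_right inv_closed rng_inv src_inv mult_inv_right mult_inv_left)

lemma units_restrict: "units (restrict_groupoid G K) = units G \<inter> K"
  using groupoid.units_iff[OF groupoid_restrict] units_iff rng_unit by (auto simp: arrows_restrict)

lemma unit_space_restrict: "unit_space (restrict_groupoid G K) = subtopology (unit_space G) K"
proof -
  have "{x. rng G x \<in> K \<and> src G x \<in> K} \<inter> (units G \<inter> K) = units G \<inter> K"
    using units_iff rng_unit by auto
  then show ?thesis
    by (simp add: unit_space_def units_restrict subtopology_subtopology)
qed

lemma restrict_units: "restrict_groupoid G (units G) = G"
proof -
  have "topspace (gtop G) \<subseteq> {x. rng G x \<in> units G \<and> src G x \<in> units G}"
    by (auto simp: topspace_gtop rng_in_units src_in_units)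
  then show ?thesis by (simp add: restrict_groupoid_def subtopology_superset)
qed

lemma full_in_iff: "full_in G K \<longleftrightarrow> (\<forall>u\<in>units G. \<exists>x\<in>arrows G. rng G x = u \<and> src G x \<in> K)"
proof -
  have "rng G ` {x \<in> arrows G. src G x \<in> K} \<subseteq> units G" by (auto simp: rng_in_units)
  then have "full_in G K \<longleftrightarrow> units G \<subseteq> rng G ` {x \<in> arrows G. src G x \<in> K}"
    unfolding full_in_def by blast
  then show ?thesis by (simp add: subset_eq image_iff) metis
qed

text \<open>An arrow with range u and source in \<open>K\<close> is composed with an arrow of the
  restriction that leads from \<open>A\<close> to that source.\<close>

lemma full_in_trans:
  assumes "full_in G K" "full_in (restrict_groupoid G K) A"
  shows "full_in G A"
  unfolding full_in_iff
proof
  fix u assume "u \<in> units G"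
  then obtain x where x: "x \<in> arrows G" "rng G x = u" "src G x \<in> K"
    using assms(1) unfolding full_in_iff by blast
  then have "src G x \<in> units (restrict_groupoid G K)" by (simp add: units_restrict src_in_units)
  then obtain y where "y \<in> arrows G" "rng G y = src G x" "src G y \<in> A"
    using assms(2) unfolding groupoid.full_in_iff[OF groupoid_restrict] by (auto simp: arrows_restrict)
  then show "\<exists>x\<in>arrows G. rng G x = u \<and> src G x \<in> A"
    using x by (intro bexI[of _ "gmult G x y"]) (simp_all add: rng_mult src_mult mult_closed)
qed

end

text \<open>The arrows with both ends in \<open>K\<close> form an open set, an intersection of two
  preimages. Open sets of the restriction are therefore open in \<open>G\<close>, and the basis,
  openness and local injectivity are inherited.\<close>

lemma (in ample_groupoid) ample_groupoid_restrict:
  assumes "openin (unit_space G) K"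
  shows "ample_groupoid (restrict_groupoid G K)"
proof (rule ample_groupoidI)
  let ?S = "{x. rng G x \<in> K \<and> src G x \<in> K}"
  have K: "openin (gtop G) K" using assms openin_unit_space by blast
  have "topspace (gtop G) \<inter> ?S =
      {x \<in> topspace (gtop G). rng G x \<in> K} \<inter> {x \<in> topspace (gtop G). src G x \<in> K}" by auto
  moreover have "openin (gtop G) \<dots>"
    using openin_continuous_map_preimage[OF rng_continuous K]
      openin_continuous_map_preimage[OF src_continuous K] by (rule openin_Int)
  ultimately have S: "openin (gtop G) (topspace (gtop G) \<inter> ?S)" by (simp only:)
  have gt: "gtop (restrict_groupoid G K) = subtopology (gtop G) (topspace (gtop G) \<inter> ?S)"
    by (simp add: subtopology_restrict)
  have open_iff: "openin (gtop (restrict_groupoid G K)) U \<longleftrightarrow> openin (gtop G) U \<and> U \<subseteq> ?S" for U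
    using openin_subset[of "gtop G" U] unfolding gt openin_open_subtopology[OF S] le_inf_iff by blast
  have cont: "continuous_map (gtop (restrict_groupoid G K)) (gtop G) (\<lambda>x. x)"
    by (simp add: continuous_map_from_subtopology)
  show "groupoid (restrict_groupoid G K)" by (rule groupoid_restrict)
  show "has_compact_open_basis (gtop (restrict_groupoid G K))"
    unfolding gt by (rule has_compact_open_basis_subtopology[OF compact_open_basis S])
  show "continuous_map (gtop (restrict_groupoid G K)) (gtop (restrict_groupoid G K)) (ginv (restrict_groupoid G K))"
    using continuous_map_ginv[OF cont]
    by (auto simp: continuous_map_in_subtopology topspace_gtop rng_inv src_inv)
  let ?D = "subtopology (prod_topology (gtop (restrict_groupoid G K)) (gtop (restrict_groupoid G K)))
     {(x, y). src (restrict_groupoid G K) x = rng (restrict_groupoid G K) y}"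
  have "continuous_map ?D (gtop G) (\<lambda>p. gmult G (fst p) (snd p))"
  proof (rule continuous_map_mult)
    show "continuous_map ?D (gtop G) fst" "continuous_map ?D (gtop G) snd"
      using continuous_map_compose[OF continuous_map_fst cont] continuous_map_compose[OF continuous_map_snd cont]
      by (auto intro!: continuous_map_from_subtopology simp: o_def)
  qed auto
  then show "continuous_map ?D (gtop (restrict_groupoid G K)) (\<lambda>(x, y). gmult (restrict_groupoid G K) x y)"
    by (auto simp: continuous_map_in_subtopology topspace_gtop rng_mult src_mult case_prod_unfold)
  show "Hausdorff_space (unit_space (restrict_groupoid G K))"
    unfolding unit_space_restrict by (rule Hausdorff_space_subtopology[OF Hausdorff_units])
  show "continuous_map (gtop (restrict_groupoid G K)) (gtop (restrict_groupoid G K)) (src (restrict_groupoid G K))"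
    using continuous_map_src[OF cont]
    by (auto simp: continuous_map_in_subtopology topspace_gtop rng_src src_src)
  show "open_map (gtop (restrict_groupoid G K)) (gtop (restrict_groupoid G K)) (src (restrict_groupoid G K))"
    unfolding open_map_def open_iff
  proof (intro allI impI conjI)
    fix U assume U: "openin (gtop G) U \<and> U \<subseteq> ?S"
    then show "openin (gtop G) (src (restrict_groupoid G K) ` U)" using open_src by simp
    have "U \<subseteq> arrows G" using U openin_subset topspace_gtop by metis
    then show "src (restrict_groupoid G K) ` U \<subseteq> ?S"
      using U by (auto simp: subset_iff rng_src src_src)
  qed
  fix x assume "x \<in> arrows (restrict_groupoid G K)"
  then obtain U where "openin (gtop G) U" "x \<in> U" "inj_on (src G) U" "rng G x \<in> K" "src G x \<in> K" "x \<in> arrows G"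
    using local_homeo_src unfolding local_homeomorphism_iff by (auto simp: arrows_restrict topspace_gtop)
  then show "\<exists>U. openin (gtop (restrict_groupoid G K)) U \<and> x \<in> U \<and> inj_on (src (restrict_groupoid G K)) U"
    unfolding open_iff using openin_Int[OF _ S]
    by (intro exI[of _ "U \<inter> (topspace (gtop G) \<inter> ?S)"]) (auto simp: topspace_gtop inj_on_Int)
qed

section \<open>Transport along isomorphisms\<close>

text \<open>The witness is the image of \<open>A\<close>. For fullness, a unit is pulled back,
  joined to \<open>A\<close> by an arrow there, and this arrow is pushed forward.\<close>

lemma isomorphic_restrict:
  assumes P: "ample_groupoid P" and Q: "ample_groupoid Q" and iso: "groupoid_isomorphic P Q"
    and A: "openin (unit_space P) A" "full_in P A"
  obtains B where "openin (unit_space Q) B" "full_in Q B"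
    "groupoid_isomorphic (restrict_groupoid P A) (restrict_groupoid Q B)"
proof -
  interpret P: ample_groupoid P by fact
  interpret Q: ample_groupoid Q by fact
  obtain \<phi> \<psi> where hom: "homeomorphic_maps (gtop P) (gtop Q) \<phi> \<psi>"
    and \<phi>: "groupoid_hom P Q \<phi>" and \<psi>: "groupoid_hom Q P \<psi>"
    using iso unfolding groupoid_isomorphic_def by blast
  note sr = groupoid_hom_src_rng[OF P.groupoid_axioms Q.groupoid_axioms \<phi>]
    groupoid_hom_src_rng[OF Q.groupoid_axioms P.groupoid_axioms \<psi>]
  have inv: "\<psi> (\<phi> x) = x" "\<phi> x \<in> arrows Q" if "x \<in> arrows P" for x
    using that hom \<phi> by (auto simp: homeomorphic_maps_def arrows_def groupoid_hom_def)
  have inv': "\<phi> (\<psi> y) = y" "\<psi> y \<in> arrows P" if "y \<in> arrows Q" for y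
    using that hom \<psi> by (auto simp: homeomorphic_maps_def arrows_def groupoid_hom_def)
  have Ao: "openin (gtop P) A" and Au: "A \<subseteq> units P" using A P.openin_unit_space by auto
  have Aa: "A \<subseteq> arrows P" using Au P.units_iff by blast
  show thesis
  proof
    have "openin (gtop Q) (\<phi> ` A)"
      using hom Ao homeomorphic_imp_open_map homeomorphic_maps_map open_map_def by metis
    moreover have "\<phi> ` A \<subseteq> units Q"
      using Au by (auto simp: Q.units_iff subset_iff P.units_iff inv simp flip: sr)
    ultimately show "openin (unit_space Q) (\<phi> ` A)" by (simp add: Q.openin_unit_space)
    show "full_in Q (\<phi> ` A)"
      unfolding Q.full_in_iff
    proof
      fix v assume v: "v \<in> units Q"
      then have v': "v \<in> arrows Q" "src Q v = v" by (auto simp: Q.units_iff)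
      then have "\<psi> v \<in> units P" by (simp add: P.units_iff inv' flip: sr)
      then obtain x where "x \<in> arrows P" "rng P x = \<psi> v" "src P x \<in> A"
        using A(2) unfolding P.full_in_iff by blast
      then show "\<exists>y\<in>arrows Q. rng Q y = v \<and> src Q y \<in> \<phi> ` A"
        using v' by (intro bexI[of _ "\<phi> x"]) (simp_all add: inv inv' flip: sr)
    qed
    show "groupoid_isomorphic (restrict_groupoid P A) (restrict_groupoid Q (\<phi> ` A))"
    proof (rule groupoid_isomorphicI[OF P.groupoid_restrict Q.groupoid_restrict])
      show "homeomorphic_maps (gtop (restrict_groupoid P A)) (gtop (restrict_groupoid Q (\<phi> ` A))) \<phi> \<psi>"
        unfolding restrict_groupoid_simps
        by (rule homeomorphic_maps_subtopologies_alt[OF hom])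
           (auto simp: topspace_gtop inv Aa[THEN subsetD] simp flip: sr)
      show "groupoid_hom (restrict_groupoid P A) (restrict_groupoid Q (\<phi> ` A)) \<phi>"
        using \<phi> by (auto simp: groupoid_hom_def arrows_restrict simp flip: sr)
    qed
  qed
qed

lemma isomorphic_sigma_compact:
  assumes P: "groupoid P" and Q: "groupoid Q" and iso: "groupoid_isomorphic P Q"
    and \<sigma>: "sigma_compact_space (unit_space P)"
  shows "sigma_compact_space (unit_space Q)"
proof -
  interpret P: groupoid P by fact
  interpret Q: groupoid Q by fact
  obtain \<phi> \<psi> where hom: "homeomorphic_maps (gtop P) (gtop Q) \<phi> \<psi>"
    and \<phi>: "groupoid_hom P Q \<phi>" and \<psi>: "groupoid_hom Q P \<psi>"
    using iso unfolding groupoid_isomorphic_def by blast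
  have sub: "\<phi> ` units P \<subseteq> units Q"
  proof
    fix v assume "v \<in> \<phi> ` units P"
    then obtain u where u: "u \<in> arrows P" "src P u = u" "v = \<phi> u" by (auto simp: P.units_iff)
    then show "v \<in> units Q"
      using groupoid_hom_src_rng(1)[OF P Q \<phi> u(1)] \<phi> by (simp add: Q.units_iff groupoid_hom_def)
  qed
  have sup: "units Q \<subseteq> \<phi> ` units P"
  proof
    fix v assume "v \<in> units Q"
    then have v: "v \<in> arrows Q" "src Q v = v" by (auto simp: Q.units_iff)
    then have "\<psi> v \<in> units P"
      using groupoid_hom_src_rng(1)[OF Q P \<psi> v(1)] \<psi> by (simp add: P.units_iff groupoid_hom_def)
    moreover have "\<phi> (\<psi> v) = v" using hom v by (simp add: homeomorphic_maps_def arrows_def)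
    ultimately show "v \<in> \<phi> ` units P" by (metis imageI)
  qed
  obtain \<C> where \<C>: "countable \<C>" "\<forall>K\<in>\<C>. compactin (unit_space P) K" "\<Union>\<C> = units P"
    using \<sigma> unfolding sigma_compact_space_def P.topspace_unit_space by metis
  have cont: "continuous_map (gtop P) (gtop Q) \<phi>" using hom by (simp add: homeomorphic_maps_def)
  have "compactin (unit_space Q) (\<phi> ` K)" if "K \<in> \<C>" for K
  proof -
    have "compactin (gtop P) K" "K \<subseteq> units P"
      using \<C>(2) that by (auto simp: unit_space_def compactin_subtopology)
    then have "compactin (gtop Q) (\<phi> ` K)" "\<phi> ` K \<subseteq> units Q"
      using image_compactin[OF _ cont] sub by blast+
    then show ?thesis by (simp add: unit_space_def compactin_subtopology)
  qed
  moreover have "\<Union> ((`) \<phi> ` \<C>) = units Q"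
    using equalityI[OF sub sup] \<C>(3) by (metis image_Union)
  ultimately show ?thesis
    unfolding sigma_compact_space_def Q.topspace_unit_space using \<C>(1)
    by (intro exI[of _ "(`) \<phi> ` \<C>"]) auto
qed

section \<open>Products and the full equivalence relation\<close>

lemma prod_groupoid_simps [simp]:
  "gtop (prod_groupoid G H) = prod_topology (gtop G) (gtop H)"
  "rng (prod_groupoid G H) (x, y) = (rng G x, rng H y)"
  "src (prod_groupoid G H) (x, y) = (src G x, src H y)"
  "gmult (prod_groupoid G H) (x, y) (x', y') = (gmult G x x', gmult H y y')"
  "ginv (prod_groupoid G H) (x, y) = (ginv G x, ginv H y)"
  by (simp_all add: prod_groupoid_def)

lemma arrows_prod: "arrows (prod_groupoid G H) = arrows G \<times> arrows H"
  by (simp add: arrows_def)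

lemma units_prod: "units (prod_groupoid G H) = units G \<times> units H"
  by (force simp: units_def arrows_prod image_iff)

lemma unit_space_prod: "unit_space (prod_groupoid G H) = prod_topology (unit_space G) (unit_space H)"
  by (simp add: unit_space_def units_prod subtopology_Times)

lemma groupoid_prod:
  assumes "groupoid G" "groupoid H"
  shows "groupoid (prod_groupoid G H)"
proof -
  interpret G: groupoid G by fact
  interpret H: groupoid H by fact
  show ?thesis
    by unfold_locales
      (auto simp: arrows_prod G.rng_closed G.src_closed G.rng_rng G.src_rng G.rng_src G.src_src G.mult_closed
       G.rng_mult G.src_mult G.mult_assoc G.rng_mult_left G.src_mult_right G.inv_closed G.rng_inv G.src_inv
       G.mult_inv_right G.mult_inv_left H.rng_closed H.src_closed H.rng_rng H.src_rng H.rng_src H.src_src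
       H.mult_closed H.rng_mult H.src_mult H.mult_assoc H.rng_mult_left H.src_mult_right H.inv_closed
       H.rng_inv H.src_inv H.mult_inv_right H.mult_inv_left)
qed

lemma ample_groupoid_prod:
  assumes "ample_groupoid G" "ample_groupoid H"
  shows "ample_groupoid (prod_groupoid G H)"
proof -
  interpret G: ample_groupoid G by fact
  interpret H: ample_groupoid H by fact
  have src: "src (prod_groupoid G H) = (\<lambda>(x, y). (src G x, src H y))"
    and inv: "ginv (prod_groupoid G H) = (\<lambda>(x, y). (ginv G x, ginv H y))"
    by (simp_all add: prod_groupoid_def)
  show ?thesis
  proof (rule ample_groupoidI)
    show "groupoid (prod_groupoid G H)"
      by (intro groupoid_prod G.groupoid_axioms H.groupoid_axioms)
    show "has_compact_open_basis (gtop (prod_groupoid G H))"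
      by (simp add: has_compact_open_basis_prod G.compact_open_basis H.compact_open_basis)
    show "continuous_map (gtop (prod_groupoid G H)) (gtop (prod_groupoid G H)) (ginv (prod_groupoid G H))"
      unfolding inv prod_groupoid_simps(1) continuous_map_prod_top by (simp add: G.continuous_inv H.continuous_inv)
    show "continuous_map (subtopology (prod_topology (gtop (prod_groupoid G H)) (gtop (prod_groupoid G H)))
       {(x, y). src (prod_groupoid G H) x = rng (prod_groupoid G H) y})
      (gtop (prod_groupoid G H)) (\<lambda>(x, y). gmult (prod_groupoid G H) x y)"
      unfolding prod_groupoid_simps(1)
      by (rule continuous_map_prod_partial[OF G.continuous_mult H.continuous_mult]) auto
    show "Hausdorff_space (unit_space (prod_groupoid G H))"
      by (simp add: unit_space_prod Hausdorff_space_prod_topology G.Hausdorff_units H.Hausdorff_units)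
    show "continuous_map (gtop (prod_groupoid G H)) (gtop (prod_groupoid G H)) (src (prod_groupoid G H))"
      unfolding src prod_groupoid_simps(1) continuous_map_prod_top by (simp add: G.src_continuous H.src_continuous)
    show "open_map (gtop (prod_groupoid G H)) (gtop (prod_groupoid G H)) (src (prod_groupoid G H))"
      unfolding src prod_groupoid_simps(1)
      by (rule open_map_prod) (simp_all add: open_map_def G.open_src H.open_src)
    fix p assume "p \<in> arrows (prod_groupoid G H)"
    then obtain x y where p: "p = (x, y)" "x \<in> topspace (gtop G)" "y \<in> topspace (gtop H)"
      by (auto simp: arrows_prod topspace_gtop)
    obtain U where U: "openin (gtop G) U" "x \<in> U" "inj_on (src G) U"
      using G.local_homeo_src p unfolding local_homeomorphism_iff by blast
    obtain V where V: "openin (gtop H) V" "y \<in> V" "inj_on (src H) V"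
      using H.local_homeo_src p unfolding local_homeomorphism_iff by blast
    show "\<exists>U. openin (gtop (prod_groupoid G H)) U \<and> p \<in> U \<and> inj_on (src (prod_groupoid G H)) U"
      using U V p by (intro exI[of _ "U \<times> V"]) (auto simp: openin_prod_Times_iff inj_on_def)
  qed
qed

lemma full_relation_simps [simp]:
  "gtop full_relation = discrete_topology UNIV"
  "rng full_relation (i, j) = (i, i)" "src full_relation (i, j) = (j, j)"
  "gmult full_relation (i, j) (k, l) = (i, l)" "ginv full_relation (i, j) = (j, i)"
  by (simp_all add: full_relation_def)

lemma arrows_full_relation [simp]: "arrows full_relation = UNIV"
  by (simp add: arrows_def)

lemma units_full_relation: "units full_relation = range (\<lambda>i. (i, i))"
  by (force simp: units_def image_iff)

lemma ample_full_relation: "ample_groupoid full_relation"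
proof (rule ample_groupoidI)
  show "groupoid full_relation" by unfold_locales auto
  show "has_compact_open_basis (gtop full_relation)"
    unfolding has_compact_open_basis_iff
  proof (intro allI impI)
    fix U and x :: "nat \<times> nat" assume "x \<in> U"
    then show "\<exists>K. compactin (gtop full_relation) K \<and> openin (gtop full_relation) K \<and> x \<in> K \<and> K \<subseteq> U"
      by (intro exI[of _ "{x}"]) simp
  qed
  show "continuous_map (subtopology (prod_topology (gtop full_relation) (gtop full_relation))
      {(x, y). src full_relation x = rng full_relation y})
      (gtop full_relation) (\<lambda>(x, y). gmult full_relation x y)"
    by (simp add: prod_topology_discrete_topology[symmetric] subtopology_discrete_topology)
  show "Hausdorff_space (unit_space full_relation)"
    by (simp add: unit_space_def Hausdorff_space_subtopology Hausdorff_space_discrete_topology)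
  show "\<exists>U. openin (gtop full_relation) U \<and> x \<in> U \<and> inj_on (src full_relation) U" for x
    by (intro exI[of _ "{x}"]) simp
qed (simp_all add: open_map_def)

lemma unit_space_full_relation: "unit_space full_relation = discrete_topology (range (\<lambda>i. (i, i)))"
  by (simp add: unit_space_def units_full_relation subtopology_discrete_topology)

text \<open>This is the copy of \<open>H\<close> on level 0 of its stabilisation: with both ends
  fixed at level 0, the only arrow left in the second factor is (0, 0). Fullness comes from the
  arrows (u, (i, 0)), which join level 0 to level i.\<close>

lemma isomorphic_corner:
  assumes "groupoid H"
  defines "A \<equiv> units H \<times> {(0, 0)}"
  shows "groupoid_isomorphic H (restrict_groupoid (prod_groupoid H full_relation) A)"
    and "openin (unit_space (prod_groupoid H full_relation)) A"
    and "full_in (prod_groupoid H full_relation) A"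
proof -
  interpret H: groupoid H by fact
  have gR: "groupoid full_relation"
    using ample_full_relation by (simp add: ample_groupoid_def)
  interpret HR: groupoid "prod_groupoid H full_relation"
    by (intro groupoid_prod assms gR)
  show "groupoid_isomorphic H (restrict_groupoid (prod_groupoid H full_relation) A)"
  proof (rule groupoid_isomorphicI[OF assms(1) HR.groupoid_restrict])
    show "homeomorphic_maps (gtop H) (gtop (restrict_groupoid (prod_groupoid H full_relation) A))
        (\<lambda>x. (x, (0, 0))) fst"
      unfolding homeomorphic_maps_def
      by (auto simp: continuous_map_in_subtopology continuous_map_paired A_def topspace_gtop
          H.rng_in_units H.src_in_units intro: continuous_map_from_subtopology continuous_map_fst)
    show "groupoid_hom H (restrict_groupoid (prod_groupoid H full_relation) A) (\<lambda>x. (x, (0, 0)))"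
      by (auto simp: groupoid_hom_def arrows_restrict arrows_prod A_def H.rng_in_units H.src_in_units)
  qed
  show "openin (unit_space (prod_groupoid H full_relation)) A"
    using openin_topspace[of "unit_space H"]
    by (auto simp: A_def unit_space_prod unit_space_full_relation openin_prod_Times_iff H.topspace_unit_space)
  show "full_in (prod_groupoid H full_relation) A"
    unfolding HR.full_in_iff
  proof
    fix p assume "p \<in> units (prod_groupoid H full_relation)"
    then obtain u i where "p = (u, (i, i))" "u \<in> units H"
      by (auto simp: units_prod units_full_relation)
    then show "\<exists>x\<in>arrows (prod_groupoid H full_relation). rng (prod_groupoid H full_relation) x = p \<and>
        src (prod_groupoid H full_relation) x \<in> A"
      by (intro bexI[of _ "(u, (i, 0))"]) (auto simp: arrows_prod H.rng_unit H.units_iff A_def)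
  qed
qed

section \<open>Bibundles with continuous division\<close>

text \<open>The maps \<open>d\<close> and \<open>e\<close> are left and right division:
  \<open>d z w\<close> is the arrow moving w to z from the left, \<open>e z w\<close> the one moving
  w to z from the right. Left division is defined where \<open>s\<close> agrees, because the left
  orbits are the fibres of \<open>s\<close>. Existence of division encodes transitivity on fibres,
  \<open>d_l\<close> and \<open>e_a\<close> encode freeness, and continuity stands in for
  properness.\<close>

locale bibundle = G: ample_groupoid G + H: ample_groupoid H +
    L: left_action G Z r l + R: right_action H Z s a
  for G :: "'a tgroupoid" and H :: "'b tgroupoid" and Z :: "'z topology" and r s l a +
  fixes d :: "'z \<Rightarrow> 'z \<Rightarrow> 'a" and e :: "'z \<Rightarrow> 'z \<Rightarrow> 'b"
  assumes s_l: "\<lbrakk>g \<in> arrows G; z \<in> topspace Z; src G g = r z\<rbrakk> \<Longrightarrow> s (l g z) = s z"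
    and r_a: "\<lbrakk>z \<in> topspace Z; h \<in> arrows H; s z = rng H h\<rbrakk> \<Longrightarrow> r (a z h) = r z"
    and l_a: "\<lbrakk>g \<in> arrows G; z \<in> topspace Z; h \<in> arrows H; src G g = r z; s z = rng H h\<rbrakk>
      \<Longrightarrow> a (l g z) h = l g (a z h)"
    and open_r: "open_map Z (unit_space G) r" and surj_r: "r ` topspace Z = units G"
    and open_s: "open_map Z (unit_space H) s" and surj_s: "s ` topspace Z = units H"
    and d_continuous: "continuous_map (subtopology (prod_topology Z Z) {(z, w). s z = s w}) (gtop G)
      (\<lambda>(z, w). d z w)"
    and d_src: "\<lbrakk>z \<in> topspace Z; w \<in> topspace Z; s z = s w\<rbrakk> \<Longrightarrow> src G (d z w) = r w"
    and l_d: "\<lbrakk>z \<in> topspace Z; w \<in> topspace Z; s z = s w\<rbrakk> \<Longrightarrow> l (d z w) w = z"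
    and d_l: "\<lbrakk>g \<in> arrows G; w \<in> topspace Z; src G g = r w\<rbrakk> \<Longrightarrow> d (l g w) w = g"
    and e_continuous: "continuous_map (subtopology (prod_topology Z Z) {(z, w). r z = r w}) (gtop H)
      (\<lambda>(z, w). e z w)"
    and e_rng: "\<lbrakk>z \<in> topspace Z; w \<in> topspace Z; r z = r w\<rbrakk> \<Longrightarrow> rng H (e z w) = s w"
    and a_e: "\<lbrakk>z \<in> topspace Z; w \<in> topspace Z; r z = r w\<rbrakk> \<Longrightarrow> a w (e z w) = z"
    and e_a: "\<lbrakk>h \<in> arrows H; w \<in> topspace Z; s w = rng H h\<rbrakk> \<Longrightarrow> e (a w h) w = h"
begin

lemmas l_closed = left_act_closed[OF L.left_action_axioms]
lemmas a_closed = right_act_closed[OF R.right_action_axioms]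
lemmas continuous_map_d = continuous_map_partial[OF d_continuous]
lemmas continuous_map_e = continuous_map_partial[OF e_continuous]

lemma r_units: "z \<in> topspace Z \<Longrightarrow> r z \<in> units G" using surj_r by blast
lemma s_units: "z \<in> topspace Z \<Longrightarrow> s z \<in> units H" using surj_s by blast

lemma d_closed: "\<lbrakk>z \<in> topspace Z; w \<in> topspace Z; s z = s w\<rbrakk> \<Longrightarrow> d z w \<in> arrows G"
  using funcset_mem[OF continuous_map_funspace[OF d_continuous], of "(z, w)"] by (simp add: arrows_def)

lemma e_closed: "\<lbrakk>z \<in> topspace Z; w \<in> topspace Z; r z = r w\<rbrakk> \<Longrightarrow> e z w \<in> arrows H"
  using funcset_mem[OF continuous_map_funspace[OF e_continuous], of "(z, w)"] by (simp add: arrows_def)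

lemma d_rng: "\<lbrakk>z \<in> topspace Z; w \<in> topspace Z; s z = s w\<rbrakk> \<Longrightarrow> rng G (d z w) = r z"
  by (metis L.anchor_act d_closed d_src l_d)

lemma e_src: "\<lbrakk>z \<in> topspace Z; w \<in> topspace Z; r z = r w\<rbrakk> \<Longrightarrow> src H (e z w) = s z"
  by (metis R.anchor_act e_closed e_rng a_e)

text \<open>The division \<open>d\<close> maps the diagonal into the open set of units, hence maps pairs of points
  close to the diagonal to units.\<close>

lemma locally_injective_s:
  assumes z: "z \<in> topspace Z"
  obtains U where "openin Z U" "z \<in> U" "inj_on s U"
proof -
  let ?D = "subtopology (prod_topology Z Z) {(z, w). s z = s w}"
  let ?E = "{p \<in> topspace ?D. (\<lambda>(z, w). d z w) p \<in> units G}"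
  have "openin ?D ?E"
    by (rule openin_continuous_map_preimage[OF d_continuous G.open_units])
  then obtain W where W: "openin (prod_topology Z Z) W" "?E = W \<inter> {(z, w). s z = s w}"
    unfolding openin_subtopology by blast
  have "d z z = r z"
    using d_l[of "r z" z] r_units[OF z] z by (simp add: G.units_iff L.act_unit)
  then have "(z, z) \<in> ?E" using z r_units[OF z] by simp
  then have "(z, z) \<in> W" unfolding W(2) by simp
  then obtain U V where UV: "openin Z U" "openin Z V" "z \<in> U" "z \<in> V" "U \<times> V \<subseteq> W"
    using W(1) unfolding openin_prod_topology_alt by metis
  have "inj_on s (U \<inter> V)"
  proof (rule inj_onI)
    fix x y assume xy: "x \<in> U \<inter> V" "y \<in> U \<inter> V" "s x = s y"
    then have t: "x \<in> topspace Z" "y \<in> topspace Z" using UV openin_subset by blast+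
    have "(x, y) \<in> ?E" using W(2) UV(5) xy by blast
    then have "d x y \<in> units G" by simp
    then have "d x y = r y" using d_src[OF t xy(3)] by (simp add: G.units_iff)
    then show "x = y" using l_d[OF t xy(3)] L.act_unit[OF t(2)] by simp
  qed
  then show thesis using UV that by (meson IntI openin_Int)
qed

end

text \<open>Inverting arrows exchanges right and left actions, so that one-sided results cover both
  sides.\<close>

lemma right_action_flip:
  assumes "groupoid H" and cont: "continuous_map (gtop H) (gtop H) (ginv H)"
    and "right_action H Z s a"
  shows "left_action H Z s (\<lambda>h z. a z (ginv H h))"
proof -
  interpret groupoid H by fact
  interpret right_action H Z s a by fact
  show ?thesis
  proof
    let ?D = "subtopology (prod_topology (gtop H) Z) {(h, z). src H h = s z}"
    have id: "continuous_map ?D (prod_topology (gtop H) Z) (\<lambda>x. x)"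
      by (simp add: continuous_map_from_subtopology)
    have "continuous_map ?D Z (\<lambda>p. a (snd p) (ginv H (fst p)))"
    proof (rule continuous_map_partial[OF act_continuous])
      show "continuous_map ?D Z snd"
        using continuous_map_snd_of[OF id] by (simp add: o_def)
      show "continuous_map ?D (gtop H) (\<lambda>p. ginv H (fst p))"
        using continuous_map_compose[OF continuous_map_fst_of[OF id] cont] by (simp add: o_def)
    qed (auto simp: topspace_gtop rng_inv)
    then show "continuous_map ?D Z (\<lambda>(h, z). a z (ginv H h))"
      by (simp add: case_prod_unfold)
    show "continuous_map Z (unit_space H) s" by (rule anchor_continuous)
    fix z assume z: "z \<in> topspace Z"
    then have "s z \<in> units H"
      using continuous_map_funspace[OF anchor_continuous] topspace_unit_space by blast
    then show "a z (ginv H (s z)) = z" using z by (simp add: act_unit inv_unit)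
  qed (simp_all add: anchor_act act_act inv_closed rng_inv src_inv inv_mult)
qed

lemma left_action_flip:
  assumes "groupoid G" and cont: "continuous_map (gtop G) (gtop G) (ginv G)"
    and "left_action G Z r l"
  shows "right_action G Z r (\<lambda>z g. l (ginv G g) z)"
proof -
  interpret groupoid G by fact
  interpret left_action G Z r l by fact
  show ?thesis
  proof
    let ?D = "subtopology (prod_topology Z (gtop G)) {(z, g). r z = rng G g}"
    have id: "continuous_map ?D (prod_topology Z (gtop G)) (\<lambda>x. x)"
      by (simp add: continuous_map_from_subtopology)
    have "continuous_map ?D Z (\<lambda>p. l (ginv G (snd p)) (fst p))"
    proof (rule continuous_map_partial[OF act_continuous])
      show "continuous_map ?D Z fst"
        using continuous_map_fst_of[OF id] by (simp add: o_def)
      show "continuous_map ?D (gtop G) (\<lambda>p. ginv G (snd p))"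
        using continuous_map_compose[OF continuous_map_snd_of[OF id] cont] by (simp add: o_def)
    qed (auto simp: topspace_gtop src_inv)
    then show "continuous_map ?D Z (\<lambda>(z, g). l (ginv G g) z)"
      by (simp add: case_prod_unfold)
    show "continuous_map Z (unit_space G) r" by (rule anchor_continuous)
    fix z assume z: "z \<in> topspace Z"
    then have "r z \<in> units G"
      using continuous_map_funspace[OF anchor_continuous] topspace_unit_space by blast
    then show "l (ginv G (r z)) z = z" using z by (simp add: act_unit inv_unit)
  qed (simp_all add: anchor_act act_act inv_closed rng_inv src_inv inv_mult)
qed

text \<open>Left division in the flipped bibundle must return the h with
  \<open>a w (ginv H h) = z\<close>, hence the inverse of \<open>e z w\<close>; likewise on the
  other side. Statements about one anchor are read off for the other through this symmetry.\<close>

lemma (in bibundle) flip: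
  "bibundle H G Z s r (\<lambda>h z. a z (ginv H h)) (\<lambda>z g. l (ginv G g) z)
     (\<lambda>z w. ginv H (e z w)) (\<lambda>z w. ginv G (d z w))"
proof -
  interpret L': left_action H Z s "\<lambda>h z. a z (ginv H h)"
    by (rule right_action_flip[OF H.groupoid_axioms H.continuous_inv R.right_action_axioms])
  interpret R': right_action G Z r "\<lambda>z g. l (ginv G g) z"
    by (rule left_action_flip[OF G.groupoid_axioms G.continuous_inv L.left_action_axioms])
  show ?thesis
  proof
    show "continuous_map (subtopology (prod_topology Z Z) {(z, w). r z = r w}) (gtop H)
        (\<lambda>(z, w). ginv H (e z w))"
      using H.continuous_map_ginv[OF e_continuous] by (simp add: case_prod_unfold)
    show "continuous_map (subtopology (prod_topology Z Z) {(z, w). s z = s w}) (gtop G)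
        (\<lambda>(z, w). ginv G (d z w))"
      using G.continuous_map_ginv[OF d_continuous] by (simp add: case_prod_unfold)
  qed (simp_all add: s_l r_a l_a open_r surj_r open_s surj_s d_src l_d d_l e_rng a_e e_a d_closed e_closed
      G.inv_closed G.rng_inv G.src_inv G.inv_inv H.inv_closed H.rng_inv H.src_inv H.inv_inv)
qed

section \<open>Bibundles and equivalences\<close>

text \<open>The map \<open>?\<Theta>\<close> is a homeomorphism onto the set of pairs on which
  \<open>s\<close> agrees, its inverse being given by \<open>d\<close>. That set is closed because
  the units of \<open>H\<close> are Hausdorff, so \<open>?\<Theta>\<close> is closed and injective
  as a map into the whole product, hence proper.\<close>

lemma (in bibundle) proper_left: "proper_left_action G Z r l"
proof -
  let ?E = "subtopology (prod_topology (gtop G) Z) {(g, z). src G g = r z}"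
  let ?D = "{p \<in> topspace (prod_topology Z Z). s (fst p) = s (snd p)}"
  let ?\<Theta> = "\<lambda>(g, z). (l g z, z)"
  have cl: "closedin (prod_topology Z Z) ?D"
  proof (rule closedin_continuous_maps_eq[OF H.Hausdorff_units])
    show "continuous_map (prod_topology Z Z) (unit_space H) (\<lambda>p. s (fst p))"
      "continuous_map (prod_topology Z Z) (unit_space H) (\<lambda>p. s (snd p))"
      using continuous_map_compose[OF continuous_map_fst R.anchor_continuous]
        continuous_map_compose[OF continuous_map_snd R.anchor_continuous] by (simp_all add: o_def)
  qed
  have D_eq: "subtopology (prod_topology Z Z) ?D = subtopology (prod_topology Z Z) {(z, w). s z = s w}"
    by (subst subtopology_restrict[symmetric]) (auto intro: arg_cong[where f = "subtopology _"])
  have id: "continuous_map (subtopology (prod_topology Z Z) ?D) (prod_topology Z Z) (\<lambda>x. x)"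
    and id': "continuous_map ?E (prod_topology (gtop G) Z) (\<lambda>x. x)"
    by (simp_all add: continuous_map_from_subtopology)
  have "homeomorphic_maps ?E (subtopology (prod_topology Z Z) ?D) ?\<Theta> (\<lambda>(z, w). (d z w, w))"
    unfolding homeomorphic_maps_def
  proof (intro conjI ballI)
    have "continuous_map ?E (prod_topology Z Z) (\<lambda>p. (l (fst p) (snd p), snd p))"
      using L.act_continuous continuous_map_snd_of[OF id'] by (simp add: continuous_map_paired case_prod_unfold o_def)
    then show "continuous_map ?E (subtopology (prod_topology Z Z) ?D) ?\<Theta>"
      by (auto simp: continuous_map_in_subtopology case_prod_unfold topspace_gtop l_closed s_l)
    have "continuous_map (subtopology (prod_topology Z Z) ?D) (prod_topology (gtop G) Z)
        (\<lambda>p. (d (fst p) (snd p), snd p))"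
      using d_continuous continuous_map_snd_of[OF id] unfolding D_eq
      by (simp add: continuous_map_paired case_prod_unfold o_def)
    then show "continuous_map (subtopology (prod_topology Z Z) ?D) ?E (\<lambda>(z, w). (d z w, w))"
      by (auto simp: continuous_map_in_subtopology case_prod_unfold d_src)
  qed (auto simp: topspace_gtop d_l l_d)
  then have hom: "homeomorphic_map ?E (subtopology (prod_topology Z Z) ?D) ?\<Theta>"
    by (rule homeomorphic_maps_imp_map)
  show ?thesis
    unfolding proper_left_action_def
  proof (rule closed_injective_imp_proper_map)
    show "closed_map ?E (prod_topology Z Z) ?\<Theta>"
      unfolding closed_map_def
    proof (intro allI impI)
      fix C assume "closedin ?E C"
      then have "closedin (subtopology (prod_topology Z Z) ?D) (?\<Theta> ` C)"
        using homeomorphic_imp_closed_map[OF hom] by (simp add: closed_map_def)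
      then show "closedin (prod_topology Z Z) (?\<Theta> ` C)"
        using cl by (rule closedin_trans_full)
    qed
    show "inj_on ?\<Theta> (topspace ?E)" by (rule homeomorphic_imp_injective_map[OF hom])
  qed
qed

lemma homeomorphic_maps_flip:
  assumes "groupoid H" and cont: "continuous_map (gtop H) (gtop H) (ginv H)"
  shows "homeomorphic_maps (subtopology (prod_topology Z (gtop H)) {(z, h). s z = rng H h})
    (subtopology (prod_topology (gtop H) Z) {(h, z). src H h = s z})
    (\<lambda>(z, h). (ginv H h, z)) (\<lambda>(h, z). (z, ginv H h))"
proof -
  interpret groupoid H by fact
  have "homeomorphic_maps (prod_topology Z (gtop H)) (prod_topology (gtop H) Z)
      (\<lambda>(z, h). (ginv H h, z)) (\<lambda>(h, z). (z, ginv H h))"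
    unfolding homeomorphic_maps_def case_prod_unfold continuous_map_paired
    using continuous_map_compose[OF continuous_map_fst cont]
      continuous_map_compose[OF continuous_map_snd cont]
    by (auto simp: o_def inv_inv topspace_gtop continuous_map_fst continuous_map_snd)
  then show ?thesis
    by (rule homeomorphic_maps_subtopologies_alt) (auto simp: topspace_gtop rng_inv src_inv)
qed

text \<open>Inverting the arrow coordinate is a homeomorphism between the two domains and leaves the
  resulting pair of points unchanged, so properness transfers both ways.\<close>

lemma proper_right_action_flip:
  assumes "groupoid H" "continuous_map (gtop H) (gtop H) (ginv H)"
  shows "proper_right_action H Z s a \<longleftrightarrow> proper_left_action H Z s (\<lambda>h z. a z (ginv H h))"
proof -
  interpret groupoid H by fact
  note hom = homeomorphic_maps_flip[OF assms, of Z s]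
  have id: "homeomorphic_maps (prod_topology Z Z) (prod_topology Z Z) (\<lambda>x. x) (\<lambda>x. x)"
    by (simp add: homeomorphic_maps_def)
  show ?thesis
    unfolding proper_right_action_def proper_left_action_def
  proof
    assume "proper_map (subtopology (prod_topology Z (gtop H)) {(z, h). s z = rng H h}) (prod_topology Z Z)
        (\<lambda>(z, h). (a z h, z))"
    then show "proper_map (subtopology (prod_topology (gtop H) Z) {(h, z). src H h = s z}) (prod_topology Z Z)
        (\<lambda>(h, z). (a z (ginv H h), z))"
      by (rule proper_map_transport[OF _ hom[THEN homeomorphic_maps_sym[THEN iffD1]] id]) auto
  next
    assume "proper_map (subtopology (prod_topology (gtop H) Z) {(h, z). src H h = s z}) (prod_topology Z Z)
        (\<lambda>(h, z). (a z (ginv H h), z))"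
    then show "proper_map (subtopology (prod_topology Z (gtop H)) {(z, h). s z = rng H h}) (prod_topology Z Z)
        (\<lambda>(z, h). (a z h, z))"
      by (rule proper_map_transport[OF _ hom id]) (auto simp: inv_inv topspace_gtop)
  qed
qed

lemma left_orbit_flip:
  assumes "groupoid H"
  shows "left_orbit H s (\<lambda>h z. a z (ginv H h)) z = right_orbit H s a z"
proof -
  interpret groupoid H by fact
  show ?thesis
  proof (intro equalityI subsetI)
    fix w assume "w \<in> left_orbit H s (\<lambda>h z. a z (ginv H h)) z"
    then obtain h where "w = a z (ginv H h)" "h \<in> arrows H" "src H h = s z"
      unfolding left_orbit_def by blast
    then show "w \<in> right_orbit H s a z"
      unfolding right_orbit_def by (intro CollectI exI[of _ "ginv H h"]) (simp add: inv_closed rng_inv)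
  next
    fix w assume "w \<in> right_orbit H s a z"
    then obtain h where "w = a z h" "h \<in> arrows H" "s z = rng H h"
      unfolding right_orbit_def by blast
    then show "w \<in> left_orbit H s (\<lambda>h z. a z (ginv H h)) z"
      unfolding left_orbit_def by (intro CollectI exI[of _ "ginv H h"]) (simp add: inv_closed inv_inv src_inv)
  qed
qed

context bibundle
begin

text \<open>Division recovers an arrow from its effect on a point, so any arrow fixing z equals
  \<open>d z z\<close>, which is the unit \<open>r z\<close>.\<close>

lemma free_left: "free_left_action G Z r l"
  unfolding free_left_action_def
proof (intro ballI impI)
  fix g z assume gz: "g \<in> arrows G" "z \<in> topspace Z" "src G g = r z" "l g z = z"
  then have "g = d z z" using d_l[of g z] by simp
  also have "d z z = r z"
    using d_l[of "r z" z] r_units[of z] gz by (simp add: G.units_iff L.act_unit)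
  finally show "g \<in> units G" using r_units gz by simp
qed

text \<open>If s x = s y, then g x = (g d(x, y)) y, so each of the two orbits contains the other.
  Conversely \<open>s\<close> is invariant under the left action.\<close>

lemma left_orbit_eq_iff:
  assumes z: "z \<in> topspace Z" and w: "w \<in> topspace Z"
  shows "s z = s w \<longleftrightarrow> left_orbit G r l z = left_orbit G r l w"
proof
  have sub: "left_orbit G r l x \<subseteq> left_orbit G r l y"
    if x: "x \<in> topspace Z" and y: "y \<in> topspace Z" and xy: "s x = s y" for x y
  proof
    fix v assume "v \<in> left_orbit G r l x"
    then obtain g where g: "v = l g x" "g \<in> arrows G" "src G g = r x" unfolding left_orbit_def by blast
    have "l (gmult G g (d x y)) y = l g (l (d x y) y)"
      using g x y xy by (intro L.act_act) (simp_all add: d_closed d_src d_rng)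
    then have "v = l (gmult G g (d x y)) y"
      using g x y xy by (simp add: l_d)
    then show "v \<in> left_orbit G r l y"
      using g x y xy unfolding left_orbit_def
      by (intro CollectI exI[of _ "gmult G g (d x y)"])
         (simp add: G.mult_closed d_closed d_src d_rng G.src_mult)
  qed
  show "left_orbit G r l z = left_orbit G r l w" if "s z = s w"
    using sub[OF z w that] sub[OF w z that[symmetric]] by blast
  have "z \<in> left_orbit G r l z"
    using r_units[OF z] L.act_unit[OF z] unfolding left_orbit_def
    by (intro CollectI exI[of _ "r z"]) (simp add: G.units_iff)
  moreover assume "left_orbit G r l z = left_orbit G r l w"
  ultimately obtain g where "z = l g w" "g \<in> arrows G" "src G g = r w"
    unfolding left_orbit_def by blast
  then show "s z = s w" using s_l w by simp
qed

lemma quotient_map_s: "quotient_map Z (unit_space H) s"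
  by (intro continuous_open_imp_quotient_map R.anchor_continuous open_s)
     (simp add: surj_s H.topspace_unit_space)

lemma is_groupoid_equivalence: "is_groupoid_equivalence G H Z r s l a"
proof -
  interpret F: bibundle H G Z s r "\<lambda>h z. a z (ginv H h)" "\<lambda>z g. l (ginv G g) z"
     "\<lambda>z w. ginv H (e z w)" "\<lambda>z w. ginv G (d z w)"
    by (rule flip)
  have "free_right_action H Z s a"
    unfolding free_right_action_def
  proof (intro ballI impI)
    fix z h assume zh: "z \<in> topspace Z" "h \<in> arrows H" "s z = rng H h" "a z h = z"
    then have "ginv H h \<in> units H"
      using F.free_left unfolding free_left_action_def by (simp add: H.inv_closed H.src_inv H.inv_inv)
    then show "h \<in> units H" using H.inv_in_units zh by blast
  qed
  moreover have "proper_right_action H Z s a"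
    unfolding proper_right_action_flip[OF H.groupoid_axioms H.continuous_inv] by (rule F.proper_left)
  moreover have "r z = r w \<longleftrightarrow> right_orbit H s a z = right_orbit H s a w"
    if "z \<in> topspace Z" "w \<in> topspace Z" for z w
    using F.left_orbit_eq_iff[OF that] by (simp add: left_orbit_flip[OF H.groupoid_axioms])
  ultimately show ?thesis
    unfolding is_groupoid_equivalence_def induces_homeomorphism_iff
    using free_left proper_left left_orbit_eq_iff quotient_map_s F.quotient_map_s s_l r_a l_a
      L.left_action_axioms R.right_action_axioms by simp
qed

end

section \<open>Division maps recovered from free and proper actions\<close>

text \<open>Freeness makes the dividing arrow unique, properness makes it continuous, and openness
  of the source map makes the quotient map open. The quotient \<open>p\<close> is kept abstract so
  that the result applies to \<open>s\<close> and, once the right action is turned around, to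
  \<open>r\<close>.\<close>

lemma (in ample_groupoid) left_division:
  assumes left: "left_action G Z r l"
    and free: "free_left_action G Z r l" and proper: "proper_left_action G Z r l"
    and quot: "quotient_map Z Y p"
    and orb: "\<forall>z\<in>topspace Z. \<forall>w\<in>topspace Z.
      p z = p w \<longleftrightarrow> left_orbit G r l z = left_orbit G r l w"
  shows "open_map Z Y p"
    and "\<exists>d. continuous_map (subtopology (prod_topology Z Z) {(z, w). p z = p w}) (gtop G) (\<lambda>(z, w). d z w) \<and>
      (\<forall>z\<in>topspace Z. \<forall>w\<in>topspace Z. p z = p w \<longrightarrow> src G (d z w) = r w \<and> l (d z w) w = z) \<and>
      (\<forall>g\<in>arrows G. \<forall>w\<in>topspace Z. src G g = r w \<longrightarrow> d (l g w) w = g)"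
proof -
  interpret L: left_action G Z r l by fact
  note lc = left_act_closed[OF left]
  let ?E = "subtopology (prod_topology (gtop G) Z) {(g, z). src G g = r z}"
  let ?D = "subtopology (prod_topology Z Z) {(z, w). p z = p w}"
  let ?\<Theta> = "\<lambda>(g, z). (l g z, z)"
  have r_units: "r z \<in> units G" if "z \<in> topspace Z" for z
    using continuous_map_funspace[OF L.anchor_continuous] that topspace_unit_space by blast
  \<comment> \<open>The hypothesis compares whole orbits; it is converted here into membership,
    which supplies the arrow carrying w to z.\<close>
  have p_orb: "p z = p w \<longleftrightarrow> z \<in> left_orbit G r l w" if z: "z \<in> topspace Z" and w: "w \<in> topspace Z" for z w
  proof
    have "z \<in> left_orbit G r l z"
      using r_units[OF z] L.act_unit[OF z] unfolding left_orbit_def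
      by (intro CollectI exI[of _ "r z"]) (simp add: units_iff)
    then show "z \<in> left_orbit G r l w" if "p z = p w" using orb z w that by simp
    assume "z \<in> left_orbit G r l w"
    then obtain g where g: "z = l g w" "g \<in> arrows G" "src G g = r w" unfolding left_orbit_def by blast
    have rz: "r z = rng G g" using g w by (simp add: L.anchor_act)
    have "l (ginv G g) z = l (gmult G (ginv G g) g) w"
      using g w by (simp add: L.act_act inv_closed src_inv)
    also have "\<dots> = w" using g w by (simp add: mult_inv_left L.act_unit)
    finally have w_eq: "l (ginv G g) z = w" .
    have "left_orbit G r l z = left_orbit G r l w"
    proof (intro equalityI subsetI)
      fix v assume "v \<in> left_orbit G r l z"
      then obtain h where h: "v = l h z" "h \<in> arrows G" "src G h = r z" unfolding left_orbit_def by blast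
      then have "v = l (gmult G h g) w" using g w rz by (simp add: L.act_act)
      then show "v \<in> left_orbit G r l w" unfolding left_orbit_def using h g rz
        by (intro CollectI exI[of _ "gmult G h g"]) (simp add: mult_closed src_mult)
    next
      fix v assume "v \<in> left_orbit G r l w"
      then obtain h where h: "v = l h w" "h \<in> arrows G" "src G h = r w" unfolding left_orbit_def by blast
      then have "v = l (gmult G h (ginv G g)) z"
        using g z rz w_eq L.act_act[of h "ginv G g" z] by (simp add: inv_closed rng_inv src_inv)
      then show "v \<in> left_orbit G r l z" unfolding left_orbit_def using h g rz
        by (intro CollectI exI[of _ "gmult G h (ginv G g)"]) (simp add: mult_closed src_mult inv_closed rng_inv src_inv)
    qed
    then show "p z = p w" using orb z w by simp
  qed
  have p_l: "p (l g z) = p z" if "g \<in> arrows G" "z \<in> topspace Z" "src G g = r z" for g z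
    using that p_orb[OF lc[OF that]] by (auto simp: left_orbit_def)
  have ex: "\<exists>g. g \<in> arrows G \<and> src G g = r w \<and> l g w = z"
    if "z \<in> topspace Z" "w \<in> topspace Z" "p z = p w" for z w
    using p_orb[OF that(1,2)] that(3) by (auto simp: left_orbit_def)
  \<comment> \<open>If g and h move w to the same point, then h^-1 g fixes w. By freeness it is a
    unit, which forces g = h.\<close>
  have unique: "g = h"
    if g: "g \<in> arrows G" "src G g = r w" and h: "h \<in> arrows G" "src G h = r w"
      and w: "w \<in> topspace Z" and eq: "l g w = l h w" for g h w
  proof -
    have rng_eq: "rng G g = rng G h" using L.anchor_act g h w eq by metis
    let ?k = "gmult G (ginv G h) g"
    have k: "?k \<in> arrows G" "src G ?k = src G g" "rng G ?k = src G h"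
      using g h rng_eq by (simp_all add: mult_closed inv_closed src_inv src_mult rng_mult rng_inv)
    have "l ?k w = l (gmult G (ginv G h) h) w"
      using L.act_act[of "ginv G h" g w] L.act_act[of "ginv G h" h w] g h w rng_eq eq
      by (simp add: inv_closed src_inv)
    also have "\<dots> = w" using h w by (simp add: mult_inv_left L.act_unit)
    finally have "?k \<in> units G"
      using free k g w unfolding free_left_action_def by metis
    then have "?k = src G h" using k rng_unit by metis
    then have "gmult G h ?k = h" using src_mult_right[OF h(1)] by simp
    then show "g = h" using mult_inv_cancel[of h g] g h rng_eq by simp
  qed
  define d where "d z w = (THE g. g \<in> arrows G \<and> src G g = r w \<and> l g w = z)" for z w
  have d: "d z w \<in> arrows G \<and> src G (d z w) = r w \<and> l (d z w) w = z"
    if "z \<in> topspace Z" "w \<in> topspace Z" "p z = p w" for z w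
    unfolding d_def by (rule theI') (use ex[OF that] unique[OF _ _ _ _ that(2)] in blast)
  have d_l: "d (l g w) w = g" if g: "g \<in> arrows G" "src G g = r w" and w: "w \<in> topspace Z" for g w
  proof -
    have "d (l g w) w \<in> arrows G \<and> src G (d (l g w) w) = r w \<and> l (d (l g w) w) w = l g w"
      using d[OF lc[OF g(1) w g(2)] w] p_l[OF g(1) w g(2)] by blast
    then show ?thesis using unique[of "d (l g w) w" w g] g w by blast
  qed
  {
    show "open_map Z Y p"
      unfolding open_map_def
    proof (intro allI impI)
      fix U assume U: "openin Z U"
      have "openin Z {w \<in> topspace Z. p w \<in> p ` U}"
      proof (subst openin_subopen, intro ballI)
        fix w assume "w \<in> {w \<in> topspace Z. p w \<in> p ` U}"
        then obtain u where w: "w \<in> topspace Z" and u: "u \<in> U" "p u = p w" by auto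
        then obtain g where g: "g \<in> arrows G" "src G g = r w" "l g w = u"
          using ex[of u w] openin_subset[OF U] by blast
        \<comment> \<open>Arrows near g move points near w into \<open>U\<close>. A point close
          enough to w has its anchor in the open set of sources of \<open>A\<close>, so some arrow
          of \<open>A\<close> acts on it and takes it into \<open>U\<close>. Thus the saturation of
          \<open>U\<close> is open.\<close>
        let ?O = "{q \<in> topspace ?E. (\<lambda>(g, z). l g z) q \<in> U}"
        have "openin ?E ?O" by (rule openin_continuous_map_preimage[OF L.act_continuous U])
        then obtain W where W: "openin (prod_topology (gtop G) Z) W" "?O = W \<inter> {(g, z). src G g = r z}"
          unfolding openin_subtopology by metis
        have "(g, w) \<in> ?O" using g w u by (simp add: topspace_gtop)
        then have "(g, w) \<in> W" using W(2) by blast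
        then obtain A B where AB: "openin (gtop G) A" "openin Z B" "g \<in> A" "w \<in> B" "A \<times> B \<subseteq> W"
          using W(1) unfolding openin_prod_topology_alt by metis
        have "continuous_map Z (gtop G) r" by (rule continuous_map_units[OF L.anchor_continuous])
        then have "openin Z {z \<in> topspace Z. r z \<in> src G ` A}"
          using open_src[OF AB(1)] by (rule openin_continuous_map_preimage)
        then have "openin Z (B \<inter> {z \<in> topspace Z. r z \<in> src G ` A})" using AB(2) by blast
        moreover have "w \<in> B \<inter> {z \<in> topspace Z. r z \<in> src G ` A}" using AB g w by (auto intro: rev_image_eqI)
        moreover have "B \<inter> {z \<in> topspace Z. r z \<in> src G ` A} \<subseteq> {w \<in> topspace Z. p w \<in> p ` U}"
        proof
          fix z assume "z \<in> B \<inter> {z \<in> topspace Z. r z \<in> src G ` A}"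
          then obtain h where h: "z \<in> B" "z \<in> topspace Z" "h \<in> A" "src G h = r z" by auto
          then have "(h, z) \<in> ?O" using W(2) AB(5) by blast
          then have "h \<in> arrows G" "l h z \<in> U" by (simp_all add: topspace_gtop)
          then show "z \<in> {w \<in> topspace Z. p w \<in> p ` U}"
            using p_l[of h z] h by (auto intro: rev_image_eqI)
        qed
        ultimately show "\<exists>T. openin Z T \<and> w \<in> T \<and> T \<subseteq> {w \<in> topspace Z. p w \<in> p ` U}" by blast
      qed
      moreover have "p ` U \<subseteq> topspace Y"
        using quot openin_subset[OF U] unfolding quotient_map_def by blast
      ultimately show "openin Y (p ` U)" using quot unfolding quotient_map_def by blast
    qed
    have "continuous_map ?D (gtop G) (\<lambda>(z, w). d z w)"
      unfolding continuous_map_closedin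
    proof (intro conjI allI impI)
      show "(\<lambda>(z, w). d z w) \<in> topspace ?D \<rightarrow> topspace (gtop G)"
        using d by (auto simp: topspace_gtop)
      fix C assume C: "closedin (gtop G) C"
      let ?F = "{q \<in> topspace ?E. fst q \<in> C}"
      have "continuous_map ?E (gtop G) fst"
        by (intro continuous_map_from_subtopology continuous_map_fst)
      then have "closedin ?E ?F" using C by (rule closedin_continuous_map_preimage)
      \<comment> \<open>The preimage of \<open>C\<close> under division consists of the pairs (g z,
        z) with g in \<open>C\<close>. Properness enters through the closedness of
        \<open>?\<Theta>\<close>.\<close>
      then have "closedin (prod_topology Z Z) (?\<Theta> ` ?F)"
        by (rule proper[unfolded proper_left_action_def, THEN proper_imp_closed_map,
            unfolded closed_map_def, rule_format])
      moreover have "?\<Theta> ` ?F \<subseteq> {(z, w). p z = p w}" by (auto simp: topspace_gtop p_l)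
      ultimately have "closedin ?D (?\<Theta> ` ?F)"
        by (rule closedin_subset_topspace)
      moreover have "?\<Theta> ` ?F = {q \<in> topspace ?D. (\<lambda>(z, w). d z w) q \<in> C}"
      proof (intro equalityI subsetI)
        fix q assume "q \<in> ?\<Theta> ` ?F"
        then show "q \<in> {q \<in> topspace ?D. (\<lambda>(z, w). d z w) q \<in> C}"
          by (auto simp: topspace_gtop p_l d_l lc)
      next
        fix q assume q: "q \<in> {q \<in> topspace ?D. (\<lambda>(z, w). d z w) q \<in> C}"
        obtain z w where "q = (z, w)" by force
        with q have zw: "z \<in> topspace Z" "w \<in> topspace Z" "p z = p w" "d z w \<in> C" "q = (z, w)" by auto
        then have "q = ?\<Theta> (d z w, w)" "(d z w, w) \<in> ?F" using d[OF zw(1-3)] by (auto simp: topspace_gtop)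
        then show "q \<in> ?\<Theta> ` ?F" by blast
      qed
      ultimately show "closedin ?D {q \<in> topspace ?D. (\<lambda>(z, w). d z w) q \<in> C}" by simp
    qed
    then show "\<exists>d. continuous_map ?D (gtop G) (\<lambda>(z, w). d z w) \<and>
      (\<forall>z\<in>topspace Z. \<forall>w\<in>topspace Z. p z = p w \<longrightarrow> src G (d z w) = r w \<and> l (d z w) w = z) \<and>
      (\<forall>g\<in>arrows G. \<forall>w\<in>topspace Z. src G g = r w \<longrightarrow> d (l g w) w = g)"
      using d d_l by (intro exI[of _ d]) blast
  }
qed

text \<open>Left division is used twice, the second time for the right action turned into a left
  one. There it yields the h with z = w h^-1, so right division is the inverse of that
  arrow.\<close>

lemma equivalence_imp_bibundle:
  assumes G: "ample_groupoid G" and H: "ample_groupoid H"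
    and eq: "is_groupoid_equivalence G H Z r s l a"
  obtains d e where "bibundle G H Z r s l a d e"
proof -
  interpret G: ample_groupoid G by fact
  interpret H: ample_groupoid H by fact
  have left: "left_action G Z r l" "free_left_action G Z r l" "proper_left_action G Z r l"
    and right: "right_action H Z s a" "free_right_action H Z s a" "proper_right_action H Z s a"
    and quot: "quotient_map Z (unit_space G) r" "quotient_map Z (unit_space H) s"
    and orb: "\<forall>z\<in>topspace Z. \<forall>w\<in>topspace Z. s z = s w \<longleftrightarrow> left_orbit G r l z = left_orbit G r l w"
      "\<forall>z\<in>topspace Z. \<forall>w\<in>topspace Z. r z = r w \<longleftrightarrow> right_orbit H s a z = right_orbit H s a w"
    using eq unfolding is_groupoid_equivalence_def induces_homeomorphism_iff by - (elim conjE; assumption)+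
  have comm: "\<And>g z. \<lbrakk>g \<in> arrows G; z \<in> topspace Z; src G g = r z\<rbrakk> \<Longrightarrow> s (l g z) = s z"
    "\<And>z h. \<lbrakk>z \<in> topspace Z; h \<in> arrows H; s z = rng H h\<rbrakk> \<Longrightarrow> r (a z h) = r z"
    "\<And>g z h. \<lbrakk>g \<in> arrows G; z \<in> topspace Z; h \<in> arrows H; src G g = r z; s z = rng H h\<rbrakk>
       \<Longrightarrow> a (l g z) h = l g (a z h)"
    using eq unfolding is_groupoid_equivalence_def by blast+
  note open_s = G.left_division(1)[OF left quot(2) orb(1)]
  obtain d where d: "continuous_map (subtopology (prod_topology Z Z) {(z, w). s z = s w}) (gtop G) (\<lambda>(z, w). d z w)"
    "\<forall>z\<in>topspace Z. \<forall>w\<in>topspace Z. s z = s w \<longrightarrow> src G (d z w) = r w \<and> l (d z w) w = z"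
    "\<forall>g\<in>arrows G. \<forall>w\<in>topspace Z. src G g = r w \<longrightarrow> d (l g w) w = g"
    using G.left_division(2)[OF left quot(2) orb(1)] by (elim exE conjE) (rule that)
  let ?l = "\<lambda>h z. a z (ginv H h)"
  have left': "left_action H Z s ?l"
    by (rule right_action_flip[OF H.groupoid_axioms H.continuous_inv right(1)])
  have free': "free_left_action H Z s ?l"
    using right(2) unfolding free_left_action_def free_right_action_def
    by (metis H.inv_closed H.inv_in_units H.rng_inv)
  have proper': "proper_left_action H Z s ?l"
    using right(3) unfolding proper_right_action_flip[OF H.groupoid_axioms H.continuous_inv] .
  have orb': "\<forall>z\<in>topspace Z. \<forall>w\<in>topspace Z. r z = r w \<longleftrightarrow> left_orbit H s ?l z = left_orbit H s ?l w"
    using orb(2) by (simp add: left_orbit_flip[OF H.groupoid_axioms])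
  note open_r = H.left_division(1)[OF left' free' proper' quot(1) orb']
  obtain e where e: "continuous_map (subtopology (prod_topology Z Z) {(z, w). r z = r w}) (gtop H) (\<lambda>(z, w). e z w)"
    "\<forall>z\<in>topspace Z. \<forall>w\<in>topspace Z. r z = r w \<longrightarrow> src H (e z w) = s w \<and> ?l (e z w) w = z"
    "\<forall>h\<in>arrows H. \<forall>w\<in>topspace Z. src H h = s w \<longrightarrow> e (?l h w) w = h"
    using H.left_division(2)[OF left' free' proper' quot(1) orb'] by (elim exE conjE) (rule that)
  have e_cl: "e z w \<in> arrows H" if "z \<in> topspace Z" "w \<in> topspace Z" "r z = r w" for z w
    using funcset_mem[OF continuous_map_funspace[OF e(1)], of "(z, w)"] that by (simp add: arrows_def)
  have "bibundle G H Z r s l a d (\<lambda>z w. ginv H (e z w))"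
  proof (intro bibundle.intro bibundle_axioms.intro G H left(1) right(1) comm d(1) open_s open_r)
    show "continuous_map (subtopology (prod_topology Z Z) {(z, w). r z = r w}) (gtop H)
        (\<lambda>(z, w). ginv H (e z w))"
      using H.continuous_map_ginv[OF e(1)] by (simp add: case_prod_unfold)
    show "r ` topspace Z = units G" "s ` topspace Z = units H"
      using quot G.topspace_unit_space H.topspace_unit_space by (simp_all add: quotient_map_def)
    show "ginv H (e (a w h) w) = h" if "h \<in> arrows H" "w \<in> topspace Z" "s w = rng H h" for h w
      using e(3)[rule_format, of "ginv H h" w] that by (simp add: H.inv_closed H.src_inv H.inv_inv)
  qed (use d e in \<open>simp_all add: e_cl H.rng_inv\<close>)
  then show thesis using that by blast
qed

section \<open>Bibundles between full corners\<close>

text \<open>The identification of \<open>G\<close> with a restriction of \<open>K\<close> is kept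
  explicit, so that groupoids over different types can be placed in one and the same
  \<open>K\<close>.\<close>

locale corner = K: ample_groupoid K + G: ample_groupoid G
  for K :: "'k tgroupoid" and G :: "'a tgroupoid" +
  fixes A :: "'k set" and \<iota> :: "'a \<Rightarrow> 'k" and \<iota>' :: "'k \<Rightarrow> 'a"
  assumes A_open: "openin (unit_space K) A" and A_full: "full_in K A"
    and homeo: "homeomorphic_maps (gtop G) (gtop (restrict_groupoid K A)) \<iota> \<iota>'"
    and hom: "groupoid_hom G (restrict_groupoid K A) \<iota>"
    and hom': "groupoid_hom (restrict_groupoid K A) G \<iota>'"
begin

lemma A_units: "A \<subseteq> units K" and A_open_gtop: "openin (gtop K) A"
  using A_open K.openin_unit_space by auto

lemma A_simps: "u \<in> A \<Longrightarrow> u \<in> arrows K" "u \<in> A \<Longrightarrow> src K u = u" "u \<in> A \<Longrightarrow> rng K u = u"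
  using A_units K.units_iff K.rng_unit by blast+

lemma \<iota>:
  assumes "g \<in> arrows G"
  shows "\<iota> g \<in> arrows K" "rng K (\<iota> g) = \<iota> (rng G g)" "src K (\<iota> g) = \<iota> (src G g)"
    "\<iota> (rng G g) \<in> A" "\<iota> (src G g) \<in> A" "\<iota>' (\<iota> g) = g"
  using assms hom groupoid_hom_src_rng[OF G.groupoid_axioms K.groupoid_restrict hom assms] homeo
  by (auto simp: groupoid_hom_def arrows_restrict homeomorphic_maps_def topspace_gtop)

lemma \<iota>':
  assumes "x \<in> arrows K" "rng K x \<in> A" "src K x \<in> A"
  shows "\<iota>' x \<in> arrows G" "rng G (\<iota>' x) = \<iota>' (rng K x)" "src G (\<iota>' x) = \<iota>' (src K x)" "\<iota> (\<iota>' x) = x"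
proof -
  have x: "x \<in> arrows (restrict_groupoid K A)" using assms by (simp add: arrows_restrict)
  then show "\<iota>' x \<in> arrows G" using hom' by (simp add: groupoid_hom_def)
  show "rng G (\<iota>' x) = \<iota>' (rng K x)" "src G (\<iota>' x) = \<iota>' (src K x)"
    using groupoid_hom_src_rng[OF K.groupoid_restrict G.groupoid_axioms hom' x] by simp_all
  show "\<iota> (\<iota>' x) = x"
    using homeo x unfolding homeomorphic_maps_def topspace_gtop by blast
qed

lemma \<iota>'_A:
  assumes "u \<in> A"
  shows "\<iota>' u \<in> units G" "\<iota> (\<iota>' u) = u"
  using \<iota>'[of u] A_simps[OF assms] assms by (simp_all add: G.units_iff)

lemma \<iota>'_eq_iff: "u \<in> A \<Longrightarrow> v \<in> A \<Longrightarrow> \<iota>' u = \<iota>' v \<longleftrightarrow> u = v"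
  by (metis \<iota>'_A(2))

lemma \<iota>_mult:
  "\<lbrakk>g \<in> arrows G; h \<in> arrows G; src G g = rng G h\<rbrakk> \<Longrightarrow> \<iota> (gmult G g h) = gmult K (\<iota> g) (\<iota> h)"
  using hom by (simp add: groupoid_hom_def)

lemma continuous_map_\<iota>: "continuous_map T (gtop G) f \<Longrightarrow> continuous_map T (gtop K) (\<lambda>t. \<iota> (f t))"
  using homeo continuous_map_compose[of T "gtop G" f "gtop K" \<iota>]
  by (auto simp: homeomorphic_maps_def continuous_map_in_subtopology o_def)

lemma continuous_map_\<iota>':
  assumes "continuous_map T (gtop K) f" "\<And>t. t \<in> topspace T \<Longrightarrow> rng K (f t) \<in> A \<and> src K (f t) \<in> A"
  shows "continuous_map T (gtop G) (\<lambda>t. \<iota>' (f t))"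
proof -
  have "continuous_map T (gtop (restrict_groupoid K A)) f"
    using assms by (auto simp: continuous_map_in_subtopology)
  moreover have "continuous_map (gtop (restrict_groupoid K A)) (gtop G) \<iota>'"
    using homeo by (simp add: homeomorphic_maps_def)
  ultimately show ?thesis
    using continuous_map_compose by (fastforce simp: o_def)
qed

lemma continuous_map_anchor:
  assumes "continuous_map T (gtop K) f" "\<And>t. t \<in> topspace T \<Longrightarrow> f t \<in> A"
  shows "continuous_map T (unit_space G) (\<lambda>t. \<iota>' (f t))"
  using continuous_map_\<iota>'[OF assms(1)] assms(2) \<iota>'_A(1) A_simps
  by (auto simp: unit_space_def continuous_map_in_subtopology)

text \<open>Since \<open>\<iota>'\<close> inverts \<open>\<iota>\<close>, the image of an open
  \<open>U\<close> under the anchor is the preimage under \<open>\<iota>\<close> of f(U), a set that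
  is open in \<open>K\<close> by assumption.\<close>

lemma open_map_anchor:
  assumes f: "\<And>U. openin T U \<Longrightarrow> openin (gtop K) (f ` U)" "\<And>t. t \<in> topspace T \<Longrightarrow> f t \<in> A"
  shows "open_map T (unit_space G) (\<lambda>t. \<iota>' (f t))"
  unfolding open_map_def G.openin_unit_space
proof (intro allI impI conjI)
  fix U assume U: "openin T U"
  have fU: "f ` U \<subseteq> A" using openin_subset[OF U] f(2) by blast
  show "(\<lambda>t. \<iota>' (f t)) ` U \<subseteq> units G" using fU \<iota>'_A(1) by blast
  have "(\<lambda>t. \<iota>' (f t)) ` U = {g \<in> topspace (gtop G). \<iota> g \<in> f ` U}"
  proof (intro equalityI subsetI)
    fix g assume "g \<in> (\<lambda>t. \<iota>' (f t)) ` U"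
    then show "g \<in> {g \<in> topspace (gtop G). \<iota> g \<in> f ` U}"
      using fU \<iota>'_A by (auto simp: topspace_gtop G.units_iff image_subset_iff)
  next
    fix g assume "g \<in> {g \<in> topspace (gtop G). \<iota> g \<in> f ` U}"
    then obtain t where "g \<in> arrows G" "t \<in> U" "\<iota> g = f t" by (auto simp: topspace_gtop)
    then show "g \<in> (\<lambda>t. \<iota>' (f t)) ` U" using \<iota>(6)[of g] by (intro image_eqI[of _ _ t]) auto
  qed
  moreover have "openin (gtop G) {g \<in> topspace (gtop G). \<iota> g \<in> f ` U}"
    by (rule openin_continuous_map_preimage[OF continuous_map_\<iota>[OF continuous_map_id[unfolded id_def]] f(1)[OF U]])
  ultimately show "openin (gtop G) ((\<lambda>t. \<iota>' (f t)) ` U)" by simp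
qed

end

lemma corner_obtain:
  assumes "ample_groupoid K" "ample_groupoid G" "openin (unit_space K) A" "full_in K A"
    "groupoid_isomorphic G (restrict_groupoid K A)"
  obtains \<iota> \<iota>' where "corner K G A \<iota> \<iota>'"
  using assms unfolding groupoid_isomorphic_def corner_def corner_axioms_def by blast

text \<open>The points are the arrows of \<open>K\<close> from \<open>B\<close> to \<open>A\<close>,
  and both corners act by multiplication; division is z w^-1 on the left and w^-1 z on the right.
  Fullness of \<open>B\<close> makes the left anchor surjective, fullness of \<open>A\<close> the
  right one.\<close>

lemma bibundle_between_corners:
  assumes "corner K G A \<iota> \<iota>'" "corner K H B \<kappa> \<kappa>'"
  shows "bibundle G H (subtopology (gtop K) {z. rng K z \<in> A \<and> src K z \<in> B})
    (\<lambda>z. \<iota>' (rng K z)) (\<lambda>z. \<kappa>' (src K z)) (\<lambda>g z. gmult K (\<iota> g) z) (\<lambda>z h. gmult K z (\<kappa> h))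
    (\<lambda>z w. \<iota>' (gmult K z (ginv K w))) (\<lambda>z w. \<kappa>' (gmult K (ginv K w) z))"
proof -
  interpret G: corner K G A \<iota> \<iota>' by fact
  interpret H: corner K H B \<kappa> \<kappa>' by fact
  let ?Z = "subtopology (gtop K) {z. rng K z \<in> A \<and> src K z \<in> B}"
  let ?r = "\<lambda>z. \<iota>' (rng K z)" and ?s = "\<lambda>z. \<kappa>' (src K z)"
  have Z: "z \<in> topspace ?Z \<longleftrightarrow> z \<in> arrows K \<and> rng K z \<in> A \<and> src K z \<in> B" for z
    by (simp add: topspace_gtop)
  have Z_cont: "continuous_map T (gtop K) f" if "continuous_map T ?Z f" for T :: "'t topology" and f
    using that by (simp add: continuous_map_in_subtopology)
  \<comment> \<open>The ends vary in open sets, so the space is open in \<open>K\<close> and the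
    anchors inherit openness from the range and source maps of \<open>K\<close>.\<close>
  have Z_open: "openin (gtop K) U" if "openin ?Z U" for U
  proof -
    have "topspace (gtop K) \<inter> {z. rng K z \<in> A \<and> src K z \<in> B} =
        {z \<in> topspace (gtop K). rng K z \<in> A} \<inter> {z \<in> topspace (gtop K). src K z \<in> B}"
      by auto
    moreover have "openin (gtop K) \<dots>"
      using openin_continuous_map_preimage[OF G.K.rng_continuous G.A_open_gtop]
        openin_continuous_map_preimage[OF G.K.src_continuous H.A_open_gtop] by (rule openin_Int)
    ultimately have "openin (gtop K) (topspace (gtop K) \<inter> {z. rng K z \<in> A \<and> src K z \<in> B})"
      by (simp only:)
    moreover have "openin (subtopology (gtop K) (topspace (gtop K) \<inter> {z. rng K z \<in> A \<and> src K z \<in> B})) U"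
      using that by (simp only: subtopology_restrict)
    ultimately show ?thesis using openin_trans_full by blast
  qed
  \<comment> \<open>The anchor condition is an equation in \<open>H\<close>; applying
    \<open>\<kappa>\<close> turns it into composability in \<open>K\<close>.\<close>
  have H_comp: "src K z = rng K (\<kappa> h)"
    if "src K z \<in> B" "h \<in> arrows H" "\<kappa>' (src K z) = rng H h" for z h
    using H.\<iota>(2)[OF that(2)] H.\<iota>'_A(2)[OF that(1)] that(3) by simp
  have idZ: "continuous_map ?Z (gtop K) (\<lambda>z. z)" by (rule Z_cont) simp
  have fst: "continuous_map (subtopology (prod_topology S T) D) S fst"
    and snd: "continuous_map (subtopology (prod_topology S T) D) T snd"
    for S :: "'u topology" and T :: "'v topology" and D
    by (intro continuous_map_from_subtopology continuous_map_fst continuous_map_snd)+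
  show ?thesis
  proof (intro bibundle.intro bibundle_axioms.intro G.G.ample_groupoid_axioms H.G.ample_groupoid_axioms)
    show "left_action G ?Z ?r (\<lambda>g z. gmult K (\<iota> g) z)"
    proof
      show "continuous_map ?Z (unit_space G) ?r"
        by (rule G.continuous_map_anchor[OF G.K.continuous_map_rng[OF idZ]]) auto
      let ?D = "subtopology (prod_topology (gtop G) ?Z) {(g, z). src G g = \<iota>' (rng K z)}"
      have comp: "src K (\<iota> g) = rng K z" if "(g, z) \<in> topspace ?D" for g z
        using that by (auto simp: topspace_gtop G.\<iota> G.\<iota>'_A)
      have "continuous_map ?D (gtop K) (\<lambda>p. gmult K (\<iota> (fst p)) (snd p))"
        by (rule G.K.continuous_map_mult[OF G.continuous_map_\<iota>[OF fst] Z_cont[OF snd]]) (rule comp, simp only: prod.collapse)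
      then show "continuous_map ?D ?Z (\<lambda>(g, z). gmult K (\<iota> g) z)"
        using comp by (auto simp: continuous_map_in_subtopology case_prod_unfold topspace_gtop
            G.K.rng_mult G.K.src_mult G.\<iota>)
    next
      fix g h z assume "g \<in> arrows G" "h \<in> arrows G" "z \<in> topspace ?Z" "src G g = rng G h" "src G h = ?r z"
      then show "gmult K (\<iota> (gmult G g h)) z = gmult K (\<iota> g) (gmult K (\<iota> h) z)"
        by (auto simp: topspace_gtop G.\<iota>_mult G.\<iota> G.\<iota>'_A intro!: G.K.mult_assoc)
    next
      fix g z assume "g \<in> arrows G" "z \<in> topspace ?Z" "src G g = ?r z"
      then show "?r (gmult K (\<iota> g) z) = rng G g"
        by (simp add: topspace_gtop G.K.rng_mult G.\<iota> G.\<iota>'_A G.G.rng_closed)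
    next
      fix z assume "z \<in> topspace ?Z"
      then show "gmult K (\<iota> (?r z)) z = z" by (simp add: topspace_gtop G.\<iota>'_A G.K.rng_mult_left)
    qed
    show "right_action H ?Z ?s (\<lambda>z h. gmult K z (\<kappa> h))"
    proof
      show "continuous_map ?Z (unit_space H) ?s"
        by (rule H.continuous_map_anchor[OF G.K.continuous_map_src[OF idZ]]) auto
      let ?D = "subtopology (prod_topology ?Z (gtop H)) {(z, h). \<kappa>' (src K z) = rng H h}"
      have comp: "src K z = rng K (\<kappa> h)" if "(z, h) \<in> topspace ?D" for z h
        using that H_comp by (auto simp: topspace_gtop)
      have "continuous_map ?D (gtop K) (\<lambda>p. gmult K (fst p) (\<kappa> (snd p)))"
        by (rule G.K.continuous_map_mult[OF Z_cont[OF fst] H.continuous_map_\<iota>[OF snd]]) (rule comp, simp only: prod.collapse)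
      then have "continuous_map ?D (gtop K) (\<lambda>(z, h). gmult K z (\<kappa> h))"
        by (simp add: case_prod_unfold)
      moreover have "(\<lambda>(z, h). gmult K z (\<kappa> h)) \<in> topspace ?D \<rightarrow> {z. rng K z \<in> A \<and> src K z \<in> B}"
      proof
        fix p assume p: "p \<in> topspace ?D"
        obtain z h where zh: "p = (z, h)" by force
        then have "z \<in> arrows K" "rng K z \<in> A" "h \<in> arrows H"
          using p by (simp_all add: topspace_gtop)
        moreover have "src K z = rng K (\<kappa> h)"
          by (rule comp) (use p zh in \<open>simp only:\<close>)
        ultimately show "(\<lambda>(z, h). gmult K z (\<kappa> h)) p \<in> {z. rng K z \<in> A \<and> src K z \<in> B}"
          using H.\<iota>(1,3,5)[of h] zh by (simp add: G.K.rng_mult G.K.src_mult)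
      qed
      ultimately show "continuous_map ?D ?Z (\<lambda>(z, h). gmult K z (\<kappa> h))"
        unfolding continuous_map_in_subtopology by (rule conjI)
    next
      fix z g h assume *: "z \<in> topspace ?Z" "g \<in> arrows H" "h \<in> arrows H" "?s z = rng H g" "src H g = rng H h"
      then have "src K z = rng K (\<kappa> g)" using H_comp by auto
      then show "gmult K z (\<kappa> (gmult H g h)) = gmult K (gmult K z (\<kappa> g)) (\<kappa> h)"
        using * by (auto simp: topspace_gtop H.\<iota>_mult H.\<iota> intro!: G.K.mult_assoc[symmetric])
    next
      fix z h assume *: "z \<in> topspace ?Z" "h \<in> arrows H" "?s z = rng H h"
      then have "src K z = rng K (\<kappa> h)" using H_comp by auto
      then show "?s (gmult K z (\<kappa> h)) = src H h"
        using * by (simp add: topspace_gtop G.K.src_mult H.\<iota> H.G.src_closed)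
    next
      fix z assume "z \<in> topspace ?Z"
      then show "gmult K z (\<kappa> (?s z)) = z" by (simp add: topspace_gtop H.\<iota>'_A G.K.src_mult_right)
    qed
    show "open_map ?Z (unit_space G) ?r"
      by (rule G.open_map_anchor) (auto intro: G.K.open_rng Z_open)
    show "open_map ?Z (unit_space H) ?s"
      by (rule H.open_map_anchor) (auto intro: G.K.open_src Z_open)
    show "?r ` topspace ?Z = units G"
    proof (intro equalityI subsetI)
      fix u assume u: "u \<in> units G"
      then have u': "u \<in> arrows G" "src G u = u" by (auto simp: G.G.units_iff)
      then have uA: "\<iota> u \<in> A" using G.\<iota>(5)[of u] by simp
      then obtain z where "z \<in> arrows K" "rng K z = \<iota> u" "src K z \<in> B"
        using H.A_full G.A_units unfolding G.K.full_in_iff by blast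
      then show "u \<in> ?r ` topspace ?Z"
        using uA u' by (intro image_eqI[of _ _ z]) (simp_all add: G.\<iota> topspace_gtop)
    qed (auto simp: G.\<iota>'_A)
    show "?s ` topspace ?Z = units H"
    proof (intro equalityI subsetI)
      fix u assume u: "u \<in> units H"
      then have u': "u \<in> arrows H" "src H u = u" by (auto simp: H.G.units_iff)
      then have uB: "\<kappa> u \<in> B" using H.\<iota>(5)[of u] by simp
      \<comment> \<open>Fullness of \<open>A\<close> yields an arrow in the wrong direction, from
        \<open>A\<close> to \<open>\<kappa> u\<close>; its inverse is the required point.\<close>
      then obtain z where "z \<in> arrows K" "rng K z = \<kappa> u" "src K z \<in> A"
        using G.A_full H.A_units unfolding G.K.full_in_iff by blast
      then show "u \<in> ?s ` topspace ?Z"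
        using uB u' by (intro image_eqI[of _ _ "ginv K z"])
          (simp_all add: H.\<iota> topspace_gtop G.K.inv_closed G.K.src_inv G.K.rng_inv)
    qed (auto simp: H.\<iota>'_A)
    have *: "src K z = src K w" if "z \<in> topspace ?Z" "w \<in> topspace ?Z" "?s z = ?s w" for z w
      using that H.\<iota>'_eq_iff by simp
    have **: "rng K z = rng K w" if "z \<in> topspace ?Z" "w \<in> topspace ?Z" "?r z = ?r w" for z w
      using that G.\<iota>'_eq_iff by simp
    let ?D = "subtopology (prod_topology ?Z ?Z) {(z, w). ?s z = ?s w}"
    have "continuous_map ?D (gtop G) (\<lambda>p. \<iota>' (gmult K (fst p) (ginv K (snd p))))"
    proof (rule G.continuous_map_\<iota>'[OF G.K.continuous_map_mult])
      show "continuous_map ?D (gtop K) fst" by (rule Z_cont[OF fst])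
      show "continuous_map ?D (gtop K) (\<lambda>p. ginv K (snd p))" by (rule G.K.continuous_map_ginv[OF Z_cont[OF snd]])
    qed (use * in \<open>auto simp: topspace_gtop G.K.rng_inv G.K.inv_closed G.K.rng_mult G.K.src_mult G.K.src_inv\<close>)
    then show "continuous_map ?D (gtop G) (\<lambda>(z, w). \<iota>' (gmult K z (ginv K w)))"
      by (simp add: case_prod_unfold)
    let ?D = "subtopology (prod_topology ?Z ?Z) {(z, w). ?r z = ?r w}"
    have "continuous_map ?D (gtop H) (\<lambda>p. \<kappa>' (gmult K (ginv K (snd p)) (fst p)))"
    proof (rule H.continuous_map_\<iota>'[OF G.K.continuous_map_mult])
      show "continuous_map ?D (gtop K) fst" by (rule Z_cont[OF fst])
      show "continuous_map ?D (gtop K) (\<lambda>p. ginv K (snd p))" by (rule G.K.continuous_map_ginv[OF Z_cont[OF snd]])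
    qed (use ** in \<open>auto simp: topspace_gtop G.K.rng_inv G.K.inv_closed G.K.rng_mult G.K.src_mult G.K.src_inv\<close>)
    then show "continuous_map ?D (gtop H) (\<lambda>(z, w). \<kappa>' (gmult K (ginv K w) z))"
      by (simp add: case_prod_unfold)
    fix z w assume zw: "z \<in> topspace ?Z" "w \<in> topspace ?Z"
    note simps = topspace_gtop G.K.inv_closed G.K.rng_inv G.K.src_inv G.K.mult_closed G.K.rng_mult G.K.src_mult
    show "src G (\<iota>' (gmult K z (ginv K w))) = ?r w" if "?s z = ?s w"
      using *[OF zw that] zw by (simp add: simps G.\<iota>')
    show "gmult K (\<iota> (\<iota>' (gmult K z (ginv K w)))) w = z" if "?s z = ?s w"
      using *[OF zw that] zw by (simp add: simps G.\<iota>' G.K.inv_mult_cancel_right)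
    show "rng H (\<kappa>' (gmult K (ginv K w) z)) = ?s w" if "?r z = ?r w"
      using **[OF zw that] zw by (simp add: simps H.\<iota>')
    show "gmult K w (\<kappa> (\<kappa>' (gmult K (ginv K w) z))) = z" if "?r z = ?r w"
      using **[OF zw that] zw by (simp add: simps H.\<iota>' G.K.mult_inv_cancel)
  next
    fix g w assume gw: "g \<in> arrows G" "w \<in> topspace ?Z" "src G g = ?r w"
    then show "\<iota>' (gmult K (gmult K (\<iota> g) w) (ginv K w)) = g"
      by (simp add: topspace_gtop G.K.mult_inv_cancel_right G.\<iota> G.\<iota>'_A)
    show "?s (gmult K (\<iota> g) w) = ?s w"
      using gw by (simp add: topspace_gtop G.K.src_mult G.\<iota> G.\<iota>'_A)
  next
    fix h w assume *: "h \<in> arrows H" "w \<in> topspace ?Z" "?s w = rng H h"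
    then have "src K w = rng K (\<kappa> h)" using H_comp by auto
    then show "\<kappa>' (gmult K (ginv K w) (gmult K w (\<kappa> h))) = h"
      using * by (simp add: topspace_gtop G.K.inv_mult_cancel H.\<iota>)
  next
    fix z h assume *: "z \<in> topspace ?Z" "h \<in> arrows H" "?s z = rng H h"
    then have sz: "src K z = rng K (\<kappa> h)" using H_comp by auto
    then show "?r (gmult K z (\<kappa> h)) = ?r z"
      using * by (simp add: topspace_gtop G.K.rng_mult H.\<iota>(1))
    fix g assume "g \<in> arrows G" "src G g = ?r z"
    then show "gmult K (gmult K (\<iota> g) z) (\<kappa> h) = gmult K (\<iota> g) (gmult K z (\<kappa> h))"
      using * sz by (intro G.K.mult_assoc) (simp_all add: topspace_gtop G.\<iota> H.\<iota>(1) G.\<iota>'_A)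
  qed
qed

text \<open>With the full relation acting on itself as second factor, this turns a bibundle between
  \<open>G\<close> and \<open>H\<close> into one between their stabilisations.\<close>

lemma bibundle_prod:
  assumes "bibundle G H Z r s l a d e" "bibundle G' H' Z' r' s' l' a' d' e'"
  shows "bibundle (prod_groupoid G G') (prod_groupoid H H') (prod_topology Z Z')
    (\<lambda>(z, z'). (r z, r' z')) (\<lambda>(z, z'). (s z, s' z'))
    (\<lambda>(g, g') (z, z'). (l g z, l' g' z')) (\<lambda>(z, z') (h, h'). (a z h, a' z' h'))
    (\<lambda>(z, z') (w, w'). (d z w, d' z' w')) (\<lambda>(z, z') (w, w'). (e z w, e' z' w'))"
proof -
  interpret X: bibundle G H Z r s l a d e by fact
  interpret Y: bibundle G' H' Z' r' s' l' a' d' e' by fact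
  show ?thesis
  proof (intro bibundle.intro bibundle_axioms.intro ample_groupoid_prod X.G.ample_groupoid_axioms
      X.H.ample_groupoid_axioms Y.G.ample_groupoid_axioms Y.H.ample_groupoid_axioms)
    show "left_action (prod_groupoid G G') (prod_topology Z Z') (\<lambda>(z, z'). (r z, r' z'))
        (\<lambda>(g, g') (z, z'). (l g z, l' g' z'))"
    proof
      show "continuous_map (prod_topology Z Z') (unit_space (prod_groupoid G G')) (\<lambda>(z, z'). (r z, r' z'))"
        unfolding unit_space_prod continuous_map_prod_top
        using X.L.anchor_continuous Y.L.anchor_continuous by simp
      show "continuous_map
          (subtopology (prod_topology (gtop (prod_groupoid G G')) (prod_topology Z Z'))
             {(g, z). src (prod_groupoid G G') g = (case z of (z, z') \<Rightarrow> (r z, r' z'))})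
          (prod_topology Z Z') (\<lambda>(g, z). (case g of (g, g') \<Rightarrow> \<lambda>(z, z'). (l g z, l' g' z')) z)"
        unfolding prod_groupoid_simps(1)
        by (rule continuous_map_prod_partial[OF X.L.act_continuous Y.L.act_continuous]) auto
    qed (auto simp: arrows_prod X.L.anchor_act X.L.act_act X.L.act_unit
        Y.L.anchor_act Y.L.act_act Y.L.act_unit)
    show "right_action (prod_groupoid H H') (prod_topology Z Z') (\<lambda>(z, z'). (s z, s' z'))
        (\<lambda>(z, z') (h, h'). (a z h, a' z' h'))"
    proof
      show "continuous_map (prod_topology Z Z') (unit_space (prod_groupoid H H')) (\<lambda>(z, z'). (s z, s' z'))"
        unfolding unit_space_prod continuous_map_prod_top
        using X.R.anchor_continuous Y.R.anchor_continuous by simp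
      show "continuous_map
          (subtopology (prod_topology (prod_topology Z Z') (gtop (prod_groupoid H H')))
             {(z, h). (case z of (z, z') \<Rightarrow> (s z, s' z')) = rng (prod_groupoid H H') h})
          (prod_topology Z Z') (\<lambda>(z, h). (case z of (z, z') \<Rightarrow> \<lambda>(h, h'). (a z h, a' z' h')) h)"
        unfolding prod_groupoid_simps(1)
        by (rule continuous_map_prod_partial[OF X.R.act_continuous Y.R.act_continuous]) auto
    qed (auto simp: arrows_prod X.R.anchor_act X.R.act_act X.R.act_unit
        Y.R.anchor_act Y.R.act_act Y.R.act_unit)
    show "open_map (prod_topology Z Z') (unit_space (prod_groupoid G G')) (\<lambda>(z, z'). (r z, r' z'))"
      unfolding unit_space_prod by (rule open_map_prod[OF X.open_r Y.open_r])
    show "open_map (prod_topology Z Z') (unit_space (prod_groupoid H H')) (\<lambda>(z, z'). (s z, s' z'))"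
      unfolding unit_space_prod by (rule open_map_prod[OF X.open_s Y.open_s])
    show "(\<lambda>(z, z'). (r z, r' z')) ` topspace (prod_topology Z Z') = units (prod_groupoid G G')"
      by (force simp: units_prod simp flip: X.surj_r Y.surj_r)
    show "(\<lambda>(z, z'). (s z, s' z')) ` topspace (prod_topology Z Z') = units (prod_groupoid H H')"
      by (force simp: units_prod simp flip: X.surj_s Y.surj_s)
    show "continuous_map
        (subtopology (prod_topology (prod_topology Z Z') (prod_topology Z Z'))
          {(z, w). (case z of (z, z') \<Rightarrow> (s z, s' z')) = (case w of (z, z') \<Rightarrow> (s z, s' z'))})
        (gtop (prod_groupoid G G')) (\<lambda>(z, w). (case z of (z, z') \<Rightarrow> \<lambda>(w, w'). (d z w, d' z' w')) w)"
      unfolding prod_groupoid_simps(1)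
      by (rule continuous_map_prod_partial[OF X.d_continuous Y.d_continuous]) auto
    show "continuous_map
        (subtopology (prod_topology (prod_topology Z Z') (prod_topology Z Z'))
          {(z, w). (case z of (z, z') \<Rightarrow> (r z, r' z')) = (case w of (z, z') \<Rightarrow> (r z, r' z'))})
        (gtop (prod_groupoid H H')) (\<lambda>(z, w). (case z of (z, z') \<Rightarrow> \<lambda>(w, w'). (e z w, e' z' w')) w)"
      unfolding prod_groupoid_simps(1)
      by (rule continuous_map_prod_partial[OF X.e_continuous Y.e_continuous]) auto
  qed (auto simp: arrows_prod X.s_l X.r_a X.l_a X.d_src X.l_d X.d_l X.e_rng X.a_e X.e_a
      Y.s_l Y.r_a Y.l_a Y.d_src Y.l_d Y.d_l Y.e_rng Y.a_e Y.e_a)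
qed

section \<open>Bisections\<close>

text \<open>The preimage of an open \<open>U\<close> under the inverse is the image of the
  intersection of \<open>W\<close> and \<open>U\<close>, which is open because \<open>p\<close> is
  an open map.\<close>

lemma continuous_map_inv_into:
  assumes "open_map Z Y p" "openin Z W" "inj_on p W"
  shows "continuous_map (subtopology Y (p ` W)) Z (inv_into W p)"
  unfolding continuous_map_def
proof (intro conjI allI impI)
  have W: "W \<subseteq> topspace Z" by (rule openin_subset[OF assms(2)])
  then show "inv_into W p \<in> topspace (subtopology Y (p ` W)) \<rightarrow> topspace Z"
    by (auto simp: inv_into_f_f[OF assms(3)])
  fix U assume U: "openin Z U"
  have pW: "p ` W \<subseteq> topspace Y" using assms(1,2) openin_subset by (fastforce simp: open_map_def)
  have "{y \<in> topspace (subtopology Y (p ` W)). inv_into W p y \<in> U} = p ` (W \<inter> U)"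
    using pW by (auto simp: inv_into_f_f[OF assms(3)])
  moreover have "openin Y (p ` (W \<inter> U))"
    using assms(1,2) U by (simp add: open_map_def openin_Int)
  then have "openin (subtopology Y (p ` W)) (p ` (W \<inter> U))"
    unfolding openin_subtopology by (intro exI[of _ "p ` (W \<inter> U)"]) auto
  ultimately show "openin (subtopology Y (p ` W)) {y \<in> topspace (subtopology Y (p ` W)). inv_into W p y \<in> U}"
    by (simp only:)
qed

context bibundle
begin

text \<open>For g from r(w) to r(x) with x and w in \<open>W\<close> there is exactly one h with x h
  = g w, and g is sent to it. Injectivity of \<open>r\<close> on \<open>W\<close> determines x and w
  from g; injectivity of \<open>s\<close> determines them from h, so the assignment can be
  reversed.\<close>

lemma isomorphic_bisection:
  assumes W: "openin Z W" and inj_r: "inj_on r W" and inj_s: "inj_on s W"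
  shows "groupoid_isomorphic (restrict_groupoid G (r ` W)) (restrict_groupoid H (s ` W))"
proof -
  define \<sigma> where "\<sigma> = inv_into W r"
  define \<tau> where "\<tau> = inv_into W s"
  have WZ: "W \<subseteq> topspace Z" by (rule openin_subset[OF W])
  have \<sigma>: "\<sigma> (r w) = w" if "w \<in> W" for w using that by (simp add: \<sigma>_def inv_into_f_f[OF inj_r])
  have \<tau>: "\<tau> (s w) = w" if "w \<in> W" for w using that by (simp add: \<tau>_def inv_into_f_f[OF inj_s])
  have \<sigma>_cont: "continuous_map T Z (\<lambda>t. \<sigma> (f t))"
    if "continuous_map T (gtop G) f" "\<And>t. t \<in> topspace T \<Longrightarrow> f t \<in> r ` W"
    for T :: "'t topology" and f
  proof -
    have "open_map Z (gtop G) r" using open_r by (simp add: open_map_def G.openin_unit_space)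
    then have inv: "continuous_map (subtopology (gtop G) (r ` W)) Z \<sigma>"
      unfolding \<sigma>_def using W inj_r by (rule continuous_map_inv_into)
    have "continuous_map T (subtopology (gtop G) (r ` W)) f"
      using that by (auto simp: continuous_map_in_subtopology)
    then show ?thesis using continuous_map_compose[OF _ inv] by (simp add: o_def)
  qed
  have \<tau>_cont: "continuous_map T Z (\<lambda>t. \<tau> (f t))"
    if "continuous_map T (gtop H) f" "\<And>t. t \<in> topspace T \<Longrightarrow> f t \<in> s ` W"
    for T :: "'t topology" and f
  proof -
    have "open_map Z (gtop H) s" using open_s by (simp add: open_map_def H.openin_unit_space)
    then have inv: "continuous_map (subtopology (gtop H) (s ` W)) Z \<tau>"
      unfolding \<tau>_def using W inj_s by (rule continuous_map_inv_into)
    have "continuous_map T (subtopology (gtop H) (s ` W)) f"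
      using that by (auto simp: continuous_map_in_subtopology)
    then show ?thesis using continuous_map_compose[OF _ inv] by (simp add: o_def)
  qed
  let ?P = "restrict_groupoid G (r ` W)" and ?Q = "restrict_groupoid H (s ` W)"
  \<comment> \<open>The section \<open>\<sigma>\<close> finds the points of \<open>W\<close> over
    the two ends of g, and right division solves x h = g w for h.\<close>
  define \<phi> where "\<phi> g = e (l g (\<sigma> (src G g))) (\<sigma> (rng G g))" for g
  define \<psi> where "\<psi> h = d (a (\<tau> (rng H h)) h) (\<tau> (src H h))" for h
  have \<phi>: "\<phi> g \<in> arrows H" "rng H (\<phi> g) = s x" "src H (\<phi> g) = s w" "a x (\<phi> g) = l g w"
    if g: "g \<in> arrows G" and x: "x \<in> W" "rng G g = r x" and w: "w \<in> W" "src G g = r w" for g x w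
  proof -
    have t: "x \<in> topspace Z" "w \<in> topspace Z" "l g w \<in> topspace Z" "r (l g w) = r x"
      using x w g WZ by (auto simp: l_closed L.anchor_act)
    have "\<phi> g = e (l g w) x" using x w by (simp add: \<phi>_def \<sigma>)
    then show "\<phi> g \<in> arrows H" "rng H (\<phi> g) = s x" "src H (\<phi> g) = s w" "a x (\<phi> g) = l g w"
      using t g w by (simp_all add: e_closed e_rng e_src a_e s_l)
  qed
  have \<psi>: "\<psi> h \<in> arrows G" "rng G (\<psi> h) = r x" "src G (\<psi> h) = r w" "l (\<psi> h) w = a x h"
    if h: "h \<in> arrows H" and x: "x \<in> W" "rng H h = s x" and w: "w \<in> W" "src H h = s w" for h x w
  proof -
    have t: "x \<in> topspace Z" "w \<in> topspace Z" "a x h \<in> topspace Z" "s (a x h) = s w"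
      using x w h WZ by (auto simp: a_closed R.anchor_act)
    have "\<psi> h = d (a x h) w" using x w by (simp add: \<psi>_def \<tau>)
    then show "\<psi> h \<in> arrows G" "rng G (\<psi> h) = r x" "src G (\<psi> h) = r w" "l (\<psi> h) w = a x h"
      using t h x by (simp_all add: d_closed d_rng d_src l_d r_a)
  qed
  have P: "g \<in> topspace (gtop ?P) \<longleftrightarrow> g \<in> arrows G \<and> rng G g \<in> r ` W \<and> src G g \<in> r ` W" for g
    by (simp add: topspace_gtop)
  have Q: "h \<in> topspace (gtop ?Q) \<longleftrightarrow> h \<in> arrows H \<and> rng H h \<in> s ` W \<and> src H h \<in> s ` W" for h
    by (simp add: topspace_gtop)
  have idP: "continuous_map (gtop ?P) (gtop G) (\<lambda>x. x)" and idQ: "continuous_map (gtop ?Q) (gtop H) (\<lambda>x. x)"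
    by (simp_all add: continuous_map_from_subtopology)
  have "homeomorphic_maps (gtop ?P) (gtop ?Q) \<phi> \<psi>"
    unfolding homeomorphic_maps_def
  proof (intro conjI ballI)
    have "continuous_map (gtop ?P) Z (\<lambda>g. l g (\<sigma> (src G g)))"
    proof (rule continuous_map_partial[OF L.act_continuous idP])
      show "continuous_map (gtop ?P) Z (\<lambda>g. \<sigma> (src G g))"
        by (rule \<sigma>_cont[OF G.continuous_map_src[OF idP]]) (simp only: P)
    qed (auto simp: P \<sigma> simp del: restrict_groupoid_simps)
    then have "continuous_map (gtop ?P) (gtop H) (\<lambda>g. e (l g (\<sigma> (src G g))) (\<sigma> (rng G g)))"
    proof (rule continuous_map_e)
      show "continuous_map (gtop ?P) Z (\<lambda>g. \<sigma> (rng G g))"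
        by (rule \<sigma>_cont[OF G.continuous_map_rng[OF idP]]) (simp only: P)
      fix g assume "g \<in> topspace (gtop ?P)"
      then obtain x w where "g \<in> arrows G" "x \<in> W" "rng G g = r x" "w \<in> W" "src G g = r w"
        unfolding P by blast
      then show "r (l g (\<sigma> (src G g))) = r (\<sigma> (rng G g))"
        using WZ by (simp add: \<sigma> L.anchor_act subset_iff)
    qed
    then have "continuous_map (gtop ?P) (gtop H) \<phi>" by (simp add: \<phi>_def[abs_def])
    moreover have "\<phi> g \<in> topspace (gtop ?Q)" if gP: "g \<in> topspace (gtop ?P)" for g
    proof -
      obtain x w where "g \<in> arrows G" "x \<in> W" "rng G g = r x" "w \<in> W" "src G g = r w"
        using gP unfolding P by blast
      then show ?thesis unfolding Q using \<phi>[of g x w] by simp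
    qed
    ultimately show "continuous_map (gtop ?P) (gtop ?Q) \<phi>"
      by (auto simp: continuous_map_in_subtopology)
    have "continuous_map (gtop ?Q) Z (\<lambda>h. a (\<tau> (rng H h)) h)"
    proof (rule continuous_map_partial[OF R.act_continuous _ idQ])
      show "continuous_map (gtop ?Q) Z (\<lambda>h. \<tau> (rng H h))"
        by (rule \<tau>_cont[OF H.continuous_map_rng[OF idQ]]) (simp only: Q)
    qed (auto simp: Q \<tau> simp del: restrict_groupoid_simps)
    then have "continuous_map (gtop ?Q) (gtop G) (\<lambda>h. d (a (\<tau> (rng H h)) h) (\<tau> (src H h)))"
    proof (rule continuous_map_d)
      show "continuous_map (gtop ?Q) Z (\<lambda>h. \<tau> (src H h))"
        by (rule \<tau>_cont[OF H.continuous_map_src[OF idQ]]) (simp only: Q)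
      fix h assume "h \<in> topspace (gtop ?Q)"
      then obtain x w where "h \<in> arrows H" "x \<in> W" "rng H h = s x" "w \<in> W" "src H h = s w"
        unfolding Q by blast
      then show "s (a (\<tau> (rng H h)) h) = s (\<tau> (src H h))"
        using WZ by (simp add: \<tau> R.anchor_act subset_iff)
    qed
    then have "continuous_map (gtop ?Q) (gtop G) \<psi>" by (simp add: \<psi>_def[abs_def])
    moreover have "\<psi> h \<in> topspace (gtop ?P)" if hQ: "h \<in> topspace (gtop ?Q)" for h
    proof -
      obtain x w where "h \<in> arrows H" "x \<in> W" "rng H h = s x" "w \<in> W" "src H h = s w"
        using hQ unfolding Q by blast
      then show ?thesis unfolding P using \<psi>[of h x w] by simp
    qed
    ultimately show "continuous_map (gtop ?Q) (gtop ?P) \<psi>"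
      by (auto simp: continuous_map_in_subtopology)
  next
    fix g assume "g \<in> topspace (gtop ?P)"
    then obtain x w where g: "g \<in> arrows G" and x: "x \<in> W" "rng G g = r x" and w: "w \<in> W" "src G g = r w"
      unfolding P by blast
    note f = \<phi>[OF g x w]
    have "\<psi> (\<phi> g) = d (a x (\<phi> g)) w" using f(2,3) x w by (simp add: \<psi>_def \<tau>)
    also have "\<dots> = g" using f(4) g w WZ by (simp add: d_l subset_iff)
    finally show "\<psi> (\<phi> g) = g" .
  next
    fix h assume "h \<in> topspace (gtop ?Q)"
    then obtain x w where h: "h \<in> arrows H" and x: "x \<in> W" "rng H h = s x" and w: "w \<in> W" "src H h = s w"
      unfolding Q by blast
    note f = \<psi>[OF h x w]
    have "\<phi> (\<psi> h) = e (l (\<psi> h) w) x" using f(2,3) x w by (simp add: \<phi>_def \<sigma>)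
    also have "\<dots> = h" using f(4) h x WZ by (simp add: e_a subset_iff)
    finally show "\<phi> (\<psi> h) = h" .
  qed
  moreover have "groupoid_hom ?P ?Q \<phi>"
    unfolding groupoid_hom_def
  proof (intro conjI ballI impI)
    fix g assume "g \<in> arrows ?P"
    then obtain x w where "g \<in> arrows G" "x \<in> W" "rng G g = r x" "w \<in> W" "src G g = r w"
      unfolding arrows_restrict by blast
    then show "\<phi> g \<in> arrows ?Q" unfolding arrows_restrict using \<phi>[of g x w] by simp
  next
    fix g g' assume gg': "g \<in> arrows ?P" "g' \<in> arrows ?P" "src ?P g = rng ?P g'"
    then obtain x y w where g: "g \<in> arrows G" and x: "x \<in> W" "rng G g = r x" and y: "y \<in> W" "src G g = r y"
      and g': "g' \<in> arrows G" and y': "rng G g' = r y" and w: "w \<in> W" "src G g' = r w"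
      unfolding arrows_restrict by auto
    note f = \<phi>[OF g x y] and f' = \<phi>[OF g' y(1) y' w]
    have t: "x \<in> topspace Z" "y \<in> topspace Z" "w \<in> topspace Z" using x y w WZ by auto
    show "src ?Q (\<phi> g) = rng ?Q (\<phi> g')" using f f' by simp
    let ?g = "gmult G g g'"
    have g'': "?g \<in> arrows G" "rng G ?g = r x" "src G ?g = r w"
      using g g' x y y' w by (simp_all add: G.mult_closed G.rng_mult G.src_mult)
    \<comment> \<open>With h and h' the images of g and g', the chain is g (g' w) = g (y h') = (g y)
      h' = (x h) h'. The third expression uses that the two actions commute.\<close>
    have "l ?g w = l g (l g' w)" using g g' t y y' w by (simp add: L.act_act)
    also have "\<dots> = l g (a y (\<phi> g'))" using f'(4) by simp
    also have "\<dots> = a (l g y) (\<phi> g')" using g t y f' by (simp add: l_a)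
    also have "\<dots> = a (a x (\<phi> g)) (\<phi> g')" using f(4) by simp
    also have "\<dots> = a x (gmult H (\<phi> g) (\<phi> g'))" using f f' t by (simp add: R.act_act)
    finally have eq: "l ?g w = a x (gmult H (\<phi> g) (\<phi> g'))" .
    have "\<phi> ?g = e (l ?g w) x" using g'' x w by (simp add: \<phi>_def \<sigma>)
    also have "\<dots> = gmult H (\<phi> g) (\<phi> g')"
      unfolding eq using f f' t by (simp add: e_a H.mult_closed H.rng_mult)
    finally show "\<phi> (gmult ?P g g') = gmult ?Q (\<phi> g) (\<phi> g')" by simp
  qed
  ultimately show ?thesis
    using groupoid_isomorphicI(2)[OF G.groupoid_restrict H.groupoid_restrict] by blast
qed

end

section \<open>Compact open bisections and their assembly\<close>

definition compact_open_bisection :: "'z topology \<Rightarrow> ('z \<Rightarrow> 'a) \<Rightarrow> ('z \<Rightarrow> 'b) \<Rightarrow> 'z set \<Rightarrow> bool" where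
  "compact_open_bisection Z r s U \<longleftrightarrow> compactin Z U \<and> openin Z U \<and> inj_on r U \<and> inj_on s U"

lemma compact_open_bisection_flip:
  "compact_open_bisection Z r s U \<longleftrightarrow> compact_open_bisection Z s r U"
  by (auto simp: compact_open_bisection_def)

text \<open>A compact image in the Hausdorff space \<open>X\<close> is closed. The bisection itself
  need not be closed in \<open>Z\<close>, since \<open>Z\<close> may fail to be Hausdorff.\<close>

lemma compact_open_bisection_image:
  assumes "Hausdorff_space X" "continuous_map Z X r" "open_map Z X r" "compact_open_bisection Z r s U"
  shows "openin X (r ` U)" "closedin X (r ` U)"
  using assms image_compactin[of Z U X r] compactin_imp_closedin[of X "r ` U"]
  by (auto simp: compact_open_bisection_def open_map_def)

lemma compact_open_bisection_Int:
  assumes "compact_open_bisection Z r s U" "openin Z F" "closedin Z F"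
  shows "compact_open_bisection Z r s (U \<inter> F)"
  using assms closed_Int_compactin[of Z F U]
  by (auto simp: compact_open_bisection_def openin_Int inj_on_Int Int_commute)

text \<open>Intersecting with such a clopen set is the way to discard the points over an image
  already used while staying among compact open bisections.\<close>

lemma clopen_preimage_complement:
  assumes "continuous_map Z X r" "openin X A" "closedin X A"
  shows "openin Z {z \<in> topspace Z. r z \<notin> A}" "closedin Z {z \<in> topspace Z. r z \<notin> A}"
proof -
  have "{z \<in> topspace Z. r z \<notin> A} = {z \<in> topspace Z. r z \<in> topspace X - A}"
    using continuous_map_funspace[OF assms(1)] by blast
  moreover have "openin X (topspace X - A)" "closedin X (topspace X - A)"
    using assms by (simp_all add: openin_diff closedin_diff)
  then have "openin Z {z \<in> topspace Z. r z \<in> topspace X - A}" "closedin Z {z \<in> topspace Z. r z \<in> topspace X - A}"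
    using openin_continuous_map_preimage[OF assms(1)] closedin_continuous_map_preimage[OF assms(1)] by blast+
  ultimately show "openin Z {z \<in> topspace Z. r z \<notin> A}" "closedin Z {z \<in> topspace Z. r z \<notin> A}"
    by (simp_all only:)
qed

text \<open>Since \<open>V n\<close> avoids the images of the first \<open>n\<close> bisections, only finitely many of the sets
  \<open>r ` V n\<close> meet a given \<open>r ` U m\<close>; this local finiteness makes the image of their union closed.\<close>

lemma greedy_bisection:
  fixes U :: "nat \<Rightarrow> 'z set"
  assumes X: "Hausdorff_space X" "continuous_map Z X r" "open_map Z X r"
    and Y: "Hausdorff_space Y" "continuous_map Z Y s" "open_map Z Y s"
    and U: "\<And>n. compact_open_bisection Z r s (U n)"
    and cover: "(\<Union>n. r ` U n) = topspace X"
  defines "V \<equiv> \<lambda>n. {z \<in> U n. r z \<notin> (\<Union>i<n. r ` U i) \<and> s z \<notin> (\<Union>i<n. s ` U i)}"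
  shows "openin Z (\<Union>n. V n)" and "inj_on r (\<Union>n. V n)" and "closedin X (r ` (\<Union>n. V n))"
proof -
  have U': "compact_open_bisection Z s r (U n)" for n
    using U compact_open_bisection_flip by metis
  have UZ: "U n \<subseteq> topspace Z" for n
    using U openin_subset unfolding compact_open_bisection_def by blast
  have A: "openin X (\<Union>i<n. r ` U i)" "closedin X (\<Union>i<n. r ` U i)" for n
    using compact_open_bisection_image[OF X U] by (auto intro: closedin_Union)
  have B: "openin Y (\<Union>i<n. s ` U i)" "closedin Y (\<Union>i<n. s ` U i)" for n
    using compact_open_bisection_image[OF Y U'] by (auto intro: closedin_Union)
  have V: "compact_open_bisection Z r s (V n)" for n
  proof -
    \<comment> \<open>In this form \<open>V n\<close> is \<open>U n\<close> cut by two clopen sets,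
      one from each anchor.\<close>
    have eq: "V n = (U n \<inter> {z \<in> topspace Z. r z \<notin> (\<Union>i<n. r ` U i)}) \<inter> {z \<in> topspace Z. s z \<notin> (\<Union>i<n. s ` U i)}"
      using UZ by (auto simp: V_def)
    show ?thesis
      unfolding eq
      by (intro compact_open_bisection_Int U clopen_preimage_complement[OF X(2) A]
          clopen_preimage_complement[OF Y(2) B])
  qed
  show "openin Z (\<Union>n. V n)"
    using V by (auto simp: compact_open_bisection_def)
  show "inj_on r (\<Union>n. V n)"
  proof (rule inj_onI)
    fix z w assume "z \<in> (\<Union>n. V n)" "w \<in> (\<Union>n. V n)" and eq: "r z = r w"
    then obtain m n where mn: "z \<in> V m" "w \<in> V n" by blast
    have lt: "r y \<notin> r ` U i" if "y \<in> V j" "i < j" for y i j using that by (auto simp: V_def)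
    \<comment> \<open>If the indices differed, the common value would lie in the image of the
      earlier \<open>U\<close>, which the later \<open>V\<close> excludes.\<close>
    have "r z \<in> r ` U m" "r w \<in> r ` U n" using mn by (auto simp: V_def)
    then have "m = n"
      using eq lt[OF mn(1), of n] lt[OF mn(2), of m] by (cases m n rule: linorder_cases) auto
    then show "z = w" using mn eq V[of n] by (auto simp: compact_open_bisection_def inj_on_def)
  qed
  show "closedin X (r ` (\<Union>n. V n))"
    unfolding closedin_def
  proof
    have "V n \<subseteq> U n" for n by (auto simp: V_def)
    then show "r ` (\<Union>n. V n) \<subseteq> topspace X" unfolding cover[symmetric] by blast
    show "openin X (topspace X - r ` (\<Union>n. V n))"
    proof (subst openin_subopen, intro ballI)
      fix x assume x: "x \<in> topspace X - r ` (\<Union>n. V n)"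
      then have "x \<in> (\<Union>n. r ` U n)" unfolding cover by blast
      then obtain n where n: "x \<in> r ` U n" by blast
      let ?N = "r ` U n - (\<Union>i\<le>n. r ` V i)"
      have "closedin X (\<Union>i\<le>n. r ` V i)"
        using compact_open_bisection_image(2)[OF X V] by (auto intro: closedin_Union)
      then have "openin X ?N"
        using compact_open_bisection_image(1)[OF X U] by (simp add: openin_diff)
      moreover have "?N \<subseteq> topspace X - r ` (\<Union>n. V n)"
      proof
        fix y assume y: "y \<in> ?N"
        have "y \<notin> r ` V m" for m
        proof (cases "m \<le> n")
          case False
          then have "r z \<notin> r ` U n" if "z \<in> V m" for z using that by (auto simp: V_def)
          then show ?thesis using y by blast
        qed (use y in blast)
        moreover have "y \<in> topspace X" unfolding cover[symmetric] using y by blast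
        ultimately show "y \<in> topspace X - r ` (\<Union>n. V n)" by blast
      qed
      ultimately show "\<exists>T. openin X T \<and> x \<in> T \<and> T \<subseteq> topspace X - r ` (\<Union>n. V n)"
        using x n by (intro exI[of _ ?N]) blast
    qed
  qed
qed

lemma inj_on_Un_disjoint:
  assumes "inj_on f A" "inj_on f B" "f ` B \<inter> f ` A = {}"
  shows "inj_on f (A \<union> B)"
  unfolding inj_on_Un using assms by blast

text \<open>Only the part of \<open>V\<close> whose r-values are new is added. This keeps
  \<open>r\<close> injective, \<open>disj\<close> keeps \<open>s\<close> injective, and the omitted
  points have r-values already attained on \<open>S\<close>.\<close>

lemma extend_bisection:
  assumes X: "Hausdorff_space X" "continuous_map Z X r" "open_map Z X r"
    and S: "compact_open_bisection Z r s S" and V: "compact_open_bisection Z r s V"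
    and disj: "s ` V \<inter> s ` S = {}"
  obtains S' where "compact_open_bisection Z r s S'" "S \<subseteq> S'" "r ` V \<subseteq> r ` S'"
proof
  let ?V = "V \<inter> {z \<in> topspace Z. r z \<notin> r ` S}"
  have VZ: "V \<subseteq> topspace Z" using V openin_subset unfolding compact_open_bisection_def by blast
  have V': "compact_open_bisection Z r s ?V"
    by (intro compact_open_bisection_Int V clopen_preimage_complement[OF X(2)]
        compact_open_bisection_image[OF X S])
  have "inj_on r S" "inj_on r ?V" "inj_on s S" "inj_on s ?V"
    using S V' by (simp_all only: compact_open_bisection_def)
  moreover have "r ` ?V \<inter> r ` S = {}" "s ` ?V \<inter> s ` S = {}" using disj by blast+
  ultimately have "inj_on r (S \<union> ?V)" "inj_on s (S \<union> ?V)"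
    by - (rule inj_on_Un_disjoint; assumption)+
  then show "compact_open_bisection Z r s (S \<union> ?V)"
    using S V' unfolding compact_open_bisection_def by (simp add: compactin_Un openin_Un)
  show "S \<subseteq> S \<union> ?V" by blast
  show "r ` V \<subseteq> r ` (S \<union> ?V)" using VZ by blast
qed

text \<open>Stage n absorbs the images of \<open>U n\<close> on both sides. Before a piece is added,
  its image on the opposite side has to be moved away from everything used so far; the two shift
  hypotheses isolate this need for room.\<close>

lemma exhausting_bisection:
  fixes U :: "nat \<Rightarrow> 'z set"
  assumes X: "Hausdorff_space X" "continuous_map Z X r" "open_map Z X r"
    and Y: "Hausdorff_space Y" "continuous_map Z Y s" "open_map Z Y s"
    and cover: "(\<Union>n. r ` U n) = topspace X" "(\<Union>n. s ` U n) = topspace Y"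
    and shift_s: "\<And>S n. compact_open_bisection Z r s S \<Longrightarrow>
      \<exists>V. compact_open_bisection Z r s V \<and> r ` V = r ` U n \<and> s ` V \<inter> s ` S = {}"
    and shift_r: "\<And>S n. compact_open_bisection Z r s S \<Longrightarrow>
      \<exists>V. compact_open_bisection Z r s V \<and> s ` V = s ` U n \<and> r ` V \<inter> r ` S = {}"
  obtains W where "openin Z W" "inj_on r W" "inj_on s W" "r ` W = topspace X" "s ` W = topspace Y"
proof -
  let ?b = "compact_open_bisection Z r s"
  have "\<exists>S. \<forall>n. ?b (S n) \<and> (S n \<subseteq> S (Suc n) \<and> r ` U n \<subseteq> r ` S (Suc n) \<and> s ` U n \<subseteq> s ` S (Suc n))"
  proof (rule dependent_nat_choice)
    show "\<exists>S. ?b S" by (intro exI[of _ "{}"]) (simp add: compact_open_bisection_def)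
  next
    fix S n assume S: "?b S"
    obtain V where V: "?b V" "r ` V = r ` U n" "s ` V \<inter> s ` S = {}" using shift_s[OF S] by blast
    obtain S' where S': "?b S'" "S \<subseteq> S'" "r ` V \<subseteq> r ` S'" by (rule extend_bisection[OF X S V(1,3)])
    obtain V' where V': "?b V'" "s ` V' = s ` U n" "r ` V' \<inter> r ` S' = {}" using shift_r[OF S'(1)] by blast
    \<comment> \<open>The same extension with \<open>r\<close> and \<open>s\<close> exchanged,
      starting from the already enlarged \<open>S'\<close>.\<close>
    obtain T where T: "?b T" "S' \<subseteq> T" "s ` V' \<subseteq> s ` T"
      using extend_bisection[OF Y _ _ V'(3)] S'(1) V'(1) compact_open_bisection_flip by metis
    show "\<exists>T. ?b T \<and> (S \<subseteq> T \<and> r ` U n \<subseteq> r ` T \<and> s ` U n \<subseteq> s ` T)"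
    proof (intro exI[of _ T] conjI)
      show "S \<subseteq> T" using S' T by blast
      show "r ` U n \<subseteq> r ` T" using S'(3) T(2) V(2) by blast
      show "s ` U n \<subseteq> s ` T" using T(3) V'(2) by blast
    qed (rule T)
  qed
  then obtain S where step: "\<forall>n. ?b (S n) \<and> (S n \<subseteq> S (Suc n) \<and> r ` U n \<subseteq> r ` S (Suc n) \<and> s ` U n \<subseteq> s ` S (Suc n))"
    by (rule exE)
  then have S: "?b (S n)" "S n \<subseteq> S (Suc n)" "r ` U n \<subseteq> r ` S (Suc n)" "s ` U n \<subseteq> s ` S (Suc n)" for n
    by simp_all
  have mono: "S m \<subseteq> S n" if "m \<le> n" for m n using S(2) that by (rule lift_Suc_mono_le)
  \<comment> \<open>Along a chain any two points lie in a common member, so injectivity passes to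
    the union.\<close>
  have chain: "S m \<subseteq> S n \<or> S n \<subseteq> S m" for m n using mono[of m n] mono[of n m] by linarith
  have op: "openin Z (\<Union>n. S n)" using S(1) by (auto simp: compact_open_bisection_def)
  have sub: "(\<Union>n. S n) \<subseteq> topspace Z" by (rule openin_subset[OF op])
  show thesis
  proof (rule that[OF op])
    show "inj_on r (\<Union>n. S n)" "inj_on s (\<Union>n. S n)"
      using S(1) chain by (auto intro!: inj_on_UNION_chain simp: compact_open_bisection_def)
    show "r ` (\<Union>n. S n) = topspace X"
    proof
      show "r ` (\<Union>n. S n) \<subseteq> topspace X" using sub continuous_map_funspace[OF X(2)] by blast
      have "r ` U n \<subseteq> r ` (\<Union>n. S n)" for n using S(3)[of n] by blast
      then have "(\<Union>n. r ` U n) \<subseteq> r ` (\<Union>n. S n)" by (rule UN_least)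
      then show "topspace X \<subseteq> r ` (\<Union>n. S n)" by (simp only: cover)
    qed
    show "s ` (\<Union>n. S n) = topspace Y"
    proof
      show "s ` (\<Union>n. S n) \<subseteq> topspace Y" using sub continuous_map_funspace[OF Y(2)] by blast
      have "s ` U n \<subseteq> s ` (\<Union>n. S n)" for n using S(4)[of n] by blast
      then have "(\<Union>n. s ` U n) \<subseteq> s ` (\<Union>n. S n)" by (rule UN_least)
      then show "topspace Y \<subseteq> s ` (\<Union>n. S n)" by (simp only: cover)
    qed
  qed
qed

section \<open>Countable covers of the unit spaces by bisections\<close>

context bibundle
begin

abbreviation bisection :: "'z set \<Rightarrow> bool" where
  "bisection \<equiv> compact_open_bisection Z r s"

text \<open>Both anchors are locally injective, \<open>r\<close> by the flipped bibundle. On a set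
  \<open>?V\<close> where both are, compactness is borrowed from the unit space: a compact open
  \<open>K\<close> inside r(V) is lifted along the inverse of \<open>r\<close>.\<close>

lemma bisection_basis:
  assumes z: "z \<in> topspace Z"
  obtains U where "bisection U" "z \<in> U"
proof -
  obtain V\<^sub>1 where V1: "openin Z V\<^sub>1" "z \<in> V\<^sub>1" "inj_on s V\<^sub>1" by (rule locally_injective_s[OF z])
  obtain V\<^sub>2 where V2: "openin Z V\<^sub>2" "z \<in> V\<^sub>2" "inj_on r V\<^sub>2" by (rule bibundle.locally_injective_s[OF flip z])
  let ?V = "V\<^sub>1 \<inter> V\<^sub>2"
  have V: "openin Z ?V" "z \<in> ?V" "inj_on r ?V" "inj_on s ?V"
    using V1 V2 by (auto simp: inj_on_Int openin_Int)
  have "openin (unit_space G) (r ` ?V)" using open_r V(1) by (simp add: open_map_def)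
  then obtain K where K: "compactin (unit_space G) K" "openin (unit_space G) K" "r z \<in> K" "K \<subseteq> r ` ?V"
    using G.compact_open_basis_units V(2) unfolding has_compact_open_basis_iff by blast
  let ?U = "inv_into ?V r ` K"
  \<comment> \<open>The lift is compact as a continuous image of \<open>K\<close>; the description
    as an intersection with a preimage makes it open.\<close>
  have U: "?U = ?V \<inter> {z \<in> topspace Z. r z \<in> K}"
  proof (intro equalityI subsetI)
    fix w assume "w \<in> ?U"
    then obtain v where "v \<in> ?V" "r v \<in> K" "w = inv_into ?V r (r v)" using K(4) by blast
    then show "w \<in> ?V \<inter> {z \<in> topspace Z. r z \<in> K}"
      using inv_into_f_f[OF V(3)] openin_subset[OF V(1)] by auto
  next
    fix w assume "w \<in> ?V \<inter> {z \<in> topspace Z. r z \<in> K}"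
    then show "w \<in> ?U" using inv_into_f_f[OF V(3), of w] by (intro image_eqI[of _ _ "r w"]) auto
  qed
  have "compactin (subtopology (unit_space G) (r ` ?V)) K"
    using K by (simp add: compactin_subtopology)
  then have "compactin Z ?U"
    using continuous_map_inv_into[OF open_r V(1,3)] by (rule image_compactin)
  moreover have "openin Z ?U"
    unfolding U using V(1) openin_continuous_map_preimage[OF L.anchor_continuous K(2)] by (rule openin_Int)
  ultimately have "bisection ?U"
    using V(3,4) U unfolding compact_open_bisection_def by (simp add: inj_on_Int)
  moreover have "z \<in> ?U" unfolding U using V(2) K(3) z by blast
  ultimately show thesis by (rule that)
qed

text \<open>Each member of a countable compact cover is covered by finitely many of the open
  r-images, and countably many finite families form a countable one.\<close>

lemma countable_bisection_cover:
  assumes "sigma_compact_space (unit_space G)"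
  obtains \<U> where "countable \<U>" "\<And>U. U \<in> \<U> \<Longrightarrow> bisection U" "(\<Union>U\<in>\<U>. r ` U) = units G"
proof -
  obtain \<C> where \<C>: "countable \<C>" "\<forall>K\<in>\<C>. compactin (unit_space G) K" "\<Union>\<C> = units G"
    using assms unfolding sigma_compact_space_def G.topspace_unit_space by metis
  have "\<exists>\<F>. finite \<F> \<and> \<F> \<subseteq> Collect bisection \<and> K \<subseteq> \<Union> ((`) r ` \<F>)" if K: "K \<in> \<C>" for K
  proof -
    have "openin (unit_space G) V" if "V \<in> (`) r ` Collect bisection" for V
      using that open_r by (auto simp: compact_open_bisection_def open_map_def)
    moreover have "K \<subseteq> \<Union> ((`) r ` Collect bisection)"
    proof
      fix u assume "u \<in> K"
      then obtain z where z: "z \<in> topspace Z" "u = r z" using K \<C>(3) surj_r by blast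
      obtain U where "bisection U" "z \<in> U" by (rule bisection_basis[OF z(1)])
      then show "u \<in> \<Union> ((`) r ` Collect bisection)" using z(2) by blast
    qed
    ultimately obtain \<V> where "finite \<V>" "\<V> \<subseteq> (`) r ` Collect bisection" "K \<subseteq> \<Union>\<V>"
      using compactinD[of "unit_space G" K "(`) r ` Collect bisection"] \<C>(2) K by metis
    then show ?thesis using finite_subset_image by metis
  qed
  then obtain \<F> where \<F>: "\<And>K. K \<in> \<C> \<Longrightarrow> finite (\<F> K)" "\<And>K. K \<in> \<C> \<Longrightarrow> \<F> K \<subseteq> Collect bisection"
    "\<And>K. K \<in> \<C> \<Longrightarrow> K \<subseteq> \<Union> ((`) r ` \<F> K)" by metis
  show thesis
  proof (rule that[of "\<Union>K\<in>\<C>. \<F> K"])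
    show "countable (\<Union>K\<in>\<C>. \<F> K)"
      using \<C>(1) \<F>(1) by (intro countable_UN) (auto intro: countable_finite)
    show b: "bisection U" if "U \<in> (\<Union>K\<in>\<C>. \<F> K)" for U using that \<F>(2) by blast
    show "(\<Union>U\<in>(\<Union>K\<in>\<C>. \<F> K). r ` U) = units G"
    proof
      have "r ` U \<subseteq> units G" if "U \<in> (\<Union>K\<in>\<C>. \<F> K)" for U
        using b[OF that] openin_subset r_units unfolding compact_open_bisection_def by blast
      then show "(\<Union>U\<in>(\<Union>K\<in>\<C>. \<F> K). r ` U) \<subseteq> units G" by blast
      show "units G \<subseteq> (\<Union>U\<in>(\<Union>K\<in>\<C>. \<F> K). r ` U)"
      proof
        fix u assume "u \<in> units G"
        then obtain K where K: "K \<in> \<C>" "u \<in> K" using \<C>(3) by blast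
        then obtain U where "U \<in> \<F> K" "u \<in> r ` U" using \<F>(3)[OF K(1)] by blast
        then show "u \<in> (\<Union>U\<in>(\<Union>K\<in>\<C>. \<F> K). r ` U)" using K by blast
      qed
    qed
  qed
qed

lemma bisection_sequence:
  assumes "sigma_compact_space (unit_space G)" "sigma_compact_space (unit_space H)"
  obtains U :: "nat \<Rightarrow> 'z set"
  where "\<forall>n. bisection (U n)" "(\<Union>n. r ` U n) = units G" "(\<Union>n. s ` U n) = units H"
proof -
  obtain \<U> where \<U>: "countable \<U>" "\<And>U. U \<in> \<U> \<Longrightarrow> bisection U" "(\<Union>U\<in>\<U>. r ` U) = units G"
    using countable_bisection_cover[OF assms(1)] by metis
  obtain \<V> where \<V>: "countable \<V>" "\<And>U. U \<in> \<V> \<Longrightarrow> bisection U" "(\<Union>U\<in>\<V>. s ` U) = units H"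
    using bibundle.countable_bisection_cover[OF flip assms(2)] compact_open_bisection_flip by metis
  \<comment> \<open>The empty bisection makes the family nonempty, as \<open>from_nat_into\<close>
    requires in order to enumerate exactly this family.\<close>
  let ?A = "insert {} (\<U> \<union> \<V>)"
  have b: "bisection A" if "A \<in> ?A" for A
    using that \<U>(2) \<V>(2) by (auto simp: compact_open_bisection_def)
  have cnt: "countable ?A" using \<U>(1) \<V>(1) by simp
  define U where "U = from_nat_into ?A"
  have rU: "range U = ?A" unfolding U_def by (rule range_from_nat_into[OF _ cnt]) simp
  have bU: "bisection (U n)" for n using b rU by blast
  have UZ: "U n \<subseteq> topspace Z" for n
    using bU openin_subset unfolding compact_open_bisection_def by blast
  show thesis
  proof (rule that)
    show "\<forall>n. bisection (U n)" using bU by blast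
    show "(\<Union>n. r ` U n) = units G"
    proof
      show "(\<Union>n. r ` U n) \<subseteq> units G" using UZ r_units by blast
      have "(\<Union>U\<in>\<U>. r ` U) \<subseteq> (\<Union>A\<in>range U. r ` A)" unfolding rU by blast
      then show "units G \<subseteq> (\<Union>n. r ` U n)" using \<U>(3) by simp
    qed
    show "(\<Union>n. s ` U n) = units H"
    proof
      show "(\<Union>n. s ` U n) \<subseteq> units H" using UZ s_units by blast
      have "(\<Union>U\<in>\<V>. s ` U) \<subseteq> (\<Union>A\<in>range U. s ` A)" unfolding rU by blast
      then show "units H \<subseteq> (\<Union>n. s ` U n)" using \<V>(3) by simp
    qed
  qed
qed

text \<open>Sigma-compactness is pushed through the bibundle: s-images of bisections are compact,
  and countably many bisections already cover the units of \<open>G\<close>. For fullness, a point z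
  over v is compared with a point w of a chosen bisection with the same r-value;
  \<open>e w z\<close> then leads from s(w) to v.\<close>

lemma sigma_compact_full_subset:
  assumes "sigma_compact_space (unit_space G)"
  obtains Y where "openin (unit_space H) Y" "full_in H Y" "sigma_compact_space (unit_space (restrict_groupoid H Y))"
proof -
  obtain \<U> where \<U>: "countable \<U>" "\<And>U. U \<in> \<U> \<Longrightarrow> bisection U" "(\<Union>U\<in>\<U>. r ` U) = units G"
    using countable_bisection_cover[OF assms(1)] by metis
  let ?Y = "\<Union>U\<in>\<U>. s ` U"
  have UZ: "U \<subseteq> topspace Z" if "U \<in> \<U>" for U
    using \<U>(2)[OF that] openin_subset unfolding compact_open_bisection_def by blast
  show thesis
  proof (rule that)
    show Y: "openin (unit_space H) ?Y"
      using \<U>(2) open_s by (auto simp: compact_open_bisection_def open_map_def)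
    show "full_in H ?Y"
      unfolding H.full_in_iff
    proof
      fix v assume "v \<in> units H"
      then have "v \<in> s ` topspace Z" by (simp only: surj_s)
      then obtain z where z: "z \<in> topspace Z" "s z = v" by blast
      then have "r z \<in> (\<Union>U\<in>\<U>. r ` U)" using \<U>(3) r_units by simp
      then obtain U w where w: "U \<in> \<U>" "w \<in> U" "r w = r z" by fastforce
      then have "w \<in> topspace Z" using UZ by blast
      then show "\<exists>h\<in>arrows H. rng H h = v \<and> src H h \<in> ?Y"
        using z w by (intro bexI[of _ "e w z"]) (auto simp: e_closed e_rng e_src)
    qed
    have K: "compactin (subtopology (unit_space H) ?Y) (s ` U)" if "U \<in> \<U>" for U
      using image_compactin[OF _ R.anchor_continuous, of U] \<U>(2)[OF that] that
      unfolding compactin_subtopology compact_open_bisection_def by blast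
    have "countable ((`) s ` \<U>)" using \<U>(1) by simp
    moreover have "\<forall>C\<in>(`) s ` \<U>. compactin (subtopology (unit_space H) ?Y) C" using K by blast
    moreover have "\<Union> ((`) s ` \<U>) = topspace (subtopology (unit_space H) ?Y)"
      using openin_subset[OF Y] by auto
    ultimately show "sigma_compact_space (unit_space (restrict_groupoid H ?Y))"
      unfolding H.unit_space_restrict sigma_compact_space_def by (intro exI conjI)
  qed
qed

end

section \<open>Kakutani equivalence and stable isomorphism\<close>

text \<open>The greedy choice discards a point as soon as either of its values is taken, so units
  may be missed on both sides. They are recovered only up to an arrow, which is what fullness asks
  for.\<close>

lemma (in bibundle) Kakutani_equivalent:
  assumes "sigma_compact_space (unit_space G)" "sigma_compact_space (unit_space H)"
  shows "Kakutani_equivalent G H"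
proof -
  obtain U :: "nat \<Rightarrow> 'z set" where bis_U: "\<forall>n. bisection (U n)"
    and cover_r: "(\<Union>n. r ` U n) = units G" and cover_s: "(\<Union>n. s ` U n) = units H"
    by (rule bisection_sequence[OF assms])
  have U: "bisection (U n)" for n using bis_U by blast
  define V where "V n = {z \<in> U n. r z \<notin> (\<Union>i<n. r ` U i) \<and> s z \<notin> (\<Union>i<n. s ` U i)}" for n
  \<comment> \<open>Both uses of \<open>greedy_bisection\<close> must yield the same
    \<open>W\<close>; the one with the anchors exchanged lists the two conditions in the other
    order.\<close>
  have V': "V = (\<lambda>n. {z \<in> U n. s z \<notin> (\<Union>i<n. s ` U i) \<and> r z \<notin> (\<Union>i<n. r ` U i)})"
    unfolding V_def[abs_def] by (simp add: conj_commute)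
  define W where "W = (\<Union>n. V n)"
  note X = G.Hausdorff_units L.anchor_continuous open_r
  note Y = H.Hausdorff_units R.anchor_continuous open_s
  note gr = greedy_bisection[OF X Y U, unfolded G.topspace_unit_space, OF cover_r, folded V_def, folded W_def]
  have U': "compact_open_bisection Z s r (U n)" for n using U compact_open_bisection_flip by metis
  note gs = greedy_bisection[OF Y X U', unfolded H.topspace_unit_space, OF cover_s, folded V', folded W_def]
  have WZ: "W \<subseteq> topspace Z" by (rule openin_subset[OF gr(1)])
  have UZ: "U n \<subseteq> topspace Z" for n
    using U openin_subset unfolding compact_open_bisection_def by blast
  \<comment> \<open>Strong induction on the index. A discarded z shares its r-value or its s-value
    with a point w of an earlier set. In the second case \<open>d z w\<close> leads from r(w) to
    r(z) and is composed with the arrow found for w.\<close>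
  have sat: "\<exists>g\<in>arrows G. rng G g = r z \<and> src G g \<in> r ` W" if "z \<in> U n" for n z
    using that
  proof (induction n arbitrary: z rule: less_induct)
    case (less n)
    have z: "z \<in> topspace Z" using less.prems UZ by blast
    consider "z \<in> V n" | i w where "i < n" "w \<in> U i" "r z = r w" | i w where "i < n" "w \<in> U i" "s z = s w"
      using less.prems unfolding V_def by blast
    then show ?case
    proof cases
      case 1
      then have "r z \<in> r ` W" by (auto simp: W_def)
      then show ?thesis using r_units[OF z] G.rng_unit[of "r z"] unfolding G.units_iff
        by (intro bexI[of _ "r z"]) auto
    next
      case 2
      then show ?thesis using less.IH[of i w] by simp
    next
      case 3
      have w: "w \<in> topspace Z" using 3 UZ by blast
      obtain g where g: "g \<in> arrows G" "rng G g = r w" "src G g \<in> r ` W"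
        using less.IH[of i w] 3 by blast
      then show ?thesis using z w 3
        by (intro bexI[of _ "gmult G (d z w) g"])
          (simp_all add: d_closed d_src d_rng G.mult_closed G.rng_mult G.src_mult)
    qed
  qed
  have "full_in G (r ` W)"
    unfolding G.full_in_iff
  proof
    fix u assume "u \<in> units G"
    then have "u \<in> (\<Union>n. r ` U n)" by (simp only: cover_r)
    then obtain n z where "z \<in> U n" "u = r z" by blast
    then show "\<exists>g\<in>arrows G. rng G g = u \<and> src G g \<in> r ` W" using sat by blast
  qed
  moreover have "full_in H (s ` W)"
    unfolding H.full_in_iff
  proof
    fix v assume "v \<in> units H"
    then have "v \<in> (\<Union>n. s ` U n)" by (simp only: cover_s)
    then obtain n z where z: "z \<in> U n" "v = s z" by blast
    then obtain g where "g \<in> arrows G" "rng G g = r z" "src G g \<in> r ` W" using sat by blast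
    then obtain w where g: "g \<in> arrows G" "rng G g = r z" "src G g = r w" and w: "w \<in> W" by blast
    have t: "z \<in> topspace Z" "w \<in> topspace Z" using z w UZ WZ by blast+
    \<comment> \<open>Fullness in \<open>H\<close> follows from that in \<open>G\<close>: the
      translated point g w lies over r(z), so dividing it by z gives an arrow from s(w) to
      v.\<close>
    have gw: "l g w \<in> topspace Z" "r (l g w) = r z" "s (l g w) = s w"
      using g t by (simp_all add: l_closed L.anchor_act s_l)
    show "\<exists>h\<in>arrows H. rng H h = v \<and> src H h \<in> s ` W"
      using gw t w z(2) by (intro bexI[of _ "e (l g w) z"]) (simp_all add: e_closed e_rng e_src)
  qed
  moreover have "openin (unit_space G) (r ` W)" "openin (unit_space H) (s ` W)"
    using open_r open_s gr(1) by (simp_all add: open_map_def)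
  ultimately show ?thesis
    unfolding Kakutani_equivalent_def
    using gr(3) gs(3) isomorphic_bisection[OF gr(1,2) gs(2)] by blast
qed

text \<open>Seeing \<open>G\<close> as a corner of itself lets one end of
  \<open>bibundle_between_corners\<close> be all of \<open>G\<close>.\<close>

lemma corner_units:
  assumes "ample_groupoid G"
  shows "corner G G (units G) id id"
proof -
  interpret ample_groupoid G by fact
  show ?thesis
  proof
    show "openin (unit_space G) (units G)" by (simp add: openin_unit_space open_units)
    show "full_in G (units G)"
      unfolding full_in_iff
    proof
      fix u assume "u \<in> units G"
      then show "\<exists>x\<in>arrows G. rng G x = u \<and> src G x \<in> units G"
        using rng_unit[of u] by (intro bexI[of _ u]) (simp_all add: units_iff)
    qed
    show "homeomorphic_maps (gtop G) (gtop (restrict_groupoid G (units G))) id id"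
      unfolding restrict_units by (simp add: homeomorphic_maps_id)
    show "groupoid_hom G (restrict_groupoid G (units G)) id" "groupoid_hom (restrict_groupoid G (units G)) G id"
      by (auto simp: groupoid_hom_def arrows_restrict rng_in_units src_in_units)
  qed
qed

lemma bibundle_full_relation:
  obtains l a d e where "bibundle full_relation full_relation (discrete_topology UNIV)
    (rng full_relation) (src full_relation) l a d e"
proof -
  have "src full_relation p \<in> units full_relation" "rng full_relation p \<in> units full_relation" for p
    by (cases p; simp add: units_full_relation)+
  then have "{z. rng full_relation z \<in> units full_relation \<and> src full_relation z \<in> units full_relation} = UNIV"
    by simp
  then show thesis
    using bibundle_between_corners[OF corner_units corner_units, OF ample_full_relation ample_full_relation]
      that by (simp add: id_def)
qed

lemma (in bibundle) stably_isomorphic: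
  assumes "sigma_compact_space (unit_space G)" "sigma_compact_space (unit_space H)"
  shows "groupoid_isomorphic (prod_groupoid G full_relation) (prod_groupoid H full_relation)"
proof -
  obtain U :: "nat \<Rightarrow> 'z set" where bis_U: "\<forall>n. bisection (U n)"
    and cover_r: "(\<Union>n. r ` U n) = units G" and cover_s: "(\<Union>n. s ` U n) = units H"
    by (rule bisection_sequence[OF assms])
  have U: "bisection (U n)" for n using bis_U by blast
  let ?R = "full_relation"
  let ?Z = "prod_topology Z (discrete_topology (UNIV :: (nat \<times> nat) set))"
  let ?r = "\<lambda>(z, p). (r z, rng ?R p)" and ?s = "\<lambda>(z, p). (s z, src ?R p)"
  obtain l\<^sub>R a\<^sub>R d\<^sub>R e\<^sub>R where "bibundle ?R ?R (discrete_topology UNIV) (rng ?R) (src ?R) l\<^sub>R a\<^sub>R d\<^sub>R e\<^sub>R"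
    by (rule bibundle_full_relation)
  note prod = bibundle_prod[OF bibundle_axioms this]
  interpret P: bibundle "prod_groupoid G ?R" "prod_groupoid H ?R" ?Z ?r ?s
    "\<lambda>(g, g') (z, z'). (l g z, l\<^sub>R g' z')" "\<lambda>(z, z') (h, h'). (a z h, a\<^sub>R z' h')"
    "\<lambda>(z, z') (w, w'). (d z w, d\<^sub>R z' w')" "\<lambda>(z, z') (w, w'). (e z w, e\<^sub>R z' w')"
    by (rule prod)
  \<comment> \<open>One natural number codes a bisection together with a level, so that each
    \<open>U m\<close> appears on every level.\<close>
  define U' where "U' n = (case prod_decode n of (m, j) \<Rightarrow> U m \<times> {(j, j)})" for n :: nat
  \<comment> \<open>In the label (j, k) the r-image sits on level j and the s-image on level k;
    either can be moved without touching the other.\<close>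
  have bis: "P.bisection (U m \<times> {(j, k)})" for m j k
    using U[of m] by (auto simp: compact_open_bisection_def compactin_Times openin_prod_Times_iff inj_on_def)
  have r_img: "?r ` (U m \<times> {(j, k)}) = r ` U m \<times> {(j, j)}" and s_img: "?s ` (U m \<times> {(j, k)}) = s ` U m \<times> {(k, k)}"
    for m j k by (force simp: image_iff)+
  have U'_ex: "\<exists>n. U' n = U m \<times> {(j, j)}" for m j
    by (rule exI[of _ "prod_encode (m, j)"]) (simp add: U'_def)
  have U'_cases: "\<exists>m j. U' n = U m \<times> {(j, j)}" for n
    by (cases "prod_decode n") (auto simp: U'_def)
  have levels: "finite (snd ` S)" if "P.bisection S" for S
  proof -
    have "compactin (discrete_topology UNIV) (snd ` S)"
      using that image_compactin[OF _ continuous_map_snd] unfolding compact_open_bisection_def by blast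
    then show ?thesis by (simp add: compactin_discrete_topology)
  qed
  obtain W where W: "openin ?Z W" "inj_on ?r W" "inj_on ?s W"
    "?r ` W = topspace (unit_space (prod_groupoid G ?R))" "?s ` W = topspace (unit_space (prod_groupoid H ?R))"
  proof (rule exhausting_bisection[OF P.G.Hausdorff_units P.L.anchor_continuous P.open_r
      P.H.Hausdorff_units P.R.anchor_continuous P.open_s, where U = U'])
    show "(\<Union>n. ?r ` U' n) = topspace (unit_space (prod_groupoid G ?R))"
      unfolding P.G.topspace_unit_space units_prod
    proof (intro equalityI subsetI)
      fix p assume "p \<in> (\<Union>n. ?r ` U' n)"
      then obtain n where "p \<in> ?r ` U' n" by blast
      then obtain m j where "p \<in> ?r ` (U m \<times> {(j, j)})" using U'_cases[of n] by metis
      then show "p \<in> units G \<times> units ?R"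
        using cover_r by (auto simp: units_full_relation)
    next
      fix p assume "p \<in> units G \<times> units ?R"
      then obtain u j where p: "p = (u, (j, j))" "u \<in> units G" by (auto simp: units_full_relation)
      then have "u \<in> (\<Union>n. r ` U n)" by (simp only: cover_r)
      then obtain m where "u \<in> r ` U m" by blast
      then have "p \<in> ?r ` (U m \<times> {(j, j)})" unfolding r_img using p by simp
      moreover obtain n where "U' n = U m \<times> {(j, j)}" using U'_ex by blast
      ultimately have "p \<in> ?r ` U' n" by (simp only:)
      then show "p \<in> (\<Union>n. ?r ` U' n)" by blast
    qed
    show "(\<Union>n. ?s ` U' n) = topspace (unit_space (prod_groupoid H ?R))"
      unfolding P.H.topspace_unit_space units_prod
    proof (intro equalityI subsetI)
      fix p assume "p \<in> (\<Union>n. ?s ` U' n)"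
      then obtain n where "p \<in> ?s ` U' n" by blast
      then obtain m j where "p \<in> ?s ` (U m \<times> {(j, j)})" using U'_cases[of n] by metis
      then show "p \<in> units H \<times> units ?R"
        using cover_s by (auto simp: units_full_relation)
    next
      fix p assume "p \<in> units H \<times> units ?R"
      then obtain u j where p: "p = (u, (j, j))" "u \<in> units H" by (auto simp: units_full_relation)
      then have "u \<in> (\<Union>n. s ` U n)" by (simp only: cover_s)
      then obtain m where "u \<in> s ` U m" by blast
      then have "p \<in> ?s ` (U m \<times> {(j, j)})" unfolding s_img using p by simp
      moreover obtain n where "U' n = U m \<times> {(j, j)}" using U'_ex by blast
      ultimately have "p \<in> ?s ` U' n" by (simp only:)
      then show "p \<in> (\<Union>n. ?s ` U' n)" by blast
    qed
  next
    fix S n assume S: "P.bisection S"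
    obtain m j where n: "U' n = U m \<times> {(j, j)}" using U'_cases by blast
    have "finite (snd ` snd ` S)" "finite (fst ` snd ` S)" using levels[OF S] by simp_all
    \<comment> \<open>The level k is fresh for the sources of \<open>S\<close> and i is fresh for
      the ranges of \<open>S\<close>.\<close>
    then obtain k i where k: "k \<notin> snd ` snd ` S" and i: "i \<notin> fst ` snd ` S"
      using ex_new_if_finite infinite_UNIV_nat by metis
    have "?s ` (U m \<times> {(j, k)}) \<inter> ?s ` S = {}"
    proof -
      have "snd q \<noteq> (k, k)" if "q \<in> ?s ` S" for q using that k by force
      moreover have "snd q = (k, k)" if "q \<in> ?s ` (U m \<times> {(j, k)})" for q
        using that unfolding s_img by auto
      ultimately show ?thesis by blast
    qed
    then show "\<exists>V. P.bisection V \<and> ?r ` V = ?r ` U' n \<and> ?s ` V \<inter> ?s ` S = {}"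
      unfolding n by (intro exI[of _ "U m \<times> {(j, k)}"] conjI bis) (simp_all only: r_img)
    have "?r ` (U m \<times> {(i, j)}) \<inter> ?r ` S = {}"
    proof -
      have "snd q \<noteq> (i, i)" if "q \<in> ?r ` S" for q using that i by force
      moreover have "snd q = (i, i)" if "q \<in> ?r ` (U m \<times> {(i, j)})" for q
        using that unfolding r_img by auto
      ultimately show ?thesis by blast
    qed
    then show "\<exists>V. P.bisection V \<and> ?s ` V = ?s ` U' n \<and> ?r ` V \<inter> ?r ` S = {}"
      unfolding n by (intro exI[of _ "U m \<times> {(i, j)}"] conjI bis) (simp_all only: s_img)
  qed
  \<comment> \<open>Both images of \<open>W\<close> are whole unit spaces, so the restrictions are
    the groupoids themselves.\<close>
  show ?thesis
    using P.isomorphic_bisection[OF W(1-3)]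
    unfolding W(4,5) P.G.topspace_unit_space P.H.topspace_unit_space
      P.G.restrict_units P.H.restrict_units .
qed

section \<open>Full open restrictions, stable isomorphism and equivalence spaces\<close>

text \<open>The arrows of \<open>G\<close> with source in \<open>X\<close> form a bibundle between
  \<open>G\<close> and its full corner, to which the stabilisation result applies.\<close>

lemma stably_isomorphic_full_open:
  assumes G: "ample_groupoid G" and K: "ample_groupoid K"
    and \<sigma>: "sigma_compact_space (unit_space G)" "sigma_compact_space (unit_space K)"
    and X: "openin (unit_space G) X" "full_in G X" and iso: "groupoid_isomorphic K (restrict_groupoid G X)"
  shows "groupoid_isomorphic (prod_groupoid G full_relation) (prod_groupoid K full_relation)"
proof -
  obtain \<iota> \<iota>' where "corner G K X \<iota> \<iota>'" by (rule corner_obtain[OF G K X iso])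
  from bibundle_between_corners[OF corner_units[OF G] this] show ?thesis
    using bibundle.stably_isomorphic \<sigma> by blast
qed

text \<open>The sets \<open>X\<close> and \<open>Y\<close> may fail to be sigma-compact, so neither
  restriction can be compared with \<open>G\<close> or \<open>H\<close> right away. Instead a
  sigma-compact full open part \<open>A\<close> of \<open>X\<close> is carried to a part
  \<open>B\<close> of \<open>Y\<close>, and both stabilisations are compared with that of
  \<open>?M\<close>.\<close>

lemma isomorphic_full_open_imp_stably_isomorphic:
  assumes G: "ample_groupoid G" and H: "ample_groupoid H"
    and \<sigma>: "sigma_compact_space (unit_space G)" "sigma_compact_space (unit_space H)"
    and X: "openin (unit_space G) X" "full_in G X" and Y: "openin (unit_space H) Y" "full_in H Y"
    and iso: "groupoid_isomorphic (restrict_groupoid G X) (restrict_groupoid H Y)"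
  shows "groupoid_isomorphic (prod_groupoid G full_relation) (prod_groupoid H full_relation)"
proof -
  interpret G: ample_groupoid G by fact
  interpret H: ample_groupoid H by fact
  let ?P = "restrict_groupoid G X" and ?Q = "restrict_groupoid H Y"
  have P: "ample_groupoid ?P" by (rule G.ample_groupoid_restrict[OF X(1)])
  have Q: "ample_groupoid ?Q" by (rule H.ample_groupoid_restrict[OF Y(1)])
  have refl: "groupoid_isomorphic K K" for K :: "'k tgroupoid"
    unfolding groupoid_isomorphic_def by (intro exI[of _ id]) (simp add: homeomorphic_maps_id groupoid_hom_def)
  obtain \<iota> \<iota>' where "corner G ?P X \<iota> \<iota>'" by (rule corner_obtain[OF G P X refl])
  note bdl = bibundle_between_corners[OF corner_units[OF G] this]
  \<comment> \<open>Applied to the bibundle between \<open>G\<close> and its restriction, this turns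
    sigma-compactness of the units of \<open>G\<close> into that of a full open part of
    \<open>X\<close>.\<close>
  obtain A where A: "openin (unit_space ?P) A" "full_in ?P A"
    "sigma_compact_space (unit_space (restrict_groupoid ?P A))"
    by (rule bibundle.sigma_compact_full_subset[OF bdl \<sigma>(1)])
  obtain B where B: "openin (unit_space ?Q) B" "full_in ?Q B"
    "groupoid_isomorphic (restrict_groupoid ?P A) (restrict_groupoid ?Q B)"
    by (rule isomorphic_restrict[OF P Q iso A(1,2)])
  have AX: "A \<subseteq> X" and BY: "B \<subseteq> Y"
    using openin_subset[OF A(1)] openin_subset[OF B(1)]
    by (auto simp: groupoid.topspace_unit_space[OF G.groupoid_restrict] G.units_restrict
        groupoid.topspace_unit_space[OF H.groupoid_restrict] H.units_restrict)
  let ?M = "restrict_groupoid H B"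
  have iso': "groupoid_isomorphic (restrict_groupoid G A) ?M"
    using B(3) unfolding restrict_restrict[OF AX] restrict_restrict[OF BY] .
  have A': "openin (unit_space G) A" "full_in G A"
    using A(1) X(1) G.full_in_trans[OF X(2) A(2)] openin_trans_full by (auto simp: G.unit_space_restrict)
  have B': "openin (unit_space H) B" "full_in H B"
    using B(1) Y(1) H.full_in_trans[OF Y(2) B(2)] openin_trans_full by (auto simp: H.unit_space_restrict)
  have M: "ample_groupoid ?M" by (rule H.ample_groupoid_restrict[OF B'(1)])
  have \<sigma>M: "sigma_compact_space (unit_space ?M)"
    using isomorphic_sigma_compact[OF G.groupoid_restrict H.groupoid_restrict iso'] A(3)
    unfolding restrict_restrict[OF AX] .
  have "groupoid_isomorphic (prod_groupoid G full_relation) (prod_groupoid ?M full_relation)"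
    by (rule stably_isomorphic_full_open[OF G M \<sigma>(1) \<sigma>M A' groupoid_isomorphic_sym[OF iso']])
  moreover have "groupoid_isomorphic (prod_groupoid H full_relation) (prod_groupoid ?M full_relation)"
    by (rule stably_isomorphic_full_open[OF H M \<sigma>(2) \<sigma>M B' refl])
  ultimately show ?thesis
    using groupoid_isomorphic_sym groupoid_isomorphic_trans by blast
qed

text \<open>Level 0 of the stabilisation of \<open>H\<close> is carried into \<open>?K\<close> by
  the inverse isomorphism, so that \<open>G\<close> and \<open>H\<close> become full corners of the
  same groupoid. The arrows between the corners form the equivalence space, and
  \<open>groupoid_equivalentI\<close> moves it to the prescribed type.\<close>

lemma stably_isomorphic_imp_equivalent:
  assumes G: "ample_groupoid G" and H: "ample_groupoid H"
    and iso: "groupoid_isomorphic (prod_groupoid G full_relation) (prod_groupoid H full_relation)"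
  shows "groupoid_equivalent G H"
proof -
  interpret G: ample_groupoid G by fact
  interpret H: ample_groupoid H by fact
  let ?K = "prod_groupoid G full_relation" and ?L = "prod_groupoid H full_relation"
  have K: "ample_groupoid ?K" and L: "ample_groupoid ?L"
    by (intro ample_groupoid_prod G H ample_full_relation)+
  note cG = isomorphic_corner[OF G.groupoid_axioms] and cH = isomorphic_corner[OF H.groupoid_axioms]
  obtain B where B: "openin (unit_space ?K) B" "full_in ?K B"
    "groupoid_isomorphic (restrict_groupoid ?L (units H \<times> {(0, 0)})) (restrict_groupoid ?K B)"
    by (rule isomorphic_restrict[OF L K groupoid_isomorphic_sym[OF iso] cH(2,3)])
  obtain \<iota> \<iota>' where \<iota>: "corner ?K G (units G \<times> {(0, 0)}) \<iota> \<iota>'"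
    by (rule corner_obtain[OF K G cG(2,3,1)])
  obtain \<kappa> \<kappa>' where \<kappa>: "corner ?K H B \<kappa> \<kappa>'"
    by (rule corner_obtain[OF K H B(1,2) groupoid_isomorphic_trans[OF cH(1) B(3)]])
  show ?thesis
    by (rule groupoid_equivalentI[OF H.groupoid_axioms
        bibundle.is_groupoid_equivalence[OF bibundle_between_corners[OF \<iota> \<kappa>]]])
qed

theorem theorem3p2:
  fixes G :: "'a tgroupoid" and H :: "'b tgroupoid"
  assumes "ample_groupoid G" and "ample_groupoid H"
    and "sigma_compact_space (unit_space G)" and "sigma_compact_space (unit_space H)"
  shows "(Kakutani_equivalent G H \<longleftrightarrow>
            (\<exists>X Y. openin (unit_space G) X \<and> full_in G X \<and> openin (unit_space H) Y \<and> full_in H Y \<and>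
               groupoid_isomorphic (restrict_groupoid G X) (restrict_groupoid H Y))) \<and>
         ((\<exists>X Y. openin (unit_space G) X \<and> full_in G X \<and> openin (unit_space H) Y \<and> full_in H Y \<and>
               groupoid_isomorphic (restrict_groupoid G X) (restrict_groupoid H Y)) \<longleftrightarrow>
            groupoid_equivalent G H) \<and>
         (groupoid_equivalent G H \<longleftrightarrow>
            groupoid_isomorphic (prod_groupoid G full_relation) (prod_groupoid H full_relation))"
proof -
  let ?K = "Kakutani_equivalent G H" and ?E = "groupoid_equivalent G H"
  let ?O = "\<exists>X Y. openin (unit_space G) X \<and> full_in G X \<and> openin (unit_space H) Y \<and> full_in H Y \<and>
    groupoid_isomorphic (restrict_groupoid G X) (restrict_groupoid H Y)"
  let ?S = "groupoid_isomorphic (prod_groupoid G full_relation) (prod_groupoid H full_relation)"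
  have "?K \<Longrightarrow> ?O"
    unfolding Kakutani_equivalent_def by blast
  moreover have "?O \<Longrightarrow> ?S"
    using isomorphic_full_open_imp_stably_isomorphic[OF assms] by blast
  moreover have "?S \<Longrightarrow> ?E"
    by (rule stably_isomorphic_imp_equivalent[OF assms(1,2)])
  moreover have "?E \<Longrightarrow> ?K"
  proof -
    assume ?E
    then obtain Z :: "('a \<times> 'b) topology" and r s l a where eq: "is_groupoid_equivalence G H Z r s l a"
      unfolding groupoid_equivalent_def by blast
    obtain d e where "bibundle G H Z r s l a d e"
      by (rule equivalence_imp_bibundle[OF assms(1,2) eq])
    then show ?K using assms(3,4) by (rule bibundle.Kakutani_equivalent)
  qed
  ultimately show ?thesis by blast
qed

end
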